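(* Let $M$ be an $m$-dimensional globally hyperbolic spacetime admitting a compact spacelike Cauchy surface and let $0\le k\le m$. Let $\omega_{\rm free}:\mathcal W(\mathsf{Top}^k_{\rm free}(M))\to\mathbb C$ be the linear functional specified by $$\omega_{\rm free}(W(u,\tilde u,z,\tilde z))=\begin{cases}1&\text{if }z=0,\ \tilde z=0,\\0&\text{otherwise.}\end{cases}$$ Then $\omega_{\rm free}$ is a state on the $C^*$-algebra $\mathcal W(\mathsf{Top}^k_{\rm free}(M))$. Furthermore, this state and its analogue on $\mathcal W(\mathsf{Top}^{m-k}_{\rm free}(M))$ satisfy $$\omega_{\rm free}\circ\mathcal W(\zeta_{\rm free})=\omega_{\rm free},$$ where $\mathcal W(\zeta_{\rm free}):\mathcal W(\mathsf{Top}^k_{\rm free}(M))\to\mathcal W(\mathsf{Top}^{m-k}_{\rm free}(M))$ is the $C^*$-isomorphism with $W(u,\tilde u,z,\tilde z)\mapsto W(\zeta_{\rm free}(u,\tilde u,z,\tilde z))$.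
   Context: A spacetime is an oriented and time-oriented (connected, finite type) Lorentzian manifold. $\mathbb T=\mathbb R/\mathbb Z$; $A^{p,q}=A^p\times A^q$ for a graded group $A$, groups in negative degree being $0$. $i_\Sigma:\Sigma\to M$ is the embedding of a compact spacelike Cauchy surface, oriented by the orientation and time-orientation of $M$. $H^p_{\rm free}(\cdot;\mathbb Z)$ is $H^p(\cdot;\mathbb Z)$ modulo torsion, $q$ the quotient map, viewed as a lattice in $H^p(\cdot;\mathbb R)$; $\mu:H^p(\cdot;\mathbb R)/H^p_{\rm free}(\cdot;\mathbb Z)\to H^p(\cdot;\mathbb T)$ is induced by $\mathbb R\to\mathbb T$. $\mathsf{Top}^k_{\rm free}(M)=\frac{H^{k-1,m-k-1}(M;\mathbb R)}{H^{k-1,m-k-1}_{\rm free}(M;\mathbb Z)}\oplus H^{k,m-k}_{\rm free}(M;\mathbb Z)$, with elements $(u,\tilde u,z,\tilde z)$ and symplectic form $\sigma_{\rm free}((u,\tilde u,z,\tilde z),(u',\tilde u',z',\tilde z'))=\langle\tilde u,z'\rangle-(-1)^{k(m-k)}\langle u,\tilde z'\rangle-\langle\tilde u',z\rangle+(-1)^{k(m-k)}\langle u',\tilde z\rangle\in\mathbb T$, where $\langle v,w\rangle=(\mu\,i_\Sigma^*v\smile i_\Sigma^*y)[\Sigma]\in\mathbb T$ (evaluation of a class in $H^{m-1}(\Sigma;\mathbb T)$ on the fundamental class) for any integral class $y$ with $qy=w$. Duality: $\zeta_{\rm free}:\mathsf{Top}^k_{\rm free}(M)\to\mathsf{Top}^{m-k}_{\rm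 free}(M)$, $(u,\tilde u,z,\tilde z)\mapsto(\tilde u,\varepsilon u,\tilde z,\varepsilon z)$ with $\varepsilon=(-1)^{k(m-k)+1}$; it preserves $\sigma_{\rm free}$. Weyl algebra: for an abelian group $G$ with antisymmetric bihomomorphism $\sigma:G\times G\to\mathbb T$, $\mathcal W(G)$ is the enveloping $C^*$-algebra of the Banach $*$-algebra obtained by completing, in the norm $\|\sum_j\alpha_jW(g_j)\|_1=\sum_j|\alpha_j|$ (distinct $g_j$), the unital $*$-algebra spanned by linearly independent symbols $W(g)$, $g\in G$, with $W(g)^*=W(-g)$, $W(g)W(g')=e^{2\pi i\sigma(g,g')}W(g+g')$. A functional given on generators is extended by linearity and continuity. *)

theory Defs
  imports "HOL-Analysis.Analysis" "HOL-Homology.Homology"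
begin

section \<open>Oriented and time-oriented Lorentzian manifolds\<close>

text \<open>For open \<open>S\<close>; class \<open>C\<^sup>k\<close> is tested on iterated directional derivatives.\<close>

primrec Ck_on :: "nat \<Rightarrow> 'v::euclidean_space set \<Rightarrow> ('v \<Rightarrow> 'w::real_normed_vector) \<Rightarrow> bool" where
  "Ck_on 0 S f \<longleftrightarrow> continuous_on S f"
| "Ck_on (Suc k) S f \<longleftrightarrow>
     f differentiable_on S \<and> (\<forall>v. Ck_on k S (\<lambda>x. frechet_derivative f (at x) v))"

definition smooth_on :: "'v::euclidean_space set \<Rightarrow> ('v \<Rightarrow> 'w::real_normed_vector) \<Rightarrow> bool" where
  "smooth_on S f \<longleftrightarrow> (\<forall>k. Ck_on k S f)"

text \<open>A chart is a pair of a domain and a coordinate map.  The dimension is the cardinality of the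
  index type, whose linear order is used to speak of the first coordinate and of ordered frames.\<close>

type_synonym ('a, 'n) chart = "'a set \<times> ('a \<Rightarrow> real ^ 'n)"

definition is_chart :: "'a topology \<Rightarrow> ('a, 'n::finite) chart \<Rightarrow> bool" where
  "is_chart X c \<longleftrightarrow> openin X (fst c) \<and> open (snd c ` fst c) \<and>
     homeomorphic_map (subtopology X (fst c)) (top_of_set (snd c ` fst c)) (snd c)"

definition transition :: "('a, 'n::finite) chart \<Rightarrow> ('a, 'n) chart \<Rightarrow> real ^ 'n \<Rightarrow> real ^ 'n" where
  "transition c d = snd d \<circ> inv_into (fst c) (snd c)"

definition jacobian :: "('a, 'n::finite) chart \<Rightarrow> ('a, 'n) chart \<Rightarrow> 'a \<Rightarrow> real ^ 'n ^ 'n" where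
  "jacobian c d p = matrix (frechet_derivative (transition c d) (at (snd c p)))"

definition oriented_compatible :: "('a, 'n::finite) chart \<Rightarrow> ('a, 'n) chart \<Rightarrow> bool" where
  "oriented_compatible c d \<longleftrightarrow>
     smooth_on (snd c ` (fst c \<inter> fst d)) (transition c d) \<and>
     smooth_on (snd d ` (fst c \<inter> fst d)) (transition d c) \<and>
     (\<forall>p \<in> fst c \<inter> fst d. det (jacobian c d p) > 0)"

text \<open>A maximal oriented smooth atlas encodes a smooth structure together with an orientation.\<close>

definition oriented_atlas :: "'a topology \<Rightarrow> ('a, 'n::finite) chart set \<Rightarrow> bool" where
  "oriented_atlas X \<A> \<longleftrightarrow>
     (\<forall>c \<in> \<A>. is_chart X c) \<and> (\<Union>c \<in> \<A>. fst c) = topspace X \<and>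
     (\<forall>c \<in> \<A>. \<forall>d \<in> \<A>. oriented_compatible c d) \<and>
     (\<forall>c. is_chart X c \<and> (\<forall>d \<in> \<A>. oriented_compatible c d) \<longrightarrow> c \<in> \<A>)"

text \<open>Finite type: there is a finite good cover.\<close>

definition finite_type :: "'a topology \<Rightarrow> bool" where
  "finite_type X \<longleftrightarrow>
     (\<exists>\<U>. finite \<U> \<and> (\<forall>U \<in> \<U>. openin X U) \<and> \<Union>\<U> = topspace X \<and>
        (\<forall>\<V> \<subseteq> \<U>. \<V> \<noteq> {} \<and> \<Inter>\<V> \<noteq> {} \<longrightarrow> contractible_space (subtopology X (\<Inter>\<V>))))"

text \<open>Tensor fields are given by their components at the points of each chart of the atlas.  The
  time-orientation is represented by a timelike vector field, declared to be future-pointing.\<close>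

record ('a, 'n) spacetime_data =
  pts :: "'a topology"
  atlas :: "('a, 'n) chart set"
  metric :: "('a, 'n) chart \<Rightarrow> 'a \<Rightarrow> real ^ 'n ^ 'n"
  future :: "('a, 'n) chart \<Rightarrow> 'a \<Rightarrow> real ^ 'n"

definition first_index :: "'n::{finite,linorder}" where
  "first_index = Min UNIV"

definition minkowski :: "real ^ 'n::{finite,linorder} ^ 'n::{finite,linorder}" where
  "minkowski = (\<chi> i j. if i = j then (if i = first_index then - 1 else 1) else 0)"

definition lorentz_form :: "real ^ 'n::{finite,linorder} ^ 'n::{finite,linorder} \<Rightarrow> bool" where
  "lorentz_form g \<longleftrightarrow> (\<exists>P :: real ^ 'n::{finite,linorder} ^ 'n::{finite,linorder}. invertible P \<and> transpose P ** g ** P = minkowski)"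

definition metric_form ::
    "('a, 'n::finite) spacetime_data \<Rightarrow> ('a, 'n) chart \<Rightarrow> 'a \<Rightarrow> real ^ 'n \<Rightarrow> real" where
  "metric_form M c p v = v \<bullet> (metric M c p *v v)"

definition spacetime :: "('a, 'n::{finite,linorder}) spacetime_data \<Rightarrow> bool" where
  "spacetime M \<longleftrightarrow>
     topspace (pts M) \<noteq> {} \<and> connected_space (pts M) \<and> Hausdorff_space (pts M) \<and>
     second_countable (pts M) \<and> finite_type (pts M) \<and> oriented_atlas (pts M) (atlas M) \<and>
     (\<forall>c \<in> atlas M.
        smooth_on (snd c ` fst c) (\<lambda>x. metric M c (inv_into (fst c) (snd c) x)) \<and>
        smooth_on (snd c ` fst c) (\<lambda>x. future M c (inv_into (fst c) (snd c) x)) \<and>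
        (\<forall>p \<in> fst c. lorentz_form (metric M c p) \<and> metric_form M c p (future M c p) < 0)) \<and>
     (\<forall>c \<in> atlas M. \<forall>d \<in> atlas M. \<forall>p \<in> fst c \<inter> fst d.
        metric M c p = transpose (jacobian c d p) ** metric M d p ** jacobian c d p \<and>
        future M d p = jacobian c d p *v future M c p)"

text \<open>An inextendible curve has an open interval as its domain and can be reparametrized so as to be
  defined on the whole real line.\<close>

definition timelike_curve ::
    "('a, 'n::{finite,linorder}) spacetime_data \<Rightarrow> (real \<Rightarrow> 'a) \<Rightarrow> bool" where
  "timelike_curve M \<gamma> \<longleftrightarrow> continuous_map euclideanreal (pts M) \<gamma> \<and>
     (\<forall>c \<in> atlas M. smooth_on {t. \<gamma> t \<in> fst c} (snd c \<circ> \<gamma>) \<and>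
        (\<forall>t. \<gamma> t \<in> fst c \<longrightarrow> metric_form M c (\<gamma> t) (vector_derivative (snd c \<circ> \<gamma>) (at t)) < 0))"

definition inextendible :: "('a, 'n::finite) spacetime_data \<Rightarrow> (real \<Rightarrow> 'a) \<Rightarrow> bool" where
  "inextendible M \<gamma> \<longleftrightarrow> (\<nexists>p. limitin (pts M) \<gamma> p at_top) \<and> (\<nexists>p. limitin (pts M) \<gamma> p at_bot)"

definition cauchy_surface :: "('a, 'n::{finite,linorder}) spacetime_data \<Rightarrow> 'a set \<Rightarrow> bool" where
  "cauchy_surface M S \<longleftrightarrow> S \<subseteq> topspace (pts M) \<and>
     (\<forall>\<gamma>. timelike_curve M \<gamma> \<and> inextendible M \<gamma> \<longrightarrow> (\<exists>!t. \<gamma> t \<in> S))"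

definition globally_hyperbolic :: "('a, 'n::{finite,linorder}) spacetime_data \<Rightarrow> bool" where
  "globally_hyperbolic M \<longleftrightarrow> (\<exists>S. cauchy_surface M S)"

text \<open>Around every point, an embedded hypersurface is the zero set of the first coordinate of some
  chart; by a reflection, that chart can be chosen oriented.\<close>

definition slice_chart ::
    "('a, 'n::{finite,linorder}) spacetime_data \<Rightarrow> 'a set \<Rightarrow> ('a, 'n) chart \<Rightarrow> bool" where
  "slice_chart M S c \<longleftrightarrow> c \<in> atlas M \<and>
     snd c ` (fst c \<inter> S) = {x \<in> snd c ` fst c. x $ first_index = 0}"

definition spacelike_hypersurface ::
    "('a, 'n::{finite,linorder}) spacetime_data \<Rightarrow> 'a set \<Rightarrow> bool" where
  "spacelike_hypersurface M S \<longleftrightarrow>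
     (\<forall>p \<in> S. \<exists>c. slice_chart M S c \<and> p \<in> fst c) \<and>
     (\<forall>c. slice_chart M S c \<longrightarrow>
        (\<forall>p \<in> fst c \<inter> S. \<forall>v. v \<noteq> 0 \<and> v $ first_index = 0 \<longrightarrow> metric_form M c p v > 0))"

definition compact_spacelike_cauchy_surface ::
    "('a, 'n::{finite,linorder}) spacetime_data \<Rightarrow> 'a set \<Rightarrow> bool" where
  "compact_spacelike_cauchy_surface M S \<longleftrightarrow>
     cauchy_surface M S \<and> spacelike_hypersurface M S \<and> compactin (pts M) S"


section \<open>The fundamental class of a spacelike hypersurface\<close>

text \<open>The rows are taken in the order of the index type.\<close>

definition frame_det :: "(nat \<Rightarrow> real ^ 'n::{finite,linorder}) \<Rightarrow> real" where
  "frame_det w = det ((\<chi> i. w (card {j. j < i})) :: real ^ 'n::{finite,linorder} ^ 'n::{finite,linorder})"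

text \<open>The affine simplex with vertices \<open>v 0, \<dots>, v n\<close> in the coordinates of \<open>c\<close>.\<close>

definition chart_simplex :: "('a, 'n::finite) chart \<Rightarrow> nat \<Rightarrow> (nat \<Rightarrow> real ^ 'n) \<Rightarrow> (nat \<Rightarrow> real) \<Rightarrow> 'a" where
  "chart_simplex c n v =
     (\<lambda>x \<in> standard_simplex n. inv_into (fst c) (snd c) (\<Sum>i\<le>n. x i *\<^sub>R v i))"

text \<open>A frame of the hypersurface is positive iff prefixing it with a future-pointing timelike vector
  gives a positive frame of the spacetime.  A fundamental class restricts at every point to the
  generator of local homology given by small affine simplices, with the sign of their edge frame.\<close>

definition is_fundamental_class ::
    "('a, 'n::{finite,linorder}) spacetime_data \<Rightarrow> 'a set \<Rightarrow> 'a chain set \<Rightarrow> bool" where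
  "is_fundamental_class M S h \<longleftrightarrow>
     (let n = CARD('n) - 1; Y = subtopology (pts M) S in
       h \<in> carrier (homology_group (int n) Y) \<and>
       (\<forall>c p v. let d = frame_det (\<lambda>i. if i = 0 then future M c p else v i - v 0) in
          slice_chart M S c \<and> p \<in> fst c \<inter> S \<and>
          convex hull (v ` {..n}) \<subseteq> snd c ` (fst c \<inter> S) \<and>
          snd c p \<in> rel_interior (convex hull (v ` {..n})) \<and> d \<noteq> 0 \<longrightarrow>
            hom_induced (int n) Y {} Y (topspace Y - {p}) id h =
            homologous_rel_set n Y (topspace Y - {p})
              (frag_cmul (if d > 0 then 1 else - 1) (frag_of (chart_simplex c n v)))))"

text \<open>There is exactly one such class if \<open>S\<close> is compact; the neutral element is a dummy value.\<close>

definition fundamental_class ::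
    "('a, 'n::{finite,linorder}) spacetime_data \<Rightarrow> 'a set \<Rightarrow> 'a chain set" where
  "fundamental_class M S =
     (if \<exists>h. is_fundamental_class M S h then SOME h. is_fundamental_class M S h
      else one (homology_group (int (CARD('n) - 1)) (subtopology (pts M) S)))"


section \<open>The circle group\<close>

definition int_diff_rel :: "real \<Rightarrow> real \<Rightarrow> bool" where
  "int_diff_rel x y \<longleftrightarrow> x - y \<in> \<int>"

lemma equivp_int_diff_rel: "equivp int_diff_rel"
proof (rule equivpI)
  show "reflp int_diff_rel"
    by (simp add: reflp_def int_diff_rel_def)
  show "symp int_diff_rel"
    unfolding symp_def int_diff_rel_def by (metis Ints_minus minus_diff_eq)
  show "transp int_diff_rel"
    unfolding transp_def int_diff_rel_def by (metis Ints_add diff_add_cancel add_diff_eq)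
qed

quotient_type circle = real / int_diff_rel
  by (rule equivp_int_diff_rel)

lift_definition to_circle :: "real \<Rightarrow> circle" is "\<lambda>x. x" .

instantiation circle :: ab_group_add
begin

lift_definition zero_circle :: circle is "0 :: real" .

lift_definition plus_circle :: "circle \<Rightarrow> circle \<Rightarrow> circle" is "(+)"
  unfolding int_diff_rel_def by (simp add: add_diff_add)

lift_definition uminus_circle :: "circle \<Rightarrow> circle" is uminus
  unfolding int_diff_rel_def by (metis Ints_minus minus_diff_minus)

definition minus_circle :: "circle \<Rightarrow> circle \<Rightarrow> circle" where
  "minus_circle s t = s + - t"

instance
proof
  fix a b c :: circle
  show "a + b + c = a + (b + c)"
    by transfer (simp add: int_diff_rel_def)
  show "a + b = b + a"
    by transfer (simp add: int_diff_rel_def)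
  show "0 + a = a"
    by transfer (simp add: int_diff_rel_def)
  show "- a + a = 0"
    by transfer (simp add: int_diff_rel_def)
  show "a - b = a + - b"
    by (simp add: minus_circle_def)
qed

end

lift_definition int_scale :: "int \<Rightarrow> circle \<Rightarrow> circle" is "\<lambda>n x. of_int n * x"
  unfolding int_diff_rel_def by (metis Ints_mult Ints_of_int right_diff_distrib)

text \<open>The character \<open>t \<mapsto> e\<^bsup>2\<pi>it\<^esup>\<close>.\<close>

lift_definition circle_exp :: "circle \<Rightarrow> complex" is "\<lambda>x. cis (2 * pi * x)"
proof -
  fix x y :: real
  assume "int_diff_rel x y"
  then obtain n where "x = y + of_int n"
    unfolding int_diff_rel_def Ints_def by (metis add.commute diff_add_cancel rangeE)
  then have "cis (2 * pi * x) = cis (2 * pi * y) * cis (2 * pi * of_int n)"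
    unfolding cis_mult by (simp add: distrib_left)
  moreover have "cis (2 * pi * of_int n) = 1"
    by (rule cis_multiple_2pi) simp
  ultimately show "cis (2 * pi * x) = cis (2 * pi * y)"
    by simp
qed


section \<open>Singular cohomology\<close>

text \<open>A cochain is a function on singular simplices, extended by \<open>0\<close>.  Degrees are integers, so all
  groups of negative degree are trivial.\<close>

type_synonym ('a, 'g) cochain = "((nat \<Rightarrow> real) \<Rightarrow> 'a) \<Rightarrow> 'g"
type_synonym ('a, 'g) cohom_class = "('a, 'g) cochain set"

definition cochains :: "int \<Rightarrow> 'a topology \<Rightarrow> ('a, 'g::ab_group_add) cochain set" where
  "cochains p X = {c. \<forall>s. c s \<noteq> 0 \<longrightarrow> 0 \<le> p \<and> singular_simplex (nat p) X s}"

definition coboundary ::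
    "int \<Rightarrow> 'a topology \<Rightarrow> ('a, 'g::ab_group_add) cochain \<Rightarrow> ('a, 'g) cochain" where
  "coboundary p X c =
     (\<lambda>s. if 0 \<le> p \<and> singular_simplex (nat p + 1) X s
          then \<Sum>i\<le>nat p + 1. (if even i then c (singular_face (nat p + 1) i s)
                              else - c (singular_face (nat p + 1) i s))
          else 0)"

definition cocycle_group :: "int \<Rightarrow> 'a topology \<Rightarrow> ('a, 'g::ab_group_add) cochain monoid" where
  "cocycle_group p X =
     \<lparr>carrier = {c \<in> cochains p X. coboundary p X c = (\<lambda>_. 0)},
      monoid.mult = (\<lambda>a b s. a s + b s), one = (\<lambda>_. 0)\<rparr>"

definition coboundaries :: "int \<Rightarrow> 'a topology \<Rightarrow> ('a, 'g::ab_group_add) cochain set" where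
  "coboundaries p X = coboundary (p - 1) X ` cochains (p - 1) X"

definition cohomology_group :: "int \<Rightarrow> 'a topology \<Rightarrow> ('a, 'g::ab_group_add) cohom_class monoid" where
  "cohomology_group p X = cocycle_group p X Mod coboundaries p X"

definition cohom_class :: "int \<Rightarrow> 'a topology \<Rightarrow> ('a, 'g::ab_group_add) cochain \<Rightarrow> ('a, 'g) cohom_class" where
  "cohom_class p X c = coboundaries p X #>\<^bsub>cocycle_group p X\<^esub> c"

text \<open>Maps on quotient groups are written as unions over all representatives; the sets in such a
  union are all equal.\<close>

definition cohom_coeff ::
    "('g \<Rightarrow> 'h) \<Rightarrow> int \<Rightarrow> 'a topology \<Rightarrow> ('a, 'g::ab_group_add) cohom_class \<Rightarrow> ('a, 'h::ab_group_add) cohom_class" where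
  "cohom_coeff \<theta> p X \<alpha> = (\<Union>c \<in> \<alpha>. cohom_class p X (\<theta> \<circ> c))"

definition cochain_pullback ::
    "int \<Rightarrow> 'b topology \<Rightarrow> ('b \<Rightarrow> 'a) \<Rightarrow> ('a, 'g::ab_group_add) cochain \<Rightarrow> ('b, 'g) cochain" where
  "cochain_pullback p Y f c =
     (\<lambda>s. if 0 \<le> p \<and> singular_simplex (nat p) Y s then c (simplex_map (nat p) f s) else 0)"

definition cohom_pullback ::
    "int \<Rightarrow> 'b topology \<Rightarrow> ('b \<Rightarrow> 'a) \<Rightarrow> ('a, 'g::ab_group_add) cohom_class \<Rightarrow> ('b, 'g) cohom_class" where
  "cohom_pullback p Y f \<alpha> = (\<Union>c \<in> \<alpha>. cohom_class p Y (cochain_pullback p Y f c))"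

text \<open>The Alexander--Whitney product for a biadditive pairing \<open>\<beta>\<close> of coefficients.\<close>

definition front_face :: "nat \<Rightarrow> ((nat \<Rightarrow> real) \<Rightarrow> 'a) \<Rightarrow> (nat \<Rightarrow> real) \<Rightarrow> 'a" where
  "front_face p s = restrict s (standard_simplex p)"

definition back_face :: "nat \<Rightarrow> nat \<Rightarrow> ((nat \<Rightarrow> real) \<Rightarrow> 'a) \<Rightarrow> (nat \<Rightarrow> real) \<Rightarrow> 'a" where
  "back_face p q s = (\<lambda>x \<in> standard_simplex q. s (\<lambda>i. if i < p then 0 else x (i - p)))"

definition cochain_cup ::
    "('g \<Rightarrow> 'h \<Rightarrow> 'k) \<Rightarrow> int \<Rightarrow> int \<Rightarrow> 'a topology \<Rightarrow>
     ('a, 'g::ab_group_add) cochain \<Rightarrow> ('a, 'h::ab_group_add) cochain \<Rightarrow> ('a, 'k::ab_group_add) cochain" where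
  "cochain_cup \<beta> p q X a b =
     (\<lambda>s. if 0 \<le> p \<and> 0 \<le> q \<and> singular_simplex (nat p + nat q) X s
          then \<beta> (a (front_face (nat p) s)) (b (back_face (nat p) (nat q) s)) else 0)"

definition cup ::
    "('g \<Rightarrow> 'h \<Rightarrow> 'k) \<Rightarrow> int \<Rightarrow> int \<Rightarrow> 'a topology \<Rightarrow>
     ('a, 'g::ab_group_add) cohom_class \<Rightarrow> ('a, 'h::ab_group_add) cohom_class \<Rightarrow> ('a, 'k::ab_group_add) cohom_class" where
  "cup \<beta> p q X A B = (\<Union>a \<in> A. \<Union>b \<in> B. cohom_class (p + q) X (cochain_cup \<beta> p q X a b))"

definition cochain_eval :: "('a, circle) cochain \<Rightarrow> 'a chain \<Rightarrow> circle" where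
  "cochain_eval c z = (\<Sum>s \<in> Poly_Mapping.keys z. int_scale (Poly_Mapping.lookup z s) (c s))"

definition cohom_eval :: "('a, circle) cohom_class \<Rightarrow> 'a chain set \<Rightarrow> circle" where
  "cohom_eval A h = (THE t. \<exists>c \<in> A. \<exists>z \<in> h. t = cochain_eval c z)"


section \<open>The topological degrees of freedom\<close>

type_synonym 'a real_class = "('a, real) cohom_class"
type_synonym 'a int_class = "('a, int) cohom_class"

definition torsion :: "('x, 'y) monoid_scheme \<Rightarrow> 'x set" where
  "torsion G = {x \<in> carrier G. \<exists>n::nat. n > 0 \<and> x [^]\<^bsub>G\<^esub> n = \<one>\<^bsub>G\<^esub>}"

definition H_free :: "int \<Rightarrow> 'a topology \<Rightarrow> 'a int_class set monoid" where
  "H_free p X = cohomology_group p X Mod torsion (cohomology_group p X)"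

text \<open>The image of \<open>H_free\<close> in real cohomology.\<close>

definition int_lattice :: "int \<Rightarrow> 'a topology \<Rightarrow> 'a real_class set" where
  "int_lattice p X = cohom_coeff real_of_int p X ` carrier (cohomology_group p X)"

definition H_flat :: "int \<Rightarrow> 'a topology \<Rightarrow> 'a real_class set monoid" where
  "H_flat p X = cohomology_group p X Mod int_lattice p X"

definition H_flat_pullback ::
    "int \<Rightarrow> 'b topology \<Rightarrow> ('b \<Rightarrow> 'a) \<Rightarrow> 'a real_class set \<Rightarrow> 'b real_class set" where
  "H_flat_pullback p Y f v =
     (\<Union>\<alpha> \<in> v. int_lattice p Y #>\<^bsub>cohomology_group p Y\<^esub> cohom_pullback p Y f \<alpha>)"

definition flat_to_circle :: "int \<Rightarrow> 'a topology \<Rightarrow> 'a real_class set \<Rightarrow> ('a, circle) cohom_class" where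
  "flat_to_circle p X v = (\<Union>\<alpha> \<in> v. cohom_coeff to_circle p X \<alpha>)"

text \<open>An element \<open>w\<close> of \<open>H_free\<close> is the set of all integral classes that project to it.\<close>

definition pairing ::
    "('a, 'n::{finite,linorder}) spacetime_data \<Rightarrow> 'a set \<Rightarrow> int \<Rightarrow> int \<Rightarrow>
     'a real_class set \<Rightarrow> 'a int_class set \<Rightarrow> circle" where
  "pairing M S p q v w =
     (let Y = subtopology (pts M) S; y = (SOME y. y \<in> w) in
       cohom_eval
         (cup (\<lambda>t n. int_scale n t) p q Y
            (flat_to_circle p Y (H_flat_pullback p Y id v)) (cohom_pullback q Y id y))
         (fundamental_class M S))"

type_synonym 'a top_elem =
  "'a real_class set \<times> 'a real_class set \<times> 'a int_class set \<times> 'a int_class set"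

definition Top_free :: "('a, 'n::{finite,linorder}) spacetime_data \<Rightarrow> nat \<Rightarrow> 'a top_elem monoid" where
  "Top_free M k =
     (let m = int CARD('n); X = pts M in
       H_flat (int k - 1) X \<times>\<times> H_flat (m - int k - 1) X \<times>\<times> H_free (int k) X \<times>\<times> H_free (m - int k) X)"

definition sigma_free ::
    "('a, 'n::{finite,linorder}) spacetime_data \<Rightarrow> 'a set \<Rightarrow> nat \<Rightarrow> 'a top_elem \<Rightarrow> 'a top_elem \<Rightarrow> circle" where
  "sigma_free M S k = (\<lambda>(u, ut, z, zt) (u', ut', z', zt').
     let m = CARD('n); s = (- 1) ^ (k * (m - k)) in
       pairing M S (int m - int k - 1) (int k) ut z'
       - int_scale s (pairing M S (int k - 1) (int m - int k) u zt')
       - pairing M S (int m - int k - 1) (int k) ut' z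
       + int_scale s (pairing M S (int k - 1) (int m - int k) u' zt))"

definition zeta_free ::
    "('a, 'n::{finite,linorder}) spacetime_data \<Rightarrow> nat \<Rightarrow> 'a top_elem \<Rightarrow> 'a top_elem" where
  "zeta_free M k = (\<lambda>(u, ut, z, zt).
     let m = CARD('n); e = (- 1) ^ (k * (m - k) + 1) :: int in
       (ut, u [^]\<^bsub>H_flat (int k - 1) (pts M)\<^esub> e, zt, z [^]\<^bsub>H_free (int k) (pts M)\<^esub> e))"


section \<open>Weyl algebras\<close>

text \<open>Complex unital \<open>*\<close>-algebras on a carrier, with a norm or seminorm.\<close>

record 'x star_alg =
  elems :: "'x set"
  add :: "'x \<Rightarrow> 'x \<Rightarrow> 'x"
  scale :: "complex \<Rightarrow> 'x \<Rightarrow> 'x"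
  times :: "'x \<Rightarrow> 'x \<Rightarrow> 'x"
  unit :: "'x"
  star :: "'x \<Rightarrow> 'x"
  nrm :: "'x \<Rightarrow> real"

definition alg_dist :: "'x star_alg \<Rightarrow> 'x \<Rightarrow> 'x \<Rightarrow> real" where
  "alg_dist A a b = nrm A (add A a (scale A (- 1) b))"

definition cauchy_seqs :: "'x star_alg \<Rightarrow> (nat \<Rightarrow> 'x) set" where
  "cauchy_seqs A = {s. (\<forall>n. s n \<in> elems A) \<and>
     (\<forall>e>0. \<exists>N. \<forall>i\<ge>N. \<forall>j\<ge>N. alg_dist A (s i) (s j) < e)}"

definition limit_class :: "'x star_alg \<Rightarrow> (nat \<Rightarrow> 'x) \<Rightarrow> (nat \<Rightarrow> 'x) set" where
  "limit_class A s = {t \<in> cauchy_seqs A. (\<lambda>n. alg_dist A (s n) (t n)) \<longlonglongrightarrow> 0}"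

text \<open>The Hausdorff completion; elements of seminorm \<open>0\<close> are identified with \<open>0\<close>.\<close>

definition completion :: "'x star_alg \<Rightarrow> (nat \<Rightarrow> 'x) set star_alg" where
  "completion A =
     \<lparr>elems = limit_class A ` cauchy_seqs A,
      add = (\<lambda>P Q. \<Union>p \<in> P. \<Union>q \<in> Q. limit_class A (\<lambda>n. add A (p n) (q n))),
      scale = (\<lambda>c P. \<Union>p \<in> P. limit_class A (\<lambda>n. scale A c (p n))),
      times = (\<lambda>P Q. \<Union>p \<in> P. \<Union>q \<in> Q. limit_class A (\<lambda>n. times A (p n) (q n))),
      unit = limit_class A (\<lambda>_. unit A),
      star = (\<lambda>P. \<Union>p \<in> P. limit_class A (\<lambda>n. star A (p n))),
      nrm = (\<lambda>P. THE r. \<exists>p \<in> P. (\<lambda>n. nrm A (p n)) \<longlonglongrightarrow> r)\<rparr>"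

definition completion_embed :: "'x star_alg \<Rightarrow> 'x \<Rightarrow> (nat \<Rightarrow> 'x) set" where
  "completion_embed A a = limit_class A (\<lambda>_. a)"

text \<open>The continuous \<open>C\<^sup>*\<close>-seminorms are exactly the functions \<open>a \<mapsto> \<parallel>\<pi> a\<parallel>\<close> for
  \<open>*\<close>-representations \<open>\<pi>\<close> on Hilbert spaces (these are automatically continuous on a Banach
  \<open>*\<close>-algebra), so that their supremum is the norm of the enveloping \<open>C\<^sup>*\<close>-algebra.\<close>

definition cstar_seminorm :: "'x star_alg \<Rightarrow> ('x \<Rightarrow> real) \<Rightarrow> bool" where
  "cstar_seminorm A p \<longleftrightarrow>
     (\<forall>a \<in> elems A. 0 \<le> p a) \<and>
     (\<forall>a \<in> elems A. \<forall>b \<in> elems A. p (add A a b) \<le> p a + p b) \<and>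
     (\<forall>c. \<forall>a \<in> elems A. p (scale A c a) = cmod c * p a) \<and>
     (\<forall>a \<in> elems A. \<forall>b \<in> elems A. p (times A a b) \<le> p a * p b) \<and>
     (\<forall>a \<in> elems A. p (star A a) = p a) \<and>
     (\<forall>a \<in> elems A. p (times A (star A a) a) = (p a)\<^sup>2) \<and>
     (\<exists>C. \<forall>a \<in> elems A. p a \<le> C * nrm A a)"

definition with_cstar_norm :: "'x star_alg \<Rightarrow> 'x star_alg" where
  "with_cstar_norm A = A\<lparr>nrm := \<lambda>a. SUP p \<in> Collect (cstar_seminorm A). p a\<rparr>"

definition enveloping_cstar :: "'x star_alg \<Rightarrow> (nat \<Rightarrow> 'x) set star_alg" where
  "enveloping_cstar A = completion (with_cstar_norm A)"

text \<open>The finite linear combinations \<open>\<Sum>\<^sub>g a g W(g)\<close>, as their coefficient functions.\<close>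

definition weyl_poly :: "'g monoid \<Rightarrow> ('g \<Rightarrow> 'g \<Rightarrow> circle) \<Rightarrow> ('g \<Rightarrow> complex) star_alg" where
  "weyl_poly G \<sigma> =
     \<lparr>elems = {a. finite {g. a g \<noteq> 0} \<and> {g. a g \<noteq> 0} \<subseteq> carrier G},
      add = (\<lambda>a b x. a x + b x),
      scale = (\<lambda>c a x. c * a x),
      times = (\<lambda>a b x. \<Sum>g | a g \<noteq> 0. \<Sum>h | b h \<noteq> 0.
                 if g \<otimes>\<^bsub>G\<^esub> h = x then a g * b h * circle_exp (\<sigma> g h) else 0),
      unit = (\<lambda>x. if x = \<one>\<^bsub>G\<^esub> then 1 else 0),
      star = (\<lambda>a x. if x \<in> carrier G then cnj (a (inv\<^bsub>G\<^esub> x)) else 0),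
      nrm = (\<lambda>a. \<Sum>g | a g \<noteq> 0. cmod (a g))\<rparr>"

definition weyl_banach :: "'g monoid \<Rightarrow> ('g \<Rightarrow> 'g \<Rightarrow> circle) \<Rightarrow> (nat \<Rightarrow> 'g \<Rightarrow> complex) set star_alg" where
  "weyl_banach G \<sigma> = completion (weyl_poly G \<sigma>)"

type_synonym 'g weyl_elem = "(nat \<Rightarrow> (nat \<Rightarrow> 'g \<Rightarrow> complex) set) set"

definition weyl_algebra :: "'g monoid \<Rightarrow> ('g \<Rightarrow> 'g \<Rightarrow> circle) \<Rightarrow> 'g weyl_elem star_alg" where
  "weyl_algebra G \<sigma> = enveloping_cstar (weyl_banach G \<sigma>)"

definition weyl_gen :: "'g monoid \<Rightarrow> ('g \<Rightarrow> 'g \<Rightarrow> circle) \<Rightarrow> 'g \<Rightarrow> 'g weyl_elem" where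
  "weyl_gen G \<sigma> g =
     completion_embed (with_cstar_norm (weyl_banach G \<sigma>))
       (completion_embed (weyl_poly G \<sigma>) (\<lambda>x. if x = g then 1 else 0))"

definition continuous_functional :: "'x star_alg \<Rightarrow> ('x \<Rightarrow> complex) \<Rightarrow> bool" where
  "continuous_functional A \<phi> \<longleftrightarrow>
     (\<forall>a \<in> elems A. \<forall>b \<in> elems A. \<phi> (add A a b) = \<phi> a + \<phi> b) \<and>
     (\<forall>c. \<forall>a \<in> elems A. \<phi> (scale A c a) = c * \<phi> a) \<and>
     (\<exists>C. \<forall>a \<in> elems A. cmod (\<phi> a) \<le> C * nrm A a)"

definition is_state :: "'x star_alg \<Rightarrow> ('x \<Rightarrow> complex) \<Rightarrow> bool" where
  "is_state A \<phi> \<longleftrightarrow> continuous_functional A \<phi> \<and>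
     (\<forall>a \<in> elems A. \<phi> (times A (star A a) a) \<in> \<real>\<^sub>\<ge>\<^sub>0) \<and> \<phi> (unit A) = 1"

text \<open>The last clause is automatic between \<open>C\<^sup>*\<close>-algebras.\<close>

definition cstar_iso :: "'x star_alg \<Rightarrow> 'y star_alg \<Rightarrow> ('x \<Rightarrow> 'y) \<Rightarrow> bool" where
  "cstar_iso A B \<Phi> \<longleftrightarrow> bij_betw \<Phi> (elems A) (elems B) \<and>
     (\<forall>a \<in> elems A. \<forall>b \<in> elems A. \<Phi> (add A a b) = add B (\<Phi> a) (\<Phi> b)) \<and>
     (\<forall>c. \<forall>a \<in> elems A. \<Phi> (scale A c a) = scale B c (\<Phi> a)) \<and>
     (\<forall>a \<in> elems A. \<forall>b \<in> elems A. \<Phi> (times A a b) = times B (\<Phi> a) (\<Phi> b)) \<and>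
     \<Phi> (unit A) = unit B \<and>
     (\<forall>a \<in> elems A. \<Phi> (star A a) = star B (\<Phi> a)) \<and>
     (\<forall>a \<in> elems A. nrm B (\<Phi> a) = nrm A a)"


section \<open>The functional and the duality isomorphism\<close>

definition W_free ::
    "('a, 'n::{finite,linorder}) spacetime_data \<Rightarrow> 'a set \<Rightarrow> nat \<Rightarrow> 'a top_elem weyl_elem star_alg" where
  "W_free M S k = weyl_algebra (Top_free M k) (sigma_free M S k)"

definition W_gen ::
    "('a, 'n::{finite,linorder}) spacetime_data \<Rightarrow> 'a set \<Rightarrow> nat \<Rightarrow> 'a top_elem \<Rightarrow> 'a top_elem weyl_elem" where
  "W_gen M S k = weyl_gen (Top_free M k) (sigma_free M S k)"

definition omega_free_spec ::
    "('a, 'n::{finite,linorder}) spacetime_data \<Rightarrow> 'a set \<Rightarrow> nat \<Rightarrow> ('a top_elem weyl_elem \<Rightarrow> complex) \<Rightarrow> bool" where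
  "omega_free_spec M S k \<omega> \<longleftrightarrow>
     \<omega> \<in> extensional (elems (W_free M S k)) \<and> continuous_functional (W_free M S k) \<omega> \<and>
     (\<forall>u ut z zt. (u, ut, z, zt) \<in> carrier (Top_free M k) \<longrightarrow>
        \<omega> (W_gen M S k (u, ut, z, zt)) =
          (if z = \<one>\<^bsub>H_free (int k) (pts M)\<^esub> \<and> zt = \<one>\<^bsub>H_free (int CARD('n) - int k) (pts M)\<^esub>
           then 1 else 0))"

definition omega_free ::
    "('a, 'n::{finite,linorder}) spacetime_data \<Rightarrow> 'a set \<Rightarrow> nat \<Rightarrow> 'a top_elem weyl_elem \<Rightarrow> complex" where
  "omega_free M S k = (THE \<omega>. omega_free_spec M S k \<omega>)"

definition W_zeta_spec ::
    "('a, 'n::{finite,linorder}) spacetime_data \<Rightarrow> 'a set \<Rightarrow> nat \<Rightarrow>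
     ('a top_elem weyl_elem \<Rightarrow> 'a top_elem weyl_elem) \<Rightarrow> bool" where
  "W_zeta_spec M S k \<Phi> \<longleftrightarrow>
     \<Phi> \<in> extensional (elems (W_free M S k)) \<and>
     cstar_iso (W_free M S k) (W_free M S (CARD('n) - k)) \<Phi> \<and>
     (\<forall>x \<in> carrier (Top_free M k).
        \<Phi> (W_gen M S k x) = W_gen M S (CARD('n) - k) (zeta_free M k x))"

definition W_zeta ::
    "('a, 'n::{finite,linorder}) spacetime_data \<Rightarrow> 'a set \<Rightarrow> nat \<Rightarrow> 'a top_elem weyl_elem \<Rightarrow> 'a top_elem weyl_elem" where
  "W_zeta M S k = (THE \<Phi>. W_zeta_spec M S k \<Phi>)"

end

theory Submission
  imports Defs
begin

text \<open>The functional is the one that integrates over the isotropic subgroup \<open>K = {z = 0, zt = 0}\<close>: on each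
  coset of \<open>K\<close> the phases \<open>e\<^bsup>2\<pi>i\<sigma>\<^esup>\<close> are a coboundary, so that \<open>\<omega>(a* a)\<close> is a sum of squares over the
  cosets.  Positivity passes to the \<open>\<ell>\<^sup>1\<close>-completion, and there the operator seminorm
  \<open>b \<mapsto> sup {\<parallel>b c\<parallel> / \<parallel>c\<parallel>}\<close> of the pre-Hilbert form \<open>\<omega>(a* b)\<close> is a \<open>C\<^sup>*\<close>-seminorm that dominates \<open>\<bar>\<omega>\<bar>\<close>;
  hence \<open>\<omega>\<close> extends to the enveloping \<open>C\<^sup>*\<close>-algebra.  The duality is an isomorphism of groups that
  preserves \<open>\<sigma>\<close>, so it acts functorially on both completions; it maps \<open>K\<close> onto its analogue, and the
  invariance follows because the generators span a dense subspace.  All that is used of \<open>\<sigma>\<close> is that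
  the pairing is well defined and biadditive, which is the Leibniz rule together with the fact that
  the cup product with a torsion class vanishes after pushing real coefficients to the circle.\<close>

section \<open>Seminormed star algebras and their completions\<close>

text \<open>The completions and the enveloping norm are taken literally: elements are full classes
  of Cauchy sequences, operations are unions over representatives, and the C*-norm is a supremum
  over all C*-seminorms, each continuous with an unknown constant. The obstacle is to bound that
  supremum and to bound the form of a state; both yield to repeated squaring. For a C*-seminorm p,
  the identity p(x^2) = p(x)^2 on self-adjoint x, followed by 2^n-th roots, removes the constant and
  bounds p by the Banach norm. For a state, Cauchy-Schwarz takes the place of the C*-identity and
  bounds left multiplication in the same way, without square roots in the algebra and without appeal
  to completeness. The operator seminorm then plays the part of the GNS representation, with no
  Hilbert space formed. Seminorms are allowed throughout: null vectors of the form are kept, and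
  elements killed by all C*-seminorms are identified with 0 by the Hausdorff completion.\<close>

lemma UN_const: "\<lbrakk>x \<in> X; \<And>p. p \<in> X \<Longrightarrow> f p = c\<rbrakk> \<Longrightarrow> (\<Union>p \<in> X. f p) = c"
  by blast

lemma UN_const2: "\<lbrakk>x \<in> X; y \<in> Y; \<And>p q. \<lbrakk>p \<in> X; q \<in> Y\<rbrakk> \<Longrightarrow> f p q = c\<rbrakk>
    \<Longrightarrow> (\<Union>p \<in> X. \<Union>q \<in> Y. f p q) = c"
  by blast

text \<open>Every axiom is an equation or a weak inequality, so it holds for termwise operations on
  sequences and survives limits. \<open>nrm\<close> is only a seminorm, so one locale covers the
  polynomials, the Banach algebra, the same algebra with its C*-seminorm, and the completions. There
  is no zero constant; \<open>scale A 0 b\<close> serves for it, with any \<open>b\<close>.\<close>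

locale seminormed_star_alg =
  fixes A :: "'x star_alg"
  assumes unit_closed: "unit A \<in> elems A"
    and add_closed: "\<lbrakk>a \<in> elems A; b \<in> elems A\<rbrakk> \<Longrightarrow> add A a b \<in> elems A"
    and scale_closed: "a \<in> elems A \<Longrightarrow> scale A c a \<in> elems A"
    and times_closed: "\<lbrakk>a \<in> elems A; b \<in> elems A\<rbrakk> \<Longrightarrow> times A a b \<in> elems A"
    and star_closed: "a \<in> elems A \<Longrightarrow> star A a \<in> elems A"
    and add_commute: "\<lbrakk>a \<in> elems A; b \<in> elems A\<rbrakk> \<Longrightarrow> add A a b = add A b a"
    and add_assoc: "\<lbrakk>a \<in> elems A; b \<in> elems A; d \<in> elems A\<rbrakk>
      \<Longrightarrow> add A (add A a b) d = add A a (add A b d)"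
    and add_zero: "\<lbrakk>a \<in> elems A; b \<in> elems A\<rbrakk> \<Longrightarrow> add A a (scale A 0 b) = a"
    and scale_add_right: "\<lbrakk>a \<in> elems A; b \<in> elems A\<rbrakk>
      \<Longrightarrow> scale A c (add A a b) = add A (scale A c a) (scale A c b)"
    and scale_add_left: "a \<in> elems A \<Longrightarrow> scale A (c + e) a = add A (scale A c a) (scale A e a)"
    and scale_scale: "a \<in> elems A \<Longrightarrow> scale A c (scale A e a) = scale A (c * e) a"
    and scale_one: "a \<in> elems A \<Longrightarrow> scale A 1 a = a"
    and times_assoc: "\<lbrakk>a \<in> elems A; b \<in> elems A; d \<in> elems A\<rbrakk>
      \<Longrightarrow> times A (times A a b) d = times A a (times A b d)"
    and times_add_left: "\<lbrakk>a \<in> elems A; b \<in> elems A; d \<in> elems A\<rbrakk>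
      \<Longrightarrow> times A (add A a b) d = add A (times A a d) (times A b d)"
    and times_add_right: "\<lbrakk>a \<in> elems A; b \<in> elems A; d \<in> elems A\<rbrakk>
      \<Longrightarrow> times A d (add A a b) = add A (times A d a) (times A d b)"
    and times_scale_left: "\<lbrakk>a \<in> elems A; b \<in> elems A\<rbrakk>
      \<Longrightarrow> times A (scale A c a) b = scale A c (times A a b)"
    and times_scale_right: "\<lbrakk>a \<in> elems A; b \<in> elems A\<rbrakk>
      \<Longrightarrow> times A a (scale A c b) = scale A c (times A a b)"
    and unit_left: "a \<in> elems A \<Longrightarrow> times A (unit A) a = a"
    and unit_right: "a \<in> elems A \<Longrightarrow> times A a (unit A) = a"
    and star_star: "a \<in> elems A \<Longrightarrow> star A (star A a) = a"
    and star_add: "\<lbrakk>a \<in> elems A; b \<in> elems A\<rbrakk> \<Longrightarrow> star A (add A a b) = add A (star A a) (star A b)"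
    and star_scale: "a \<in> elems A \<Longrightarrow> star A (scale A c a) = scale A (cnj c) (star A a)"
    and star_times: "\<lbrakk>a \<in> elems A; b \<in> elems A\<rbrakk>
      \<Longrightarrow> star A (times A a b) = times A (star A b) (star A a)"
    and nrm_nonneg: "a \<in> elems A \<Longrightarrow> 0 \<le> nrm A a"
    and nrm_add: "\<lbrakk>a \<in> elems A; b \<in> elems A\<rbrakk> \<Longrightarrow> nrm A (add A a b) \<le> nrm A a + nrm A b"
    and nrm_scale: "a \<in> elems A \<Longrightarrow> nrm A (scale A c a) = cmod c * nrm A a"
    and nrm_times: "\<lbrakk>a \<in> elems A; b \<in> elems A\<rbrakk> \<Longrightarrow> nrm A (times A a b) \<le> nrm A a * nrm A b"
    and nrm_star: "a \<in> elems A \<Longrightarrow> nrm A (star A a) = nrm A a"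
begin

lemmas closed = unit_closed add_closed scale_closed times_closed star_closed

lemma add_left_commute: "\<lbrakk>a \<in> elems A; b \<in> elems A; d \<in> elems A\<rbrakk>
    \<Longrightarrow> add A a (add A b d) = add A b (add A a d)"
  by (metis add_assoc add_commute)

lemma add_add_swap: "\<lbrakk>a \<in> elems A; b \<in> elems A; c \<in> elems A; d \<in> elems A\<rbrakk>
    \<Longrightarrow> add A (add A a b) (add A c d) = add A (add A a c) (add A b d)"
  by (simp add: add_assoc add_left_commute closed)

lemma diff_self: "a \<in> elems A \<Longrightarrow> add A a (scale A (- 1) a) = scale A 0 a"
  using scale_add_left[of a 1 "- 1"] by (simp add: scale_one)

lemma diff_add_cancel: "\<lbrakk>a \<in> elems A; b \<in> elems A\<rbrakk> \<Longrightarrow> add A (add A a (scale A (- 1) b)) b = a"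
  by (metis add_assoc add_commute add_zero diff_self scale_closed)

lemma star_unit: "star A (unit A) = unit A"
  by (metis star_star star_times unit_closed star_closed unit_left unit_right)

text \<open>Applying the inequality to \<open>scale A c a\<close> with the inverse scalar gives the
  reverse one. A supremum yields only the inequality directly, as for \<open>with_cstar_norm\<close>
  and \<open>opn\<close>.\<close>

lemma homogeneousI:
  assumes le: "\<And>c b. b \<in> elems A \<Longrightarrow> N (scale A c b) \<le> cmod c * N b"
    and nonneg: "\<And>b. b \<in> elems A \<Longrightarrow> 0 \<le> N b" and a: "a \<in> elems A"
  shows "N (scale A c a) = cmod c * N a"
proof (cases "c = 0")
  case True
  then show ?thesis using le[OF a, of 0] nonneg[of "scale A 0 a"] a by (simp add: closed)
next
  case False
  have "cmod c * N a \<le> cmod c * (cmod (inverse c) * N (scale A c a))"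
    using le[of "scale A c a" "inverse c"] a False
    by (intro mult_left_mono) (simp_all add: closed scale_scale scale_one)
  also have "\<dots> = N (scale A c a)"
    using False by (simp add: norm_inverse)
  finally show ?thesis using le[OF a, of c] by simp
qed

section \<open>The distance and its estimates\<close>

lemma alg_dist_nonneg: "\<lbrakk>a \<in> elems A; b \<in> elems A\<rbrakk> \<Longrightarrow> 0 \<le> alg_dist A a b"
  by (simp add: alg_dist_def nrm_nonneg closed)

lemma alg_dist_self: "a \<in> elems A \<Longrightarrow> alg_dist A a a = 0"
  by (simp add: alg_dist_def diff_self nrm_scale)

lemma alg_dist_scale: "\<lbrakk>a \<in> elems A; b \<in> elems A\<rbrakk>
    \<Longrightarrow> alg_dist A (scale A c a) (scale A c b) = cmod c * alg_dist A a b"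
  by (simp add: alg_dist_def nrm_scale[symmetric] scale_add_right scale_scale closed)

lemma alg_dist_commute: "\<lbrakk>a \<in> elems A; b \<in> elems A\<rbrakk> \<Longrightarrow> alg_dist A a b = alg_dist A b a"
  using nrm_scale[of "add A a (scale A (- 1) b)" "- 1"]
  by (simp add: alg_dist_def scale_add_right scale_scale scale_one add_commute closed)

lemma alg_dist_triangle:
  assumes "a \<in> elems A" "b \<in> elems A" "c \<in> elems A"
  shows "alg_dist A a c \<le> alg_dist A a b + alg_dist A b c"
proof -
  have "add A a (scale A (- 1) c) =
      add A (add A a (scale A (- 1) b)) (add A b (scale A (- 1) c))"
    using assms by (metis add_assoc diff_add_cancel scale_closed add_closed)
  then show ?thesis
    unfolding alg_dist_def using assms by (simp add: nrm_add closed)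
qed

lemma alg_dist_add:
  assumes "a \<in> elems A" "b \<in> elems A" "a' \<in> elems A" "b' \<in> elems A"
  shows "alg_dist A (add A a b) (add A a' b') \<le> alg_dist A a a' + alg_dist A b b'"
proof -
  have "add A (add A a b) (scale A (- 1) (add A a' b')) =
      add A (add A a (scale A (- 1) a')) (add A b (scale A (- 1) b'))"
    using assms by (simp add: scale_add_right add_add_swap closed)
  then show ?thesis
    unfolding alg_dist_def using assms by (simp add: nrm_add closed)
qed

lemma alg_dist_times:
  assumes "a \<in> elems A" "b \<in> elems A" "a' \<in> elems A" "b' \<in> elems A"
  shows "alg_dist A (times A a b) (times A a' b') \<le> nrm A a * alg_dist A b b' + alg_dist A a a' * nrm A b'"
proof -
  have "alg_dist A (times A a b) (times A a' b')
      \<le> alg_dist A (times A a b) (times A a b') + alg_dist A (times A a b') (times A a' b')"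
    using assms by (simp add: alg_dist_triangle closed)
  also have "alg_dist A (times A a b) (times A a b') \<le> nrm A a * alg_dist A b b'"
    unfolding alg_dist_def using assms
    by (metis times_add_right times_scale_right nrm_times add_closed scale_closed)
  also have "alg_dist A (times A a b') (times A a' b') \<le> alg_dist A a a' * nrm A b'"
    unfolding alg_dist_def using assms
    by (metis times_add_left times_scale_left nrm_times add_closed scale_closed)
  finally show ?thesis by simp
qed

lemma alg_dist_star: "\<lbrakk>a \<in> elems A; b \<in> elems A\<rbrakk> \<Longrightarrow> alg_dist A (star A a) (star A b) = alg_dist A a b"
  unfolding alg_dist_def
  by (metis add_closed complex_cnj_minus complex_cnj_one nrm_star scale_closed star_add star_scale)

lemma nrm_le_alg_dist: "\<lbrakk>a \<in> elems A; b \<in> elems A\<rbrakk> \<Longrightarrow> nrm A a \<le> alg_dist A a b + nrm A b"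
  unfolding alg_dist_def by (metis add_closed diff_add_cancel nrm_add scale_closed)

lemma abs_nrm_diff_le: "\<lbrakk>a \<in> elems A; b \<in> elems A\<rbrakk> \<Longrightarrow> \<bar>nrm A a - nrm A b\<bar> \<le> alg_dist A a b"
  using nrm_le_alg_dist[of a b] nrm_le_alg_dist[of b a] alg_dist_commute[of a b] by simp

section \<open>Cauchy sequences\<close>

lemma cauchy_seqsD: "s \<in> cauchy_seqs A \<Longrightarrow> s n \<in> elems A"
  by (simp add: cauchy_seqs_def)

text \<open>Two control sequences, because sums and products depend on two arguments; unary
  operations use the special case below.\<close>

lemma cauchy_seqsI_le2:
  assumes "\<And>n. s n \<in> elems A" and "t \<in> cauchy_seqs A" and "u \<in> cauchy_seqs A"
    and "\<And>i j. alg_dist A (s i) (s j) \<le> K * alg_dist A (t i) (t j) + K * alg_dist A (u i) (u j)"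
  shows "s \<in> cauchy_seqs A"
proof -
  have "\<exists>N. \<forall>i\<ge>N. \<forall>j\<ge>N. alg_dist A (s i) (s j) < e" if "e > 0" for e :: real
  proof -
    \<comment> \<open>\<open>K\<close> carries no sign condition; the divisor \<bar>K\<bar> + 1 is
      positive even for K = 0.\<close>
    have e: "e / 2 / (\<bar>K\<bar> + 1) > 0" using that by simp
    obtain N where N: "\<forall>i\<ge>N. \<forall>j\<ge>N. alg_dist A (t i) (t j) < e / 2 / (\<bar>K\<bar> + 1)"
      using assms(2) e unfolding cauchy_seqs_def by blast
    obtain N' where N': "\<forall>i\<ge>N'. \<forall>j\<ge>N'. alg_dist A (u i) (u j) < e / 2 / (\<bar>K\<bar> + 1)"
      using assms(3) e unfolding cauchy_seqs_def by blast
    have "alg_dist A (s i) (s j) < e" if "i \<ge> max N N'" "j \<ge> max N N'" for i j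
    proof -
      let ?t = "alg_dist A (t i) (t j)" and ?u = "alg_dist A (u i) (u j)"
      have "0 \<le> ?t" "0 \<le> ?u"
        using assms(2,3) by (simp_all add: alg_dist_nonneg cauchy_seqsD)
      then have "K * ?t \<le> (\<bar>K\<bar> + 1) * ?t" "K * ?u \<le> (\<bar>K\<bar> + 1) * ?u"
        by (intro mult_right_mono; simp)+
      moreover have "(\<bar>K\<bar> + 1) * ?t < (\<bar>K\<bar> + 1) * (e / 2 / (\<bar>K\<bar> + 1))"
        using N that by (intro mult_strict_left_mono) auto
      moreover have "(\<bar>K\<bar> + 1) * ?u < (\<bar>K\<bar> + 1) * (e / 2 / (\<bar>K\<bar> + 1))"
        using N' that by (intro mult_strict_left_mono) auto
      moreover have "(\<bar>K\<bar> + 1) * (e / 2 / (\<bar>K\<bar> + 1)) = e / 2"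
        using nonzero_mult_div_cancel_left[of "\<bar>K\<bar> + 1" "e / 2"] by (simp only: times_divide_eq_right)
      ultimately show ?thesis using assms(4)[of i j] by linarith
    qed
    then show ?thesis by blast
  qed
  then show ?thesis using assms(1) by (simp add: cauchy_seqs_def)
qed

lemma cauchy_seqsI_le:
  assumes "\<And>n. s n \<in> elems A" and "t \<in> cauchy_seqs A"
    and "\<And>i j. alg_dist A (s i) (s j) \<le> K * alg_dist A (t i) (t j)"
  shows "s \<in> cauchy_seqs A"
  \<comment> \<open>The sequence \<open>t\<close> controls twice, each time with half of the
    constant.\<close>
  by (rule cauchy_seqsI_le2[of s t t "K / 2"]) (use assms in simp_all)

lemma nrm_convergent:
  assumes "s \<in> cauchy_seqs A"
  shows "convergent (\<lambda>n. nrm A (s n))"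
proof -
  have "Cauchy (\<lambda>n. nrm A (s n))"
  proof (rule metric_CauchyI)
    fix e :: real assume "e > 0"
    then obtain N where "\<forall>i\<ge>N. \<forall>j\<ge>N. alg_dist A (s i) (s j) < e"
      using assms unfolding cauchy_seqs_def by blast
    then have "\<forall>i\<ge>N. \<forall>j\<ge>N. dist (nrm A (s i)) (nrm A (s j)) < e"
      unfolding dist_real_def
      using abs_nrm_diff_le[OF cauchy_seqsD[OF assms] cauchy_seqsD[OF assms]]
      by (meson le_less_trans)
    then show "\<exists>N. \<forall>i\<ge>N. \<forall>j\<ge>N. dist (nrm A (s i)) (nrm A (s j)) < e" by blast
  qed
  then show ?thesis by (simp add: Cauchy_convergent)
qed

lemma cauchy_seqs_bounded:
  assumes "s \<in> cauchy_seqs A"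
  obtains K where "K > 0" "\<And>n. nrm A (s n) \<le> K"
proof -
  have "Bseq (\<lambda>n. nrm A (s n))"
    using nrm_convergent[OF assms] by (rule convergent_imp_Bseq)
  then obtain K where "K > 0" "\<And>n. norm (nrm A (s n)) \<le> K"
    by (auto simp: Bseq_def)
  then show thesis using that[of K] by (auto simp: abs_le_iff)
qed

lemma cauchy_const: "a \<in> elems A \<Longrightarrow> (\<lambda>_. a) \<in> cauchy_seqs A"
  by (simp add: cauchy_seqs_def alg_dist_self)

lemma cauchy_add: "\<lbrakk>s \<in> cauchy_seqs A; t \<in> cauchy_seqs A\<rbrakk> \<Longrightarrow> (\<lambda>n. add A (s n) (t n)) \<in> cauchy_seqs A"
  by (rule cauchy_seqsI_le2[where K = 1 and t = s and u = t]) (simp_all add: cauchy_seqsD closed alg_dist_add)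

lemma cauchy_scale: "s \<in> cauchy_seqs A \<Longrightarrow> (\<lambda>n. scale A c (s n)) \<in> cauchy_seqs A"
  by (rule cauchy_seqsI_le[where K = "cmod c" and t = s]) (simp_all add: cauchy_seqsD closed alg_dist_scale)

lemma cauchy_star: "s \<in> cauchy_seqs A \<Longrightarrow> (\<lambda>n. star A (s n)) \<in> cauchy_seqs A"
  by (rule cauchy_seqsI_le[where K = 1 and t = s]) (simp_all add: cauchy_seqsD closed alg_dist_star)

lemma cauchy_times:
  assumes "s \<in> cauchy_seqs A" "t \<in> cauchy_seqs A"
  shows "(\<lambda>n. times A (s n) (t n)) \<in> cauchy_seqs A"
proof -
  obtain K where K: "K > 0" "\<And>n. nrm A (s n) \<le> K" using cauchy_seqs_bounded[OF assms(1)] by blast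
  obtain L where L: "L > 0" "\<And>n. nrm A (t n) \<le> L" using cauchy_seqs_bounded[OF assms(2)] by blast
  show ?thesis
  proof (rule cauchy_seqsI_le2[where K = "max K L", OF _ assms])
    fix i j
    have nn: "0 \<le> alg_dist A (s i) (s j)" "0 \<le> alg_dist A (t i) (t j)"
      using assms by (simp_all add: alg_dist_nonneg cauchy_seqsD)
    have "alg_dist A (times A (s i) (t i)) (times A (s j) (t j))
        \<le> nrm A (s i) * alg_dist A (t i) (t j) + alg_dist A (s i) (s j) * nrm A (t j)"
      using assms by (simp add: alg_dist_times cauchy_seqsD)
    also have "\<dots> \<le> max K L * alg_dist A (t i) (t j) + alg_dist A (s i) (s j) * max K L"
      using nn K(2)[of i] L(2)[of j] by (intro add_mono mult_right_mono mult_left_mono) auto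
    finally show "alg_dist A (times A (s i) (t i)) (times A (s j) (t j))
        \<le> max K L * alg_dist A (s i) (s j) + max K L * alg_dist A (t i) (t j)"
      by (simp add: algebra_simps)
  qed (use assms in \<open>simp_all add: cauchy_seqsD closed\<close>)
qed

section \<open>Classes of Cauchy sequences\<close>

lemma limit_class_self: "s \<in> cauchy_seqs A \<Longrightarrow> s \<in> limit_class A s"
  by (simp add: limit_class_def alg_dist_self cauchy_seqsD)

lemma limit_class_eqI:
  assumes "s \<in> cauchy_seqs A" "t \<in> cauchy_seqs A" "(\<lambda>n. alg_dist A (s n) (t n)) \<longlonglongrightarrow> 0"
  shows "limit_class A s = limit_class A t"
proof -
  \<comment> \<open>Two sequences asymptotic to \<open>x\<close> are asymptotic to each other; used
    once with \<open>s\<close> and once with \<open>t\<close> as the middle sequence.\<close>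
  have *: "(\<lambda>n. alg_dist A (y n) (u n)) \<longlonglongrightarrow> 0"
    if "x \<in> cauchy_seqs A" "y \<in> cauchy_seqs A" "u \<in> cauchy_seqs A"
      "(\<lambda>n. alg_dist A (x n) (u n)) \<longlonglongrightarrow> 0" "(\<lambda>n. alg_dist A (x n) (y n)) \<longlonglongrightarrow> 0" for x y u
  proof (rule tendsto_sandwich[of "\<lambda>_. 0", OF _ _ tendsto_const])
    show "(\<lambda>n. alg_dist A (x n) (y n) + alg_dist A (x n) (u n)) \<longlonglongrightarrow> 0"
      using tendsto_add[OF that(5,4)] by simp
    show "\<forall>\<^sub>F n in sequentially. alg_dist A (y n) (u n) \<le> alg_dist A (x n) (y n) + alg_dist A (x n) (u n)"
    proof (rule always_eventually, rule allI)
      fix n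
      show "alg_dist A (y n) (u n) \<le> alg_dist A (x n) (y n) + alg_dist A (x n) (u n)"
        using alg_dist_triangle[of "y n" "x n" "u n"] alg_dist_commute[of "y n" "x n"] that
        by (simp add: cauchy_seqsD)
    qed
    show "\<forall>\<^sub>F n in sequentially. 0 \<le> alg_dist A (y n) (u n)"
      using that by (simp add: alg_dist_nonneg cauchy_seqsD)
  qed
  have "(\<lambda>n. alg_dist A (t n) (s n)) \<longlonglongrightarrow> 0"
    using assms(3) alg_dist_commute[OF cauchy_seqsD[OF assms(1)] cauchy_seqsD[OF assms(2)]] by simp
  then show ?thesis
    unfolding limit_class_def using assms *[of s t] *[of t s] by blast
qed

lemma limit_class_eq_iff:
  assumes "s \<in> cauchy_seqs A" "t \<in> cauchy_seqs A"
  shows "limit_class A s = limit_class A t \<longleftrightarrow> (\<lambda>n. alg_dist A (s n) (t n)) \<longlonglongrightarrow> 0"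
  using limit_class_self[OF assms(2)] limit_class_eqI[OF assms] by (auto simp: limit_class_def)

lemma limit_class_memD:
  assumes "s \<in> cauchy_seqs A" "p \<in> limit_class A s"
  shows "p \<in> cauchy_seqs A" "limit_class A p = limit_class A s"
    "(\<lambda>n. alg_dist A (p n) (s n)) \<longlonglongrightarrow> 0"
proof -
  show p: "p \<in> cauchy_seqs A" using assms by (simp add: limit_class_def)
  show "limit_class A p = limit_class A s"
    using limit_class_eqI[OF assms(1) p] assms(2) by (simp add: limit_class_def)
  then show "(\<lambda>n. alg_dist A (p n) (s n)) \<longlonglongrightarrow> 0"
    using limit_class_eq_iff[OF p assms(1)] by simp
qed

lemma completion_elems [simp]: "elems (completion A) = limit_class A ` cauchy_seqs A"
  by (simp add: completion_def)

text \<open>The common form of the well-definedness arguments for the completion: a termwise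
  operation that preserves Cauchy sequences and vanishing distance takes equivalent representatives
  into one class. The binary version follows it.\<close>

lemma UN_limit_class:
  assumes s: "s \<in> cauchy_seqs A"
    and F: "\<And>p. p \<in> cauchy_seqs A \<Longrightarrow> (\<lambda>n. F (p n)) \<in> cauchy_seqs A"
    and lim: "\<And>p. \<lbrakk>p \<in> cauchy_seqs A; (\<lambda>n. alg_dist A (p n) (s n)) \<longlonglongrightarrow> 0\<rbrakk>
      \<Longrightarrow> (\<lambda>n. alg_dist A (F (p n)) (F (s n))) \<longlonglongrightarrow> 0"
  shows "(\<Union>p \<in> limit_class A s. limit_class A (\<lambda>n. F (p n))) = limit_class A (\<lambda>n. F (s n))"
proof (rule UN_const[OF limit_class_self[OF s]])
  fix p assume "p \<in> limit_class A s"
  then show "limit_class A (\<lambda>n. F (p n)) = limit_class A (\<lambda>n. F (s n))"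
    using limit_class_memD(1,3)[OF s] by (intro limit_class_eqI F lim s) blast+
qed

lemma UN_limit_class2:
  assumes s: "s \<in> cauchy_seqs A" and t: "t \<in> cauchy_seqs A"
    and F: "\<And>p q. \<lbrakk>p \<in> cauchy_seqs A; q \<in> cauchy_seqs A\<rbrakk> \<Longrightarrow> (\<lambda>n. F (p n) (q n)) \<in> cauchy_seqs A"
    and lim: "\<And>p q. \<lbrakk>p \<in> cauchy_seqs A; q \<in> cauchy_seqs A; (\<lambda>n. alg_dist A (p n) (s n)) \<longlonglongrightarrow> 0;
        (\<lambda>n. alg_dist A (q n) (t n)) \<longlonglongrightarrow> 0\<rbrakk>
      \<Longrightarrow> (\<lambda>n. alg_dist A (F (p n) (q n)) (F (s n) (t n))) \<longlonglongrightarrow> 0"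
  shows "(\<Union>p \<in> limit_class A s. \<Union>q \<in> limit_class A t. limit_class A (\<lambda>n. F (p n) (q n)))
    = limit_class A (\<lambda>n. F (s n) (t n))"
proof (rule UN_const2[OF limit_class_self[OF s] limit_class_self[OF t]])
  fix p q assume "p \<in> limit_class A s" "q \<in> limit_class A t"
  then show "limit_class A (\<lambda>n. F (p n) (q n)) = limit_class A (\<lambda>n. F (s n) (t n))"
    using limit_class_memD(1,3)[OF s] limit_class_memD(1,3)[OF t]
    by (intro limit_class_eqI F lim s t) blast+
qed

section \<open>Operations and norm of the completion\<close>

lemma completion_add:
  assumes "s \<in> cauchy_seqs A" "t \<in> cauchy_seqs A"
  shows "add (completion A) (limit_class A s) (limit_class A t) = limit_class A (\<lambda>n. add A (s n) (t n))"
  unfolding completion_def star_alg.simps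
proof (rule UN_limit_class2[OF assms cauchy_add])
  fix p q assume pq: "p \<in> cauchy_seqs A" "q \<in> cauchy_seqs A"
    and lim: "(\<lambda>n. alg_dist A (p n) (s n)) \<longlonglongrightarrow> 0" "(\<lambda>n. alg_dist A (q n) (t n)) \<longlonglongrightarrow> 0"
  show "(\<lambda>n. alg_dist A (add A (p n) (q n)) (add A (s n) (t n))) \<longlonglongrightarrow> 0"
  proof (rule tendsto_sandwich[of "\<lambda>_. 0", OF _ _ tendsto_const])
    show "(\<lambda>n. alg_dist A (p n) (s n) + alg_dist A (q n) (t n)) \<longlonglongrightarrow> 0"
      using tendsto_add[OF lim] by simp
  qed (use assms pq in \<open>simp_all add: alg_dist_nonneg alg_dist_add cauchy_seqsD closed\<close>)
qed

lemma completion_scale: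
  assumes s: "s \<in> cauchy_seqs A"
  shows "scale (completion A) c (limit_class A s) = limit_class A (\<lambda>n. scale A c (s n))"
  unfolding completion_def star_alg.simps
proof (rule UN_limit_class[OF s cauchy_scale])
  fix p assume "p \<in> cauchy_seqs A" and lim: "(\<lambda>n. alg_dist A (p n) (s n)) \<longlonglongrightarrow> 0"
  then show "(\<lambda>n. alg_dist A (scale A c (p n)) (scale A c (s n))) \<longlonglongrightarrow> 0"
    using tendsto_mult_left[OF lim, of "cmod c"] s by (simp add: alg_dist_scale cauchy_seqsD)
qed

lemma completion_star:
  assumes s: "s \<in> cauchy_seqs A"
  shows "star (completion A) (limit_class A s) = limit_class A (\<lambda>n. star A (s n))"
  unfolding completion_def star_alg.simps
  by (rule UN_limit_class[OF s cauchy_star]) (simp_all add: alg_dist_star cauchy_seqsD s)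

lemma completion_times:
  assumes s: "s \<in> cauchy_seqs A" and t: "t \<in> cauchy_seqs A"
  shows "times (completion A) (limit_class A s) (limit_class A t) = limit_class A (\<lambda>n. times A (s n) (t n))"
  unfolding completion_def star_alg.simps
proof (rule UN_limit_class2[OF s t cauchy_times])
  fix p q assume p: "p \<in> cauchy_seqs A" and q: "q \<in> cauchy_seqs A"
    and lim: "(\<lambda>n. alg_dist A (p n) (s n)) \<longlonglongrightarrow> 0" "(\<lambda>n. alg_dist A (q n) (t n)) \<longlonglongrightarrow> 0"
  \<comment> \<open>Multiplication is not uniformly Lipschitz. The splitting in
    \<open>alg_dist_times\<close> keeps one factor from each pair, here \<open>p\<close> and
    \<open>t\<close>, and Cauchy sequences have bounded norms.\<close>
  obtain K where K: "K > 0" "\<And>n. nrm A (p n) \<le> K" using cauchy_seqs_bounded[OF p] by blast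
  obtain L where L: "L > 0" "\<And>n. nrm A (t n) \<le> L" using cauchy_seqs_bounded[OF t] by blast
  show "(\<lambda>n. alg_dist A (times A (p n) (q n)) (times A (s n) (t n))) \<longlonglongrightarrow> 0"
  proof (rule tendsto_sandwich[of "\<lambda>_. 0", OF _ _ tendsto_const])
    show "(\<lambda>n. K * alg_dist A (q n) (t n) + alg_dist A (p n) (s n) * L) \<longlonglongrightarrow> 0"
      using tendsto_add[OF tendsto_mult_left[OF lim(2), of K] tendsto_mult_right[OF lim(1), of L]] by simp
    show "\<forall>\<^sub>F n in sequentially. alg_dist A (times A (p n) (q n)) (times A (s n) (t n))
        \<le> K * alg_dist A (q n) (t n) + alg_dist A (p n) (s n) * L"
    proof (rule always_eventually, rule allI)
      fix n
      have "0 \<le> alg_dist A (p n) (s n)" "0 \<le> alg_dist A (q n) (t n)"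
        using p q s t by (simp_all add: alg_dist_nonneg cauchy_seqsD)
      moreover have "alg_dist A (times A (p n) (q n)) (times A (s n) (t n))
          \<le> nrm A (p n) * alg_dist A (q n) (t n) + alg_dist A (p n) (s n) * nrm A (t n)"
        using p q s t by (simp add: alg_dist_times cauchy_seqsD)
      ultimately show "alg_dist A (times A (p n) (q n)) (times A (s n) (t n))
          \<le> K * alg_dist A (q n) (t n) + alg_dist A (p n) (s n) * L"
        using mult_right_mono[OF K(2)[of n], of "alg_dist A (q n) (t n)"]
          mult_left_mono[OF L(2)[of n], of "alg_dist A (p n) (s n)"] by linarith
    qed
  qed (use p q s t in \<open>simp_all add: alg_dist_nonneg cauchy_seqsD closed\<close>)
qed

lemma completion_unit: "unit (completion A) = limit_class A (\<lambda>_. unit A)"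
  by (simp add: completion_def)

text \<open>The reverse triangle inequality makes the limit of the norms the same for all
  representatives of a class, so the \<open>THE\<close> in \<open>completion\<close> denotes
  it.\<close>

lemma nrm_completion_tendsto:
  assumes "s \<in> cauchy_seqs A"
  shows "(\<lambda>n. nrm A (s n)) \<longlonglongrightarrow> nrm (completion A) (limit_class A s)"
proof -
  obtain r where r: "(\<lambda>n. nrm A (s n)) \<longlonglongrightarrow> r"
    using nrm_convergent[OF assms] by (auto simp: convergent_def)
  have "(THE r. \<exists>p \<in> limit_class A s. (\<lambda>n. nrm A (p n)) \<longlonglongrightarrow> r) = r"
  proof (rule the_equality)
    show "\<exists>p \<in> limit_class A s. (\<lambda>n. nrm A (p n)) \<longlonglongrightarrow> r"
      using r limit_class_self[OF assms] by blast
    fix r' assume "\<exists>p \<in> limit_class A s. (\<lambda>n. nrm A (p n)) \<longlonglongrightarrow> r'"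
    then obtain p where p: "p \<in> limit_class A s" and r': "(\<lambda>n. nrm A (p n)) \<longlonglongrightarrow> r'" by blast
    have "(\<lambda>n. nrm A (p n) - nrm A (s n)) \<longlonglongrightarrow> 0"
    proof (rule Lim_null_comparison[OF _ limit_class_memD(3)[OF assms p]])
      show "\<forall>\<^sub>F n in sequentially. norm (nrm A (p n) - nrm A (s n)) \<le> alg_dist A (p n) (s n)"
        using assms limit_class_memD(1)[OF assms p] by (simp add: abs_nrm_diff_le cauchy_seqsD)
    qed
    then have "r' - r = 0"
      using LIMSEQ_unique[OF tendsto_diff[OF r' r]] by blast
    then show "r' = r" by simp
  qed
  then show ?thesis using r by (simp add: completion_def)
qed

lemma alg_dist_completion_tendsto:
  assumes "s \<in> cauchy_seqs A" "t \<in> cauchy_seqs A"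
  shows "(\<lambda>n. alg_dist A (s n) (t n)) \<longlonglongrightarrow> alg_dist (completion A) (limit_class A s) (limit_class A t)"
  unfolding alg_dist_def
  using nrm_completion_tendsto[OF cauchy_add[OF assms(1) cauchy_scale[OF assms(2), of "- 1"]]] assms
  by (simp add: completion_add completion_scale cauchy_scale)

text \<open>The Hausdorff property of the completion: it is what makes a continuous map into it
  determined by its values on a dense set.\<close>

lemma completion_alg_dist_0:
  assumes "P \<in> elems (completion A)" "Q \<in> elems (completion A)" "alg_dist (completion A) P Q = 0"
  shows "P = Q"
proof -
  obtain s t where st: "s \<in> cauchy_seqs A" "t \<in> cauchy_seqs A"
    and PQ: "P = limit_class A s" "Q = limit_class A t"
    using assms(1,2) unfolding completion_elems by blast
  show ?thesis
    using alg_dist_completion_tendsto[OF st] assms(3) unfolding PQ by (simp add: limit_class_eqI st)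
qed

lemmas completion_ops = completion_add completion_scale completion_times completion_star completion_unit
  cauchy_const cauchy_add cauchy_scale cauchy_times cauchy_star closed

text \<open>Representatives reduce each identity to the termwise identity in \<open>A\<close>; the
  conditions on the norm are limits of those in \<open>A\<close>.\<close>

lemma seminormed_star_alg_completion: "seminormed_star_alg (completion A)" (is "seminormed_star_alg ?C")
proof
  show "unit ?C \<in> elems ?C" by (simp add: completion_ops)
next
  fix P Q assume "P \<in> elems ?C" and "Q \<in> elems ?C"
  then obtain s t where st: "s \<in> cauchy_seqs A" "t \<in> cauchy_seqs A"
    and PQ: "P = limit_class A s" "Q = limit_class A t" 
    unfolding completion_elems by blast
  note mem [simp] = cauchy_seqsD[OF st(1)] cauchy_seqsD[OF st(2)]
  show "add ?C P Q \<in> elems ?C"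
    "times ?C P Q \<in> elems ?C"
    using st by (simp_all add: PQ completion_ops)
  show "add ?C P Q = add ?C Q P"
    "add ?C P (scale ?C 0 Q) = P"
    using st by (simp_all add: PQ completion_ops add_commute add_zero)
  show "scale ?C c (add ?C P Q)
      = add ?C (scale ?C c P) (scale ?C c Q)" for c
    using st by (simp add: PQ completion_ops scale_add_right)
  show "times ?C (scale ?C c P) Q = scale ?C c (times ?C P Q)"
    "times ?C P (scale ?C c Q) = scale ?C c (times ?C P Q)" for c
    using st by (simp_all add: PQ completion_ops times_scale_left times_scale_right)
  show "star ?C (add ?C P Q)
      = add ?C (star ?C P) (star ?C Q)"
    "star ?C (times ?C P Q)
      = times ?C (star ?C Q) (star ?C P)"
    using st by (simp_all add: PQ completion_ops star_add star_times)
  have "nrm ?C (limit_class A (\<lambda>n. add A (s n) (t n))) \<le> nrm ?C P + nrm ?C Q"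
    unfolding PQ
    by (rule LIMSEQ_le[OF nrm_completion_tendsto tendsto_add[OF nrm_completion_tendsto nrm_completion_tendsto]])
      (use st in \<open>auto simp: cauchy_add nrm_add\<close>)
  then show "nrm ?C (add ?C P Q) \<le> nrm ?C P + nrm ?C Q"
    using st by (simp add: PQ completion_add)
  have "nrm ?C (limit_class A (\<lambda>n. times A (s n) (t n))) \<le> nrm ?C P * nrm ?C Q"
    unfolding PQ
    by (rule LIMSEQ_le[OF nrm_completion_tendsto tendsto_mult[OF nrm_completion_tendsto nrm_completion_tendsto]])
      (use st in \<open>auto simp: cauchy_times nrm_times\<close>)
  then show "nrm ?C (times ?C P Q) \<le> nrm ?C P * nrm ?C Q"
    using st by (simp add: PQ completion_times)
next
  fix P Q R assume "P \<in> elems ?C" "Q \<in> elems ?C" "R \<in> elems ?C"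
  then obtain s t u where st: "s \<in> cauchy_seqs A" "t \<in> cauchy_seqs A" "u \<in> cauchy_seqs A"
    and PQ: "P = limit_class A s" "Q = limit_class A t" "R = limit_class A u" 
    unfolding completion_elems by blast
  note mem [simp] = cauchy_seqsD[OF st(1)] cauchy_seqsD[OF st(2)] cauchy_seqsD[OF st(3)]
  show "add ?C (add ?C P Q) R = add ?C P (add ?C Q R)"
    "times ?C (times ?C P Q) R = times ?C P (times ?C Q R)"
    "times ?C (add ?C P Q) R
      = add ?C (times ?C P R) (times ?C Q R)"
    "times ?C R (add ?C P Q)
      = add ?C (times ?C R P) (times ?C R Q)"
    using st by (simp_all add: PQ completion_ops add_assoc times_assoc times_add_left times_add_right)
next
  fix P assume "P \<in> elems ?C"
  then obtain s where s: "s \<in> cauchy_seqs A" and P: "P = limit_class A s" 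
    unfolding completion_elems by blast
  note mem [simp] = cauchy_seqsD[OF s]
  show "scale ?C c P \<in> elems ?C" for c
    using s by (simp add: P completion_ops)
  show "star ?C P \<in> elems ?C"
    using s by (simp add: P completion_ops)
  show "scale ?C (c + e) P = add ?C (scale ?C c P) (scale ?C e P)"
    "scale ?C c (scale ?C e P) = scale ?C (c * e) P" for c e
    using s by (simp_all add: P completion_ops scale_add_left scale_scale)
  show "scale ?C 1 P = P" "times ?C (unit ?C) P = P"
    "times ?C P (unit ?C) = P" "star ?C (star ?C P) = P"
    using s by (simp_all add: P completion_ops scale_one unit_left unit_right star_star)
  show "star ?C (scale ?C c P) = scale ?C (cnj c) (star ?C P)" for c
    using s by (simp add: P completion_ops star_scale)
  show "0 \<le> nrm ?C P"
    using s by (intro LIMSEQ_le_const[OF nrm_completion_tendsto[OF s, folded P]])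
      (auto simp: completion_ops nrm_nonneg)
  show "nrm ?C (scale ?C c P) = cmod c * nrm ?C P" for c
    using LIMSEQ_unique[OF nrm_completion_tendsto[OF cauchy_scale[OF s, of c]]
        , of "cmod c * nrm ?C P"]
      tendsto_mult_left[OF nrm_completion_tendsto[OF s], of "cmod c"] s
    by (simp add: P completion_scale nrm_scale)
  show "nrm ?C (star ?C P) = nrm ?C P"
    using LIMSEQ_unique[OF nrm_completion_tendsto[OF cauchy_star[OF s]], of "nrm ?C P"]
      nrm_completion_tendsto[OF s] s
    by (simp add: P completion_star nrm_star)
qed

section \<open>The dense embedding into the completion\<close>

lemma embed_closed: "a \<in> elems A \<Longrightarrow> completion_embed A a \<in> elems (completion A)"
  by (simp add: completion_embed_def cauchy_const)

lemma embed_add: "\<lbrakk>a \<in> elems A; b \<in> elems A\<rbrakk> \<Longrightarrow>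
    completion_embed A (add A a b) = add (completion A) (completion_embed A a) (completion_embed A b)"
  by (simp add: completion_embed_def completion_ops)

lemma embed_scale: "a \<in> elems A \<Longrightarrow>
    completion_embed A (scale A c a) = scale (completion A) c (completion_embed A a)"
  by (simp add: completion_embed_def completion_ops)

lemma nrm_embed: "a \<in> elems A \<Longrightarrow> nrm (completion A) (completion_embed A a) = nrm A a"
  using LIMSEQ_unique[OF nrm_completion_tendsto[OF cauchy_const] tendsto_const]
  by (simp add: completion_embed_def)

lemma embed_dense:
  assumes "P \<in> elems (completion A)" "e > 0"
  obtains a where "a \<in> elems A" "alg_dist (completion A) P (completion_embed A a) < e"
proof -
  obtain s where s: "s \<in> cauchy_seqs A" and P: "P = limit_class A s"
    using assms(1) by auto
  \<comment> \<open>Half of \<open>e\<close>, because passing to the limit turns the strict bound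
    into a weak one.\<close>
  obtain N where N: "\<forall>i\<ge>N. \<forall>j\<ge>N. alg_dist A (s i) (s j) < e / 2"
    using s assms(2) unfolding cauchy_seqs_def by (smt (verit) half_gt_zero mem_Collect_eq)
  have "alg_dist (completion A) P (completion_embed A (s N)) \<le> e / 2"
    unfolding P completion_embed_def
  proof (rule LIMSEQ_le_const2[OF alg_dist_completion_tendsto[OF s cauchy_const]])
    show "\<exists>M. \<forall>n\<ge>M. alg_dist A (s n) (s N) \<le> e / 2"
      using N by (meson less_imp_le order_refl)
  qed (simp add: s cauchy_seqsD)
  then show thesis
    using that[of "s N"] s assms(2) by (simp add: cauchy_seqsD)
qed

end

text \<open>If r exceeded N > 0, the powers of r / N would outgrow every C. This is how a
  multiplicative constant disappears on taking 2^n-th roots.\<close>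

lemma le_if_power_two_power_bound:
  fixes r N C :: real
  assumes "0 \<le> N" and bound: "\<And>n. r ^ 2 ^ n \<le> C * N ^ 2 ^ n"
  shows "r \<le> N"
proof (rule ccontr)
  assume "\<not> r \<le> N"
  then have r: "N < r" by simp
  \<comment> \<open>The instance n = 0 of the bound: for N = 0 it would give r \<le> 0.\<close>
  have "N \<noteq> 0" using bound[of 0] r by auto
  then have N: "0 < N" using assms(1) by simp
  then have x: "1 < r / N" using r by simp
  then obtain n where "C < (r / N) ^ n" using real_arch_pow by blast
  also have "\<dots> \<le> (r / N) ^ 2 ^ n"
    using x by (intro power_increasing) auto
  also have "\<dots> \<le> C"
    using bound[of n] N by (simp add: power_divide divide_le_eq)
  finally show False by simp
qed

text \<open>Cauchy-Schwarz for a possibly degenerate form, with w the squared modulus of the product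
  of two vectors. The quadratic is evaluated at its minimum s = 1 / B; for B = 0 a linear function
  of negative slope cannot stay non-negative.\<close>

lemma quadratic_nonneg_imp:
  fixes A B w :: real
  assumes "0 \<le> B" and "\<And>s. 0 \<le> A - 2 * s * w + s\<^sup>2 * w * B" and "0 \<le> A"
  shows "w \<le> A * B"
proof (cases "B = 0")
  case True
  have "w \<le> 0"
  proof (rule ccontr)
    assume "\<not> w \<le> 0"
    \<comment> \<open>At this value of s the expression equals A - (A + 1).\<close>
    then show False using assms(2)[of "(A + 1) / (2 * w)"] True by simp
  qed
  then show ?thesis using True by simp
next
  case False
  then have "0 \<le> A - w / B"
    using assms(2)[of "1 / B"] by (simp add: power2_eq_square)
  then show ?thesis using False assms(1) by (simp add: field_simps)
qed

section \<open>The norm of the enveloping C*-algebra\<close>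

lemma with_cstar_norm_simps [simp]:
  "elems (with_cstar_norm A) = elems A" "unit (with_cstar_norm A) = unit A"
  "add (with_cstar_norm A) = add A" "scale (with_cstar_norm A) = scale A"
  "times (with_cstar_norm A) = times A" "star (with_cstar_norm A) = star A"
  "nrm (with_cstar_norm A) a = (SUP p \<in> Collect (cstar_seminorm A). p a)"
  by (simp_all add: with_cstar_norm_def)

context seminormed_star_alg
begin

text \<open>The power x^(2^n). Only these powers occur, because the C*-identity and Cauchy-Schwarz
  both control squares.\<close>

abbreviation sqpow :: "nat \<Rightarrow> 'x \<Rightarrow> 'x" where
  "sqpow n \<equiv> (\<lambda>x. times A x x) ^^ n"

lemma sqpow_selfadjoint:
  assumes "x \<in> elems A" "star A x = x"
  shows "sqpow n x \<in> elems A \<and> star A (sqpow n x) = sqpow n x \<and> nrm A (sqpow n x) \<le> nrm A x ^ 2 ^ n"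
proof (induction n)
  case (Suc n)
  then have "nrm A (sqpow (Suc n) x) \<le> nrm A (sqpow n x) * nrm A (sqpow n x)"
    by (simp add: nrm_times)
  also have "\<dots> \<le> nrm A x ^ 2 ^ n * nrm A x ^ 2 ^ n"
    using Suc by (intro mult_mono) (auto simp: nrm_nonneg assms)
  finally show ?case using Suc
    by (simp add: times_closed star_times power_add[symmetric] mult_2)
qed (simp add: assms)

lemma star_mult_self:
  assumes "a \<in> elems A"
  shows "times A (star A a) a \<in> elems A" "star A (times A (star A a) a) = times A (star A a) a"
    "nrm A (times A (star A a) a) \<le> (nrm A a)\<^sup>2"
  using assms nrm_times[of "star A a" a]
  by (simp_all add: closed star_times star_star nrm_star power2_eq_square)

text \<open>The spectral radius argument. For x = a* a the C*-identity computes p (x^(2^n)) as the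
  2^n-th power of p x, while continuity bounds it by C times the 2^n-th power of
  \<open>nrm A x\<close>; taking roots removes C.\<close>

lemma cstar_seminorm_le_nrm:
  assumes p: "cstar_seminorm A p" and a: "a \<in> elems A"
  shows "p a \<le> nrm A a"
proof -
  obtain C where C: "\<And>a. a \<in> elems A \<Longrightarrow> p a \<le> C * nrm A a"
    using p unfolding cstar_seminorm_def by blast
  let ?x = "times A (star A a) a"
  note x = star_mult_self[OF a]
  \<comment> \<open>Each \<open>sqpow n ?x\<close> is self-adjoint, so its square has the form y* y
    required by the C*-identity.\<close>
  have sq: "p (sqpow n ?x) = ((p a)\<^sup>2) ^ 2 ^ n" for n
  proof (induction n)
    case 0
    then show ?case using p a by (simp add: cstar_seminorm_def)
  next
    case (Suc n)
    have "p (sqpow (Suc n) ?x) = p (times A (star A (sqpow n ?x)) (sqpow n ?x))"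
      using sqpow_selfadjoint[OF x(1,2), of n] by simp
    also have "\<dots> = (p (sqpow n ?x))\<^sup>2"
      using p sqpow_selfadjoint[OF x(1,2), of n] unfolding cstar_seminorm_def by blast
    finally show ?case by (simp add: Suc power_mult[symmetric] mult.commute mult.left_commute)
  qed
  have "(p a)\<^sup>2 \<le> (nrm A a)\<^sup>2"
  proof (rule le_if_power_two_power_bound)
    fix n
    have "((p a)\<^sup>2) ^ 2 ^ n \<le> C * nrm A (sqpow n ?x)"
      using C sqpow_selfadjoint[OF x(1,2), of n] by (simp add: sq[symmetric])
    also have "\<dots> \<le> \<bar>C\<bar> * nrm A (sqpow n ?x)"
      using sqpow_selfadjoint[OF x(1,2), of n] by (intro mult_right_mono) (auto simp: nrm_nonneg)
    also have "\<dots> \<le> \<bar>C\<bar> * ((nrm A a)\<^sup>2) ^ 2 ^ n"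
    proof (rule mult_left_mono)
      have "nrm A ?x ^ 2 ^ n \<le> ((nrm A a)\<^sup>2) ^ 2 ^ n"
        by (rule power_mono[OF x(3)]) (simp add: nrm_nonneg x)
      then show "nrm A (sqpow n ?x) \<le> ((nrm A a)\<^sup>2) ^ 2 ^ n"
        using sqpow_selfadjoint[OF x(1,2), of n] by linarith
    qed simp
    finally show "((p a)\<^sup>2) ^ 2 ^ n \<le> \<bar>C\<bar> * ((nrm A a)\<^sup>2) ^ 2 ^ n" .
  qed simp
  then show ?thesis by (rule power2_le_imp_le) (simp add: nrm_nonneg a)
qed

lemma cstar_seminorm_zero: "cstar_seminorm A (\<lambda>_. 0)"
  by (auto simp: cstar_seminorm_def intro: exI[of _ 0])

text \<open>A real supremum is meaningful only over a bounded non-empty set; non-emptiness comes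
  from \<open>cstar_seminorm_zero\<close>.\<close>

lemma cstar_norm_bdd: "a \<in> elems A \<Longrightarrow> bdd_above ((\<lambda>p. p a) ` Collect (cstar_seminorm A))"
  by (rule bdd_aboveI[of _ "nrm A a"]) (auto simp: cstar_seminorm_le_nrm)

lemma le_cstar_norm:
  "\<lbrakk>cstar_seminorm A p; a \<in> elems A\<rbrakk> \<Longrightarrow> p a \<le> nrm (with_cstar_norm A) a"
  unfolding with_cstar_norm_simps by (rule cSUP_upper[OF _ cstar_norm_bdd]) auto

lemma cstar_norm_le:
  assumes "\<And>p. cstar_seminorm A p \<Longrightarrow> p a \<le> r"
  shows "nrm (with_cstar_norm A) a \<le> r"
  unfolding with_cstar_norm_simps
  using cstar_seminorm_zero by (intro cSUP_least) (auto intro: assms)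

lemma cstar_norm_le_nrm: "a \<in> elems A \<Longrightarrow> nrm (with_cstar_norm A) a \<le> nrm A a"
  by (rule cstar_norm_le) (rule cstar_seminorm_le_nrm)

lemma cstar_norm_nonneg: "a \<in> elems A \<Longrightarrow> 0 \<le> nrm (with_cstar_norm A) a"
  using le_cstar_norm[OF cstar_seminorm_zero] .

lemma seminormed_star_alg_with_cstar_norm: "seminormed_star_alg (with_cstar_norm A)"
\<comment> \<open>Goals 24 to 28 are the five axioms on the norm; the others are inherited, as the
  operations do not change.\<close>
proof (unfold_locales, goal_cases)
  case (25 a b)
  show ?case
  proof (rule cstar_norm_le)
    fix p assume p: "cstar_seminorm A p"
    then have "p (add A a b) \<le> p a + p b" using 25 by (simp add: cstar_seminorm_def)
    also have "\<dots> \<le> nrm (with_cstar_norm A) a + nrm (with_cstar_norm A) b"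
      using 25 p by (intro add_mono le_cstar_norm) auto
    finally show "p (add (with_cstar_norm A) a b) \<le> nrm (with_cstar_norm A) a + nrm (with_cstar_norm A) b"
      by simp
  qed
next
  case (26 a c)
  have le: "nrm (with_cstar_norm A) (scale A c b) \<le> cmod c * nrm (with_cstar_norm A) b"
    if "b \<in> elems A" for b c
  proof (rule cstar_norm_le)
    fix p assume p: "cstar_seminorm A p"
    then have "p (scale A c b) = cmod c * p b" using that by (simp add: cstar_seminorm_def)
    also have "\<dots> \<le> cmod c * nrm (with_cstar_norm A) b"
      using that p by (intro mult_left_mono le_cstar_norm) auto
    finally show "p (scale A c b) \<le> cmod c * nrm (with_cstar_norm A) b" .
  qed
  show ?case
    using homogeneousI[OF le cstar_norm_nonneg, of a c] 26 by (simp del: with_cstar_norm_simps(7))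
next
  case (27 a b)
  show ?case
  proof (rule cstar_norm_le)
    fix p assume p: "cstar_seminorm A p"
    then have "p (times A a b) \<le> p a * p b" using 27 by (simp add: cstar_seminorm_def)
    also have "\<dots> \<le> nrm (with_cstar_norm A) a * nrm (with_cstar_norm A) b"
      using 27 p by (intro mult_mono le_cstar_norm cstar_norm_nonneg) (auto simp: cstar_seminorm_def)
    finally show "p (times (with_cstar_norm A) a b) \<le> nrm (with_cstar_norm A) a * nrm (with_cstar_norm A) b"
      by simp
  qed
next
  case (28 a)
  have "p (star A a) = p a" if "p \<in> Collect (cstar_seminorm A)" for p
    using 28 that by (simp add: cstar_seminorm_def)
  then show ?case by (auto intro: SUP_cong)
next
  case (24 a)
  then show ?case using cstar_norm_nonneg by simp
qed (simp_all add: closed add_commute add_left_commute add_assoc add_zero scale_add_right scale_add_left scale_scale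
  scale_one times_assoc times_add_left times_add_right times_scale_left times_scale_right unit_left
  unit_right star_star star_add star_scale star_times)

end

section \<open>The form of a state and its operator seminorm\<close>

locale star_alg_state = seminormed_star_alg A for A :: "'x star_alg" +
  fixes \<phi> :: "'x \<Rightarrow> complex"
  assumes state: "is_state A \<phi>"
begin

lemma phi_add: "\<lbrakk>a \<in> elems A; b \<in> elems A\<rbrakk> \<Longrightarrow> \<phi> (add A a b) = \<phi> a + \<phi> b"
  and phi_scale: "a \<in> elems A \<Longrightarrow> \<phi> (scale A c a) = c * \<phi> a"
  and phi_pos: "a \<in> elems A \<Longrightarrow> \<phi> (times A (star A a) a) \<in> \<real>\<^sub>\<ge>\<^sub>0"
  and phi_unit: "\<phi> (unit A) = 1"
  using state by (simp_all add: is_state_def continuous_functional_def)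

text \<open>The GNS form, conjugate-linear in the first argument. It may be degenerate, and no
  quotient by its null vectors is taken.\<close>

definition ip :: "'x \<Rightarrow> 'x \<Rightarrow> complex" where
  "ip a b = \<phi> (times A (star A a) b)"

definition sqn :: "'x \<Rightarrow> real" where
  "sqn a = Re (ip a a)"

lemma ip_self: "a \<in> elems A \<Longrightarrow> ip a a = of_real (sqn a)"
  using phi_pos[of a] by (auto simp: sqn_def ip_def nonneg_Reals_def)

lemma sqn_nonneg: "a \<in> elems A \<Longrightarrow> 0 \<le> sqn a"
  using phi_pos[of a] by (auto simp: sqn_def ip_def nonneg_Reals_def)

lemma ip_add_left: "\<lbrakk>a \<in> elems A; b \<in> elems A; c \<in> elems A\<rbrakk> \<Longrightarrow> ip (add A a b) c = ip a c + ip b c"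
  by (simp add: ip_def star_add times_add_left phi_add closed)

lemma ip_add_right: "\<lbrakk>a \<in> elems A; b \<in> elems A; c \<in> elems A\<rbrakk> \<Longrightarrow> ip c (add A a b) = ip c a + ip c b"
  by (simp add: ip_def times_add_right phi_add closed)

lemma ip_scale_left: "\<lbrakk>a \<in> elems A; b \<in> elems A\<rbrakk> \<Longrightarrow> ip (scale A c a) b = cnj c * ip a b"
  by (simp add: ip_def star_scale times_scale_left phi_scale closed)

lemma ip_scale_right: "\<lbrakk>a \<in> elems A; b \<in> elems A\<rbrakk> \<Longrightarrow> ip a (scale A c b) = c * ip a b"
  by (simp add: ip_def times_scale_right phi_scale closed)

lemmas ip_simps = ip_add_left ip_add_right ip_scale_left ip_scale_right closed

text \<open>By polarization, as \<open>ip\<close> is real on the diagonal.\<close>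

lemma ip_commute:
  assumes "a \<in> elems A" "b \<in> elems A"
  shows "ip b a = cnj (ip a b)"
proof -
  have 1: "Im (ip (add A a b) (add A a b)) = 0" "Im (ip a a) = 0" "Im (ip b b) = 0"
    using assms by (simp_all add: ip_self closed)
  have 2: "Im (ip (add A a (scale A \<i> b)) (add A a (scale A \<i> b))) = 0"
    using assms by (simp add: ip_self closed)
  show ?thesis
    using 1 2 assms by (simp add: complex_eq_iff ip_simps)
qed

lemma cauchy_schwarz:
  assumes "a \<in> elems A" "b \<in> elems A"
  shows "(cmod (ip a b))\<^sup>2 \<le> sqn a * sqn b"
proof (rule quadratic_nonneg_imp)
  fix s :: real
  \<comment> \<open>The factor \<open>cnj (ip a b)\<close> makes the two cross terms real: each
    equals -s times the squared modulus of \<open>ip a b\<close>.\<close>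
  let ?c = "add A a (scale A (- of_real s * cnj (ip a b)) b)"
  have "ip ?c ?c = ip a a - 2 * of_real s * (ip a b * cnj (ip a b)) + (of_real s)\<^sup>2 * (ip a b * cnj (ip a b)) * ip b b"
    using assms by (simp add: ip_simps ip_commute[of a b] algebra_simps power2_eq_square)
  then have "ip ?c ?c = of_real (sqn a - 2 * s * (cmod (ip a b))\<^sup>2 + s\<^sup>2 * (cmod (ip a b))\<^sup>2 * sqn b)"
    by (simp add: ip_self[OF assms(1)] ip_self[OF assms(2)] complex_norm_square[symmetric] flip: of_real_power)
  then have "sqn ?c = sqn a - 2 * s * (cmod (ip a b))\<^sup>2 + s\<^sup>2 * (cmod (ip a b))\<^sup>2 * sqn b"
    by (simp only: sqn_def Re_complex_of_real)
  then show "0 \<le> sqn a - 2 * s * (cmod (ip a b))\<^sup>2 + s\<^sup>2 * (cmod (ip a b))\<^sup>2 * sqn b"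
    using sqn_nonneg[of ?c] assms by (simp add: closed)
qed (use assms in \<open>simp_all add: sqn_nonneg\<close>)

definition nm :: "'x \<Rightarrow> real" where
  "nm a = sqrt (sqn a)"

lemma nm_nonneg: "a \<in> elems A \<Longrightarrow> 0 \<le> nm a"
  by (simp add: nm_def sqn_nonneg)

lemma nm_sq: "a \<in> elems A \<Longrightarrow> (nm a)\<^sup>2 = sqn a"
  by (simp add: nm_def sqn_nonneg)

lemma cauchy_schwarz_nm:
  assumes "a \<in> elems A" "b \<in> elems A"
  shows "cmod (ip a b) \<le> nm a * nm b"
proof (rule power2_le_imp_le)
  show "(cmod (ip a b))\<^sup>2 \<le> (nm a * nm b)\<^sup>2"
    using cauchy_schwarz[OF assms] assms by (simp add: power_mult_distrib nm_sq)
qed (use assms in \<open>simp add: nm_nonneg\<close>)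

lemma nm_add:
  assumes "a \<in> elems A" "b \<in> elems A"
  shows "nm (add A a b) \<le> nm a + nm b"
proof (rule power2_le_imp_le)
  have "sqn (add A a b) = sqn a + 2 * Re (ip a b) + sqn b"
    using assms by (simp add: sqn_def ip_simps ip_commute[of a b])
  also have "\<dots> \<le> sqn a + 2 * (nm a * nm b) + sqn b"
    using cauchy_schwarz_nm[OF assms] complex_Re_le_cmod[of "ip a b"] by linarith
  finally show "(nm (add A a b))\<^sup>2 \<le> (nm a + nm b)\<^sup>2"
    using assms by (simp add: nm_sq closed power2_sum)
qed (use assms in \<open>simp add: nm_nonneg\<close>)

lemma sqn_scale: "a \<in> elems A \<Longrightarrow> sqn (scale A c a) = (cmod c)\<^sup>2 * sqn a"
proof -
  assume a: "a \<in> elems A"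
  have "ip (scale A c a) (scale A c a) = (c * cnj c) * ip a a"
    using a by (simp add: ip_simps)
  then have "ip (scale A c a) (scale A c a) = of_real ((cmod c)\<^sup>2 * sqn a)"
    by (simp only: ip_self[OF a] complex_norm_square[symmetric] of_real_mult)
  then show ?thesis by (simp only: sqn_def Re_complex_of_real)
qed

lemma nm_scale: "a \<in> elems A \<Longrightarrow> nm (scale A c a) = cmod c * nm a"
  by (simp add: nm_def sqn_scale real_sqrt_mult)

lemma ip_adjoint: "\<lbrakk>a \<in> elems A; b \<in> elems A; c \<in> elems A\<rbrakk> \<Longrightarrow>
    ip (times A a b) c = ip b (times A (star A a) c)"
  by (simp add: ip_def star_times times_assoc closed)

lemma sqn_unit: "sqn (unit A) = 1"
  by (simp add: sqn_def ip_def star_unit unit_left unit_closed phi_unit)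

lemma sqn_times_eq: "\<lbrakk>b \<in> elems A; c \<in> elems A\<rbrakk> \<Longrightarrow>
    sqn (times A b c) = Re (ip c (times A (times A (star A b) b) c))"
  by (simp add: sqn_def ip_adjoint times_assoc closed)

text \<open>Boundedness of left multiplication. With x = b* b and t n = <c, x^(2^n) c>,
  Cauchy-Schwarz gives (t n)^2 \<le> <c, c> t (n + 1). Hence the 2^n-th power of t 0 / <c, c> is at
  most t n / <c, c>, which by continuity is a constant times the 2^n-th power of
  \<open>nrm A x\<close>, and roots remove the constant.\<close>

lemma sqn_times_le:
  assumes b: "b \<in> elems A" and c: "c \<in> elems A"
  shows "sqn (times A b c) \<le> (nrm A b)\<^sup>2 * sqn c"
proof -
  obtain C where C: "\<And>a. a \<in> elems A \<Longrightarrow> cmod (\<phi> a) \<le> C * nrm A a"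
    using state unfolding is_state_def continuous_functional_def by blast
  let ?x = "times A (star A b) b"
  note x = star_mult_self[OF b]
  define X where "X n = sqpow n ?x" for n
  have X: "X n \<in> elems A" "star A (X n) = X n" "nrm A (X n) \<le> nrm A ?x ^ 2 ^ n"
    "X (Suc n) = times A (X n) (X n)" for n
    using sqpow_selfadjoint[OF x(1,2), of n] by (auto simp: X_def)
  define t where "t n = Re (ip c (times A (X n) c))" for n
  have t0: "t 0 = sqn (times A b c)"
    by (simp add: t_def X_def sqn_times_eq b c)
  have tSuc: "t (Suc n) = sqn (times A (X n) c)" for n
    by (simp add: t_def X sqn_times_eq c)
  \<comment> \<open>Cauchy-Schwarz for \<open>c\<close> and the product of \<open>X n\<close> with
    \<open>c\<close>; since \<open>X n\<close> is self-adjoint, the squared length of that product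
    is t (n + 1).\<close>
  have step: "(t n)\<^sup>2 \<le> sqn c * t (Suc n)" for n
  proof -
    have "(t n)\<^sup>2 \<le> (cmod (ip c (times A (X n) c)))\<^sup>2"
      unfolding t_def by (rule abs_le_square_iff[THEN iffD1]) (simp add: abs_Re_le_cmod)
    also have "\<dots> \<le> sqn c * sqn (times A (X n) c)"
      by (rule cauchy_schwarz) (simp_all add: c closed X)
    finally show ?thesis by (simp add: tSuc)
  qed
  show ?thesis
  proof (cases "sqn c = 0")
    case True
    then have "t 0 = 0" using step[of 0] by simp
    then show ?thesis using t0 True by simp
  next
    case False
    then have pos: "0 < sqn c" using sqn_nonneg[OF c] by simp
    have t0nn: "0 \<le> t 0" by (simp add: t0 sqn_nonneg closed b c)
    have low: "(t 0 / sqn c) ^ 2 ^ n \<le> t n / sqn c" for n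
    proof (induction n)
      case (Suc n)
      have "(t 0 / sqn c) ^ 2 ^ Suc n = ((t 0 / sqn c) ^ 2 ^ n)\<^sup>2"
        by (simp add: power_mult[symmetric] mult.commute)
      also have "\<dots> \<le> (t n / sqn c)\<^sup>2"
        using Suc t0nn pos by (intro power_mono) auto
      also have "\<dots> \<le> t (Suc n) / sqn c"
        using step[of n] pos by (simp add: field_simps power2_eq_square)
      finally show ?case .
    qed simp
    \<comment> \<open>Continuity bounds t n by a multiple of \<open>nrm A ?x ^ 2 ^ n\<close>; the
      factor depends on \<open>c\<close> but not on n.\<close>
    have "t 0 / sqn c \<le> nrm A ?x"
    proof (rule le_if_power_two_power_bound)
      fix n
      have "t n \<le> cmod (ip c (times A (X n) c))"
        unfolding t_def by (rule complex_Re_le_cmod)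
      also have "\<dots> \<le> C * nrm A (times A (star A c) (times A (X n) c))"
        unfolding ip_def by (rule C) (simp add: closed c X)
      also have "\<dots> \<le> \<bar>C\<bar> * nrm A (times A (star A c) (times A (X n) c))"
        by (intro mult_right_mono) (simp_all add: nrm_nonneg closed c X)
      also have "\<dots> \<le> \<bar>C\<bar> * (nrm A c * (nrm A ?x ^ 2 ^ n * nrm A c))"
      proof (intro mult_left_mono)
        have "nrm A (times A (star A c) (times A (X n) c)) \<le> nrm A c * nrm A (times A (X n) c)"
          using nrm_times[of "star A c" "times A (X n) c"] by (simp add: closed c X nrm_star)
        also have "\<dots> \<le> nrm A c * (nrm A (X n) * nrm A c)"
          by (intro mult_left_mono nrm_times) (simp_all add: c X nrm_nonneg)
        also have "\<dots> \<le> nrm A c * (nrm A ?x ^ 2 ^ n * nrm A c)"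
          by (intro mult_left_mono mult_right_mono X) (simp_all add: c nrm_nonneg)
        finally show "nrm A (times A (star A c) (times A (X n) c)) \<le> nrm A c * (nrm A ?x ^ 2 ^ n * nrm A c)" .
      qed simp
      finally have "t n / sqn c \<le> \<bar>C\<bar> * (nrm A c * (nrm A ?x ^ 2 ^ n * nrm A c)) / sqn c"
        using pos by (simp add: divide_right_mono)
      then show "(t 0 / sqn c) ^ 2 ^ n \<le> (\<bar>C\<bar> * (nrm A c)\<^sup>2 / sqn c) * nrm A ?x ^ 2 ^ n"
        using low[of n] by (simp add: power2_eq_square mult_ac)
    qed (simp add: nrm_nonneg x)
    also have "\<dots> \<le> (nrm A b)\<^sup>2" by (rule x)
    finally show ?thesis using pos by (simp add: t0 divide_le_eq)
  qed
qed

lemma nm_times_le: "\<lbrakk>b \<in> elems A; c \<in> elems A\<rbrakk> \<Longrightarrow> nm (times A b c) \<le> nrm A b * nm c"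
  using real_sqrt_le_mono[OF sqn_times_le[of b c]]
  by (simp add: nm_def real_sqrt_mult nrm_nonneg)

text \<open>A supremum over the unit ball rather than of quotients, so that null vectors need no
  exception; the ball contains the unit and is therefore non-empty.\<close>

definition opn :: "'x \<Rightarrow> real" where
  "opn b = (SUP c \<in> {c \<in> elems A. nm c \<le> 1}. nm (times A b c))"

lemma nm_unit: "nm (unit A) = 1"
  by (simp add: nm_def sqn_unit)

lemma opn_le:
  assumes "\<And>c. \<lbrakk>c \<in> elems A; nm c \<le> 1\<rbrakk> \<Longrightarrow> nm (times A b c) \<le> r"
  shows "opn b \<le> r"
  unfolding opn_def using unit_closed nm_unit by (intro cSUP_least) (auto intro: assms)

lemma le_opn:
  assumes "b \<in> elems A" "c \<in> elems A" "nm c \<le> 1"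
  shows "nm (times A b c) \<le> opn b"
  unfolding opn_def
proof (rule cSUP_upper)
  show "bdd_above ((\<lambda>c. nm (times A b c)) ` {c \<in> elems A. nm c \<le> 1})"
  proof (rule bdd_aboveI2)
    fix c assume "c \<in> {c \<in> elems A. nm c \<le> 1}"
    then show "nm (times A b c) \<le> nrm A b"
      using nm_times_le[of b c] mult_left_mono[of "nm c" 1 "nrm A b"] assms(1)
      by (simp add: nrm_nonneg)
  qed
qed (use assms in simp)

lemma opn_nonneg: "b \<in> elems A \<Longrightarrow> 0 \<le> opn b"
  using le_opn[of b "unit A"] nm_nonneg[of "times A b (unit A)"] by (simp add: closed nm_unit)

lemma nm_times_opn:
  assumes "b \<in> elems A" "c \<in> elems A"
  shows "nm (times A b c) \<le> opn b * nm c"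
proof (cases "nm c = 0")
  case True
  \<comment> \<open>By boundedness, left multiplication sends null vectors to null vectors.\<close>
  then show ?thesis using nm_times_le[OF assms] by simp
next
  case False
  then have pos: "0 < nm c" using nm_nonneg[OF assms(2)] by simp
  let ?k = "complex_of_real (1 / nm c)"
  have "nm (times A b (scale A ?k c)) \<le> opn b"
    using pos assms by (intro le_opn) (simp_all add: closed nm_scale norm_divide)
  then show ?thesis
    using pos assms by (simp add: times_scale_right nm_scale closed norm_divide field_simps)
qed

lemma opn_le_nrm:
  assumes "b \<in> elems A"
  shows "opn b \<le> nrm A b"
proof (rule opn_le)
  fix c assume "c \<in> elems A" "nm c \<le> 1"
  then show "nm (times A b c) \<le> nrm A b"
    using nm_times_le[of b c] mult_left_mono[of "nm c" 1 "nrm A b"] assms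
    by (simp add: nrm_nonneg)
qed

lemma opn_scale:
  assumes "b \<in> elems A"
  shows "opn (scale A k b) = cmod k * opn b"
proof (rule homogeneousI[OF _ opn_nonneg assms])
  fix k b assume "b \<in> elems A"
  then show "opn (scale A k b) \<le> cmod k * opn b"
    by (intro opn_le) (simp add: times_scale_left nm_scale closed mult_left_mono le_opn)
qed

lemma opn_times:
  assumes "a \<in> elems A" "b \<in> elems A"
  shows "opn (times A a b) \<le> opn a * opn b"
proof (rule opn_le)
  fix c assume c: "c \<in> elems A" "nm c \<le> 1"
  have "nm (times A (times A a b) c) \<le> opn a * nm (times A b c)"
    using assms c by (simp add: times_assoc nm_times_opn closed)
  also have "\<dots> \<le> opn a * opn b"
    using assms c by (intro mult_left_mono le_opn opn_nonneg)
  finally show "nm (times A (times A a b) c) \<le> opn a * opn b" .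
qed

lemma opn_add:
  assumes "a \<in> elems A" "b \<in> elems A"
  shows "opn (add A a b) \<le> opn a + opn b"
proof (rule opn_le)
  fix c assume c: "c \<in> elems A" "nm c \<le> 1"
  have "nm (times A (add A a b) c) \<le> nm (times A a c) + nm (times A b c)"
    using assms c by (simp add: times_add_left nm_add closed)
  also have "\<dots> \<le> opn a + opn b"
    using assms c by (intro add_mono le_opn)
  finally show "nm (times A (add A a b) c) \<le> opn a + opn b" .
qed

text \<open>The squared length of b c is <c, b* b c>, and Cauchy-Schwarz bounds this by the length
  of b* b c when c lies in the unit ball.\<close>

lemma opn_sq_le:
  assumes b: "b \<in> elems A"
  shows "(opn b)\<^sup>2 \<le> opn (times A (star A b) b)"
proof -
  have "opn b \<le> sqrt (opn (times A (star A b) b))"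
  proof (rule opn_le, rule real_le_rsqrt)
    fix c assume c: "c \<in> elems A" "nm c \<le> 1"
    have "(nm (times A b c))\<^sup>2 \<le> cmod (ip c (times A (times A (star A b) b) c))"
      using b c by (simp add: nm_sq closed sqn_times_eq complex_Re_le_cmod)
    also have "\<dots> \<le> nm c * nm (times A (times A (star A b) b) c)"
      using b c by (intro cauchy_schwarz_nm) (simp_all add: closed)
    also have "\<dots> \<le> 1 * opn (times A (star A b) b)"
      using b c by (intro mult_mono le_opn) (simp_all add: closed nm_nonneg)
    finally show "(nm (times A b c))\<^sup>2 \<le> opn (times A (star A b) b)" by simp
  qed
  then have "(opn b)\<^sup>2 \<le> (sqrt (opn (times A (star A b) b)))\<^sup>2"
    by (rule power_mono) (simp add: opn_nonneg b)
  then show ?thesis using b by (simp add: opn_nonneg closed)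
qed

text \<open>By \<open>opn_sq_le\<close> and submultiplicativity, the square of \<open>opn b\<close>
  is at most \<open>opn (star A b)\<close> times \<open>opn b\<close>. Cancelling gives one
  inequality, and exchanging b with b* the other.\<close>

lemma opn_star:
  assumes b: "b \<in> elems A"
  shows "opn (star A b) = opn b"
proof -
  have le: "opn b \<le> opn (star A b)" if b: "b \<in> elems A" for b
  proof (cases "opn b = 0")
    case True
    then show ?thesis using opn_nonneg[of "star A b"] b by (simp add: closed)
  next
    case False
    have "(opn b)\<^sup>2 \<le> opn (star A b) * opn b"
      using opn_sq_le[OF b] opn_times[of "star A b" b] b by (simp add: closed)
    then show ?thesis using False opn_nonneg[OF b] by (simp add: power2_eq_square)
  qed
  show ?thesis using le[OF b] le[of "star A b"] b by (simp add: closed star_star)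
qed

lemma cstar_seminorm_opn: "cstar_seminorm A opn"
  unfolding cstar_seminorm_def
proof (intro conjI ballI allI)
  fix a assume a: "a \<in> elems A"
  show "opn (times A (star A a) a) = (opn a)\<^sup>2"
    using opn_sq_le[OF a] opn_times[of "star A a" a] a
    by (simp add: closed opn_star power2_eq_square)
qed (simp_all add: opn_nonneg opn_add opn_scale opn_times opn_star exI[of _ 1] opn_le_nrm)

text \<open>The value \<phi> a is the matrix coefficient <1, a 1>, and the unit has length
  1.\<close>

lemma cmod_le_opn:
  assumes "a \<in> elems A"
  shows "cmod (\<phi> a) \<le> opn a"
proof -
  have "cmod (\<phi> a) = cmod (ip (unit A) a)"
    using assms by (simp add: ip_def star_unit unit_left)
  also have "\<dots> \<le> nm (times A a (unit A))"
    using cauchy_schwarz_nm[of "unit A" a] assms by (simp add: nm_unit unit_right closed)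
  also have "\<dots> \<le> opn a"
    using assms by (intro le_opn) (simp_all add: closed nm_unit)
  finally show ?thesis .
qed

text \<open>The norm enters a state only through continuity, and \<open>opn\<close> is one of the
  seminorms in the supremum that defines the enveloping norm.\<close>

lemma is_state_with_cstar_norm: "is_state (with_cstar_norm A) \<phi>"
proof -
  have "cmod (\<phi> a) \<le> 1 * nrm (with_cstar_norm A) a" if "a \<in> elems A" for a
    using cmod_le_opn[OF that] le_cstar_norm[OF cstar_seminorm_opn that] by linarith
  then have "\<exists>C. \<forall>a \<in> elems A. cmod (\<phi> a) \<le> C * nrm (with_cstar_norm A) a" by blast
  then show ?thesis
    using state by (simp add: is_state_def continuous_functional_def del: with_cstar_norm_simps(7))
qed

end

text \<open>By the Lipschitz bound, values along a Cauchy sequence converge; linearity, positivity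
  and the bound are closed conditions. It serves for both completions in the Weyl algebra.\<close>

lemma (in seminormed_star_alg) state_completion:
  assumes state: "is_state A \<phi>"
  shows "\<exists>\<psi>. is_state (completion A) \<psi> \<and> (\<forall>a \<in> elems A. \<psi> (completion_embed A a) = \<phi> a)"
proof -
  have lin: "\<lbrakk>a \<in> elems A; b \<in> elems A\<rbrakk> \<Longrightarrow> \<phi> (add A a b) = \<phi> a + \<phi> b"
    "a \<in> elems A \<Longrightarrow> \<phi> (scale A c a) = c * \<phi> a" "\<phi> (unit A) = 1"
    "a \<in> elems A \<Longrightarrow> \<phi> (times A (star A a) a) \<in> \<real>\<^sub>\<ge>\<^sub>0" for a b c
    using state by (simp_all add: is_state_def continuous_functional_def)
  obtain C where C: "\<And>a. a \<in> elems A \<Longrightarrow> cmod (\<phi> a) \<le> C * nrm A a"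
    using state unfolding is_state_def continuous_functional_def by blast
  have lip: "cmod (\<phi> a - \<phi> b) \<le> \<bar>C\<bar> * alg_dist A a b" if "a \<in> elems A" "b \<in> elems A" for a b
  proof -
    have "\<phi> a - \<phi> b = \<phi> (add A a (scale A (- 1) b))"
      using that by (simp add: lin closed)
    then have "cmod (\<phi> a - \<phi> b) \<le> C * alg_dist A a b"
      unfolding alg_dist_def using C[of "add A a (scale A (- 1) b)"] that by (simp add: closed)
    also have "\<dots> \<le> \<bar>C\<bar> * alg_dist A a b"
      using that by (intro mult_right_mono) (simp_all add: alg_dist_nonneg)
    finally show ?thesis .
  qed
  have conv: "convergent (\<lambda>n. \<phi> (s n))" if s: "s \<in> cauchy_seqs A" for s
  proof (rule Cauchy_convergent, rule metric_CauchyI)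
    fix e :: real assume "e > 0"
    then have "e / (\<bar>C\<bar> + 1) > 0" by simp
    then obtain N where N: "\<forall>i\<ge>N. \<forall>j\<ge>N. alg_dist A (s i) (s j) < e / (\<bar>C\<bar> + 1)"
      using s unfolding cauchy_seqs_def by blast
    have "dist (\<phi> (s i)) (\<phi> (s j)) < e" if "i \<ge> N" "j \<ge> N" for i j
    proof -
      have "dist (\<phi> (s i)) (\<phi> (s j)) \<le> \<bar>C\<bar> * alg_dist A (s i) (s j)"
        unfolding dist_norm by (rule lip; rule cauchy_seqsD[OF s])
      also have "\<dots> \<le> (\<bar>C\<bar> + 1) * alg_dist A (s i) (s j)"
        by (intro mult_right_mono) (simp_all add: alg_dist_nonneg cauchy_seqsD[OF s])
      also have "\<dots> < (\<bar>C\<bar> + 1) * (e / (\<bar>C\<bar> + 1))"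
        using N that by (intro mult_strict_left_mono) auto
      finally show ?thesis by simp
    qed
    then show "\<exists>N. \<forall>i\<ge>N. \<forall>j\<ge>N. dist (\<phi> (s i)) (\<phi> (s j)) < e" by blast
  qed
  \<comment> \<open>The representative is arbitrary; \<open>tend\<close> shows that the values along
    every other representative have the same limit.\<close>
  define \<psi> where "\<psi> P = lim (\<lambda>n. \<phi> ((SOME s. s \<in> P) n))" for P :: "(nat \<Rightarrow> 'x) set"
  have tend: "(\<lambda>n. \<phi> (s n)) \<longlonglongrightarrow> \<psi> (limit_class A s)" if s: "s \<in> cauchy_seqs A" for s
  proof -
    define p where "p = (SOME t. t \<in> limit_class A s)"
    have p: "p \<in> limit_class A s"
      unfolding p_def by (rule someI[of _ s]) (rule limit_class_self[OF s])
    note p' = limit_class_memD[OF s p]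
    have "(\<lambda>n. \<phi> (p n) - \<phi> (s n)) \<longlonglongrightarrow> 0"
    proof (rule Lim_null_comparison)
      show "\<forall>\<^sub>F n in sequentially. norm (\<phi> (p n) - \<phi> (s n)) \<le> \<bar>C\<bar> * alg_dist A (p n) (s n)"
        using p' s by (simp add: lip cauchy_seqsD)
      show "(\<lambda>n. \<bar>C\<bar> * alg_dist A (p n) (s n)) \<longlonglongrightarrow> 0"
        using tendsto_mult_left[OF p'(3), of "\<bar>C\<bar>"] by simp
    qed
    moreover have "(\<lambda>n. \<phi> (p n)) \<longlonglongrightarrow> \<psi> (limit_class A s)"
      using conv[OF p'(1)] by (simp add: \<psi>_def p_def convergent_LIMSEQ_iff)
    ultimately show ?thesis
      using tendsto_diff[of "\<lambda>n. \<phi> (p n)" "\<psi> (limit_class A s)" sequentially "\<lambda>n. \<phi> (p n) - \<phi> (s n)" 0] by simp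
  qed
  have "is_state (completion A) \<psi>"
    unfolding is_state_def continuous_functional_def
  proof (intro conjI ballI allI)
    fix P Q assume "P \<in> elems (completion A)" "Q \<in> elems (completion A)"
    then obtain s t where st: "s \<in> cauchy_seqs A" "t \<in> cauchy_seqs A"
      and PQ: "P = limit_class A s" "Q = limit_class A t" unfolding completion_elems by blast
    have "(\<lambda>n. \<phi> (add A (s n) (t n))) \<longlonglongrightarrow> \<psi> P + \<psi> Q"
      using tendsto_add[OF tend[OF st(1)] tend[OF st(2)]] st by (simp add: lin cauchy_seqsD PQ)
    then show "\<psi> (add (completion A) P Q) = \<psi> P + \<psi> Q"
      using LIMSEQ_unique[OF tend[OF cauchy_add[OF st]]] by (simp add: PQ completion_add st)
  next
    fix P c assume "P \<in> elems (completion A)"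
    then obtain s where s: "s \<in> cauchy_seqs A" and P: "P = limit_class A s"
      unfolding completion_elems by blast
    have "(\<lambda>n. \<phi> (scale A c (s n))) \<longlonglongrightarrow> c * \<psi> P"
      using tendsto_mult_left[OF tend[OF s], of c] s by (simp add: lin cauchy_seqsD P)
    then show "\<psi> (scale (completion A) c P) = c * \<psi> P"
      using LIMSEQ_unique[OF tend[OF cauchy_scale[OF s]]] by (simp add: P completion_scale s)
  next
    fix P assume "P \<in> elems (completion A)"
    then obtain s where s: "s \<in> cauchy_seqs A" and P: "P = limit_class A s"
      unfolding completion_elems by blast
    have "\<psi> (limit_class A (\<lambda>n. times A (star A (s n)) (s n))) \<in> \<real>\<^sub>\<ge>\<^sub>0"
    proof (rule Lim_in_closed_set[OF closed_nonneg_Reals_complex])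
      show "(\<lambda>n. \<phi> (times A (star A (s n)) (s n))) \<longlonglongrightarrow> \<psi> (limit_class A (\<lambda>n. times A (star A (s n)) (s n)))"
        by (intro tend cauchy_times cauchy_star s)
      show "\<forall>\<^sub>F n in sequentially. \<phi> (times A (star A (s n)) (s n)) \<in> \<real>\<^sub>\<ge>\<^sub>0"
        using lin(4)[OF cauchy_seqsD[OF s]] by simp
    qed simp
    then show "\<psi> (times (completion A) (star (completion A) P) P) \<in> \<real>\<^sub>\<ge>\<^sub>0"
      by (simp add: P completion_star completion_times cauchy_star s)
  next
    show "\<psi> (unit (completion A)) = 1"
      using LIMSEQ_unique[OF tend[OF cauchy_const[OF unit_closed]] tendsto_const] lin(3)
      by (simp add: completion_unit unit_closed)
  next
    have "cmod (\<psi> P) \<le> C * nrm (completion A) P" if "P \<in> elems (completion A)" for P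
    proof -
      obtain s where s: "s \<in> cauchy_seqs A" and P: "P = limit_class A s"
        using \<open>P \<in> _\<close> unfolding completion_elems by blast
      show ?thesis unfolding P
        by (rule LIMSEQ_le[OF tendsto_norm[OF tend[OF s]] tendsto_mult_left[OF nrm_completion_tendsto[OF s]]])
          (auto intro: C cauchy_seqsD[OF s])
    qed
    then show "\<exists>C. \<forall>P \<in> elems (completion A). cmod (\<psi> P) \<le> C * nrm (completion A) P" by blast
  qed
  moreover have "\<psi> (completion_embed A a) = \<phi> a" if "a \<in> elems A" for a
    using LIMSEQ_unique[OF tend[OF cauchy_const[OF that]] tendsto_const] by (simp add: completion_embed_def)
  ultimately show ?thesis by blast
qed

subsection \<open>Isomorphisms\<close>

lemma cstar_isoD:
  assumes "cstar_iso A B \<Phi>"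
  shows "bij_betw \<Phi> (elems A) (elems B)"
    "a \<in> elems A \<Longrightarrow> b \<in> elems A \<Longrightarrow> \<Phi> (add A a b) = add B (\<Phi> a) (\<Phi> b)"
    "a \<in> elems A \<Longrightarrow> \<Phi> (scale A c a) = scale B c (\<Phi> a)"
    "a \<in> elems A \<Longrightarrow> b \<in> elems A \<Longrightarrow> \<Phi> (times A a b) = times B (\<Phi> a) (\<Phi> b)"
    "\<Phi> (unit A) = unit B"
    "a \<in> elems A \<Longrightarrow> \<Phi> (star A a) = star B (\<Phi> a)"
    "a \<in> elems A \<Longrightarrow> nrm B (\<Phi> a) = nrm A a"
    "a \<in> elems A \<Longrightarrow> \<Phi> a \<in> elems B"
  using assms by (auto simp: cstar_iso_def bij_betw_def)

lemma cstar_iso_inv: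
  assumes A: "seminormed_star_alg A" and iso: "cstar_iso A B \<Phi>"
  shows "cstar_iso B A (inv_into (elems A) \<Phi>)"
proof -
  interpret seminormed_star_alg A by (rule A)
  let ?g = "inv_into (elems A) \<Phi>"
  note bij = cstar_isoD(1)[OF iso]
  have g: "?g b \<in> elems A" "\<Phi> (?g b) = b" if "b \<in> elems B" for b
    using bij_betw_apply[OF bij_betw_inv_into[OF bij] that] bij_betw_inv_into_right[OF bij that] by auto
  have eqI: "?g b = a" if "a \<in> elems A" "\<Phi> a = b" for a b
    using bij_betw_inv_into_left[OF bij that(1)] that(2) by simp
  have iso': "\<Phi> (add A (?g x) (?g y)) = add B x y" "\<Phi> (times A (?g x) (?g y)) = times B x y"
    "\<Phi> (scale A c (?g x)) = scale B c x" "\<Phi> (star A (?g x)) = star B x" "nrm A (?g x) = nrm B x"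
    if "x \<in> elems B" "y \<in> elems B" for x y c
    using cstar_isoD(2,4)[OF iso g(1)[OF that(1)] g(1)[OF that(2)]] cstar_isoD(3,6,7)[OF iso g(1)[OF that(1)]]
    by (simp_all add: g that)
  show ?thesis
    unfolding cstar_iso_def
  proof (intro conjI ballI allI)
    show "bij_betw ?g (elems B) (elems A)" by (rule bij_betw_inv_into[OF bij])
    show "?g (unit B) = unit A" by (rule eqI) (simp_all add: closed cstar_isoD(5)[OF iso])
  next
    fix x y assume xy: "x \<in> elems B" "y \<in> elems B"
    show "?g (add B x y) = add A (?g x) (?g y)" "?g (times B x y) = times A (?g x) (?g y)"
      by (rule eqI; simp add: closed g iso' xy)+
  next
    fix x c assume x: "x \<in> elems B"
    show "?g (scale B c x) = scale A c (?g x)" "?g (star B x) = star A (?g x)"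
      by (rule eqI; simp add: closed g iso'[OF x x] x)+
    show "nrm A (?g x) = nrm B x" by (rule iso'[OF x x])
  qed
qed

lemma alg_dist_cstar_iso:
  assumes A: "seminormed_star_alg A" and iso: "cstar_iso A B \<Phi>" and "a \<in> elems A" "b \<in> elems A"
  shows "alg_dist B (\<Phi> a) (\<Phi> b) = alg_dist A a b"
proof -
  interpret seminormed_star_alg A by (rule A)
  show ?thesis
    using cstar_isoD(7)[OF iso, of "add A a (scale A (- 1) b)"] assms(3,4)
    by (simp add: alg_dist_def cstar_isoD(2,3)[OF iso] closed)
qed

text \<open>An isometric bijection applied termwise carries a whole class of Cauchy sequences onto a
  whole class, so the lifted map is the plain image of the class.\<close>

lemma cstar_iso_completion:
  assumes A: "seminormed_star_alg A" and B: "seminormed_star_alg B" and iso: "cstar_iso A B \<Phi>"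
  shows "\<exists>\<Psi>. cstar_iso (completion A) (completion B) \<Psi> \<and>
    (\<forall>a \<in> elems A. \<Psi> (completion_embed A a) = completion_embed B (\<Phi> a))"
proof -
  interpret A: seminormed_star_alg A by (rule A)
  interpret B: seminormed_star_alg B by (rule B)
  note bij = cstar_isoD(1)[OF iso]
  note dist = alg_dist_cstar_iso[OF A iso]
  let ?g = "inv_into (elems A) \<Phi>"
  have g: "?g b \<in> elems A" "\<Phi> (?g b) = b" if "b \<in> elems B" for b
    using bij_betw_apply[OF bij_betw_inv_into[OF bij] that] bij_betw_inv_into_right[OF bij that] by auto
  have push: "(\<lambda>n. \<Phi> (s n)) \<in> cauchy_seqs B" if "s \<in> cauchy_seqs A" for s
    using that by (simp add: cauchy_seqs_def dist cstar_isoD(8)[OF iso])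
  have pull: "(\<lambda>n. ?g (t n)) \<in> cauchy_seqs A" if "t \<in> cauchy_seqs B" for t
    using that alg_dist_cstar_iso[OF B cstar_iso_inv[OF A iso]] by (simp add: cauchy_seqs_def g)
  have pull_push: "t = (\<lambda>n. \<Phi> (?g (t n)))" if "t \<in> cauchy_seqs B" for t
    using that by (simp add: g B.cauchy_seqsD)
  define \<Psi> where "\<Psi> P = (\<lambda>s n. \<Phi> (s n)) ` P" for P :: "(nat \<Rightarrow> _) set"
  have \<Psi>: "\<Psi> (limit_class A s) = limit_class B (\<lambda>n. \<Phi> (s n))" if s: "s \<in> cauchy_seqs A" for s
  proof (intro equalityI subsetI)
    fix t assume "t \<in> \<Psi> (limit_class A s)"
    then show "t \<in> limit_class B (\<lambda>n. \<Phi> (s n))"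
      using s by (auto simp: \<Psi>_def limit_class_def push dist A.cauchy_seqsD)
  next
    fix t assume t: "t \<in> limit_class B (\<lambda>n. \<Phi> (s n))"
    then have tc: "t \<in> cauchy_seqs B" by (simp add: limit_class_def)
    have "alg_dist A (s n) (?g (t n)) = alg_dist B (\<Phi> (s n)) (t n)" for n
      using dist[of "s n" "?g (t n)"] g[of "t n"] A.cauchy_seqsD[OF s] B.cauchy_seqsD[OF tc] by simp
    then have "(\<lambda>n. ?g (t n)) \<in> limit_class A s"
      using t pull[OF tc] by (simp add: limit_class_def)
    then show "t \<in> \<Psi> (limit_class A s)"
      unfolding \<Psi>_def by (rule image_eqI[where f = "\<lambda>s n. \<Phi> (s n)", OF pull_push[OF tc]])
  qed
  have "cstar_iso (completion A) (completion B) \<Psi>"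
    unfolding cstar_iso_def
  proof (intro conjI ballI allI)
    show "bij_betw \<Psi> (elems (completion A)) (elems (completion B))"
      unfolding bij_betw_def
    proof
      show "inj_on \<Psi> (elems (completion A))"
      proof (rule inj_onI)
        fix P Q assume "P \<in> elems (completion A)" "Q \<in> elems (completion A)" and eq: "\<Psi> P = \<Psi> Q"
        then obtain s t where st: "s \<in> cauchy_seqs A" "t \<in> cauchy_seqs A"
          and PQ: "P = limit_class A s" "Q = limit_class A t" unfolding A.completion_elems by blast
        show "P = Q"
          using eq st by (simp add: PQ \<Psi> push A.limit_class_eq_iff B.limit_class_eq_iff dist A.cauchy_seqsD)
      qed
      show "\<Psi> ` elems (completion A) = elems (completion B)"
        unfolding A.completion_elems B.completion_elems
      proof (intro equalityI subsetI)
        fix R assume "R \<in> limit_class B ` cauchy_seqs B"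
        then obtain t where t: "t \<in> cauchy_seqs B" "R = limit_class B t" by blast
        then have "R = \<Psi> (limit_class A (\<lambda>n. ?g (t n)))"
          using \<Psi>[OF pull[OF t(1)]] pull_push[OF t(1)] by simp
        then show "R \<in> \<Psi> ` (limit_class A ` cauchy_seqs A)"
          using pull[OF t(1)] by blast
      qed (auto simp: \<Psi> push)
    qed
  next
    fix P Q assume "P \<in> elems (completion A)" "Q \<in> elems (completion A)"
    then obtain s t where st: "s \<in> cauchy_seqs A" "t \<in> cauchy_seqs A"
      and PQ: "P = limit_class A s" "Q = limit_class A t" unfolding A.completion_elems by blast
    note mem = A.cauchy_seqsD[OF st(1)] A.cauchy_seqsD[OF st(2)]
    show "\<Psi> (add (completion A) P Q) = add (completion B) (\<Psi> P) (\<Psi> Q)"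
      using st by (simp add: PQ A.completion_add A.cauchy_add B.completion_add \<Psi> push cstar_isoD(2)[OF iso] mem)
    show "\<Psi> (times (completion A) P Q) = times (completion B) (\<Psi> P) (\<Psi> Q)"
      using st by (simp add: PQ A.completion_times A.cauchy_times B.completion_times \<Psi> push cstar_isoD(4)[OF iso] mem)
  next
    fix P assume "P \<in> elems (completion A)"
    then obtain s where s: "s \<in> cauchy_seqs A" and P: "P = limit_class A s"
      unfolding A.completion_elems by blast
    note mem = A.cauchy_seqsD[OF s]
    show "\<Psi> (scale (completion A) c P) = scale (completion B) c (\<Psi> P)" for c
      using s by (simp add: P A.completion_scale A.cauchy_scale B.completion_scale \<Psi> push cstar_isoD(3)[OF iso] mem)
    show "\<Psi> (star (completion A) P) = star (completion B) (\<Psi> P)"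
      using s by (simp add: P A.completion_star A.cauchy_star B.completion_star \<Psi> push cstar_isoD(6)[OF iso] mem)
    show "nrm (completion B) (\<Psi> P) = nrm (completion A) P"
      using LIMSEQ_unique[OF B.nrm_completion_tendsto[OF push[OF s]]] A.nrm_completion_tendsto[OF s]
      by (simp add: P \<Psi> s cstar_isoD(7)[OF iso] mem)
  next
    show "\<Psi> (unit (completion A)) = unit (completion B)"
      by (simp add: A.completion_unit B.completion_unit \<Psi> A.cauchy_const A.closed cstar_isoD(5)[OF iso])
  qed
  moreover have "\<Psi> (completion_embed A a) = completion_embed B (\<Phi> a)" if "a \<in> elems A" for a
    by (simp add: completion_embed_def \<Psi> A.cauchy_const that)
  ultimately show ?thesis by blast
qed

lemma cstar_seminorm_cstar_iso:
  assumes A: "seminormed_star_alg A" and iso: "cstar_iso A B \<Phi>" and q: "cstar_seminorm B q"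
  shows "cstar_seminorm A (q \<circ> \<Phi>)"
proof -
  interpret seminormed_star_alg A by (rule A)
  obtain C where "\<And>b. b \<in> elems B \<Longrightarrow> q b \<le> C * nrm B b"
    using q unfolding cstar_seminorm_def by blast
  then have "\<forall>a \<in> elems A. q (\<Phi> a) \<le> C * nrm A a"
    by (metis cstar_isoD(7,8)[OF iso])
  then have "\<exists>C. \<forall>a \<in> elems A. q (\<Phi> a) \<le> C * nrm A a" by blast
  then show ?thesis
    using q unfolding cstar_seminorm_def by (simp add: cstar_isoD[OF iso] closed)
qed

text \<open>C*-seminorms pull back along \<Phi> and along its inverse, so the two suprema run over
  the same values.\<close>

lemma cstar_iso_with_cstar_norm:
  assumes A: "seminormed_star_alg A" and B: "seminormed_star_alg B" and iso: "cstar_iso A B \<Phi>"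
  shows "cstar_iso (with_cstar_norm A) (with_cstar_norm B) \<Phi>"
proof -
  interpret A: seminormed_star_alg A by (rule A)
  interpret B: seminormed_star_alg B by (rule B)
  let ?g = "inv_into (elems A) \<Phi>"
  have "nrm (with_cstar_norm B) (\<Phi> a) = nrm (with_cstar_norm A) a" if a: "a \<in> elems A" for a
  proof (rule antisym)
    show "nrm (with_cstar_norm B) (\<Phi> a) \<le> nrm (with_cstar_norm A) a"
      using A.le_cstar_norm[OF cstar_seminorm_cstar_iso[OF A iso] a]
      by (intro B.cstar_norm_le) (simp add: comp_def)
    have "p a \<le> nrm (with_cstar_norm B) (\<Phi> a)" if "cstar_seminorm A p" for p
      using B.le_cstar_norm[OF cstar_seminorm_cstar_iso[OF B cstar_iso_inv[OF A iso] that] cstar_isoD(8)[OF iso a]]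
        bij_betw_inv_into_left[OF cstar_isoD(1)[OF iso] a] by (simp add: comp_def)
    then show "nrm (with_cstar_norm A) a \<le> nrm (with_cstar_norm B) (\<Phi> a)"
      by (rule A.cstar_norm_le)
  qed
  then show ?thesis
    using iso unfolding cstar_iso_def by (simp del: with_cstar_norm_simps(7))
qed

subsection \<open>Bounded linear maps\<close>

text \<open>A notion wide enough for functionals and for isomorphisms, so that one density argument
  yields the uniqueness of both.\<close>

definition bdd_linear :: "'x star_alg \<Rightarrow> 'y star_alg \<Rightarrow> ('x \<Rightarrow> 'y) \<Rightarrow> bool" where
  "bdd_linear A B f \<longleftrightarrow> f \<in> elems A \<rightarrow> elems B \<and>
     (\<forall>a \<in> elems A. \<forall>b \<in> elems A. f (add A a b) = add B (f a) (f b)) \<and>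
     (\<forall>c. \<forall>a \<in> elems A. f (scale A c a) = scale B c (f a)) \<and>
     (\<exists>C. \<forall>a \<in> elems A. nrm B (f a) \<le> C * nrm A a)"

definition separated :: "'x star_alg \<Rightarrow> bool" where
  "separated A \<longleftrightarrow> (\<forall>a \<in> elems A. \<forall>b \<in> elems A. alg_dist A a b = 0 \<longrightarrow> a = b)"

text \<open>With this target, continuous functionals become bounded linear maps.\<close>

definition complex_alg :: "complex star_alg" where
  "complex_alg = \<lparr>elems = UNIV, add = (+), scale = (*), times = (*), unit = 1, star = cnj, nrm = cmod\<rparr>"

lemma seminormed_star_alg_complex_alg: "seminormed_star_alg complex_alg"
  by unfold_locales (auto simp: complex_alg_def algebra_simps norm_triangle_ineq norm_mult)

lemma separated_complex_alg: "separated complex_alg"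
  by (simp add: separated_def complex_alg_def alg_dist_def)

lemma separated_completion: "seminormed_star_alg A \<Longrightarrow> separated (completion A)"
  unfolding separated_def using seminormed_star_alg.completion_alg_dist_0 by blast

lemma bdd_linear_complex_alg: "bdd_linear A complex_alg \<phi> \<longleftrightarrow> continuous_functional A \<phi>"
  by (simp add: bdd_linear_def complex_alg_def continuous_functional_def)

lemma bdd_linear_cstar_iso: "cstar_iso A B \<Phi> \<Longrightarrow> bdd_linear A B \<Phi>"
  unfolding bdd_linear_def cstar_iso_def
  by (auto simp: bij_betw_def intro: exI[of _ 1])

lemma bdd_linear_embed:
  assumes "seminormed_star_alg A" "bdd_linear (completion A) B f"
  shows "bdd_linear A B (f \<circ> completion_embed A)"
proof -
  interpret seminormed_star_alg A by (rule assms)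
  obtain C where C: "\<And>P. P \<in> elems (completion A) \<Longrightarrow> nrm B (f P) \<le> C * nrm (completion A) P"
    using assms(2) unfolding bdd_linear_def by blast
  have "\<forall>a \<in> elems A. nrm B (f (completion_embed A a)) \<le> C * nrm A a"
    using C[OF embed_closed] by (simp add: nrm_embed)
  then have "\<exists>C. \<forall>a \<in> elems A. nrm B (f (completion_embed A a)) \<le> C * nrm A a" by blast
  then show ?thesis
    using assms(2) embed_closed unfolding bdd_linear_def
    by (auto simp: embed_add embed_scale simp del: completion_elems)
qed

text \<open>The enveloping seminorm is dominated by the given norm, so continuity with respect to it
  is the stronger property.\<close>

lemma bdd_linear_with_cstar_norm:
  assumes "seminormed_star_alg A" "bdd_linear (with_cstar_norm A) B f"
  shows "bdd_linear A B f"
proof -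
  interpret seminormed_star_alg A by (rule assms)
  obtain C where C: "\<And>a. a \<in> elems A \<Longrightarrow> nrm B (f a) \<le> C * nrm (with_cstar_norm A) a"
    using assms(2) unfolding bdd_linear_def with_cstar_norm_simps(1) by blast
  have "nrm B (f a) \<le> \<bar>C\<bar> * nrm A a" if a: "a \<in> elems A" for a
  proof -
    have "nrm B (f a) \<le> \<bar>C\<bar> * nrm (with_cstar_norm A) a"
      using C[OF a] mult_right_mono[OF abs_ge_self cstar_norm_nonneg[OF a], of C] by linarith
    also have "\<dots> \<le> \<bar>C\<bar> * nrm A a"
      by (intro mult_left_mono cstar_norm_le_nrm a) simp
    finally show ?thesis .
  qed
  then have "\<exists>C. \<forall>a \<in> elems A. nrm B (f a) \<le> C * nrm A a" by blast
  then show ?thesis using assms(2) by (simp add: bdd_linear_def)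
qed

lemma bdd_linear_lipschitz:
  assumes "seminormed_star_alg A" "bdd_linear A B f"
  obtains C where "C \<ge> 0"
    "\<And>a b. \<lbrakk>a \<in> elems A; b \<in> elems A\<rbrakk> \<Longrightarrow> alg_dist B (f a) (f b) \<le> C * alg_dist A a b"
proof -
  interpret seminormed_star_alg A by (rule assms)
  obtain C where C: "\<And>a. a \<in> elems A \<Longrightarrow> nrm B (f a) \<le> C * nrm A a"
    using assms(2) unfolding bdd_linear_def by blast
  show thesis
  proof (rule that[of "\<bar>C\<bar>"])
    fix a b assume ab: "a \<in> elems A" "b \<in> elems A"
    then have "alg_dist B (f a) (f b) = nrm B (f (add A a (scale A (- 1) b)))"
      using assms(2) by (simp add: bdd_linear_def alg_dist_def closed)
    also have "\<dots> \<le> C * alg_dist A a b"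
      using C[of "add A a (scale A (- 1) b)"] ab by (simp add: alg_dist_def closed)
    also have "\<dots> \<le> \<bar>C\<bar> * alg_dist A a b"
      using ab by (intro mult_right_mono) (simp_all add: alg_dist_nonneg)
    finally show "alg_dist B (f a) (f b) \<le> \<bar>C\<bar> * alg_dist A a b" .
  qed simp
qed

text \<open>Both maps are Lipschitz, so their distance at P is below every epsilon; separatedness of
  the target turns distance 0 into equality.\<close>

lemma bdd_linear_eq_completion:
  assumes A: "seminormed_star_alg A" and B: "seminormed_star_alg B" and sep: "separated B"
    and f: "bdd_linear (completion A) B f" and g: "bdd_linear (completion A) B g"
    and eq: "\<And>a. a \<in> elems A \<Longrightarrow> f (completion_embed A a) = g (completion_embed A a)"
    and P: "P \<in> elems (completion A)"
  shows "f P = g P"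
proof -
  interpret A: seminormed_star_alg A by (rule A)
  interpret B: seminormed_star_alg B by (rule B)
  interpret C: seminormed_star_alg "completion A" by (rule A.seminormed_star_alg_completion)
  obtain C where C: "C \<ge> 0" "\<And>a b. \<lbrakk>a \<in> elems (completion A); b \<in> elems (completion A)\<rbrakk>
      \<Longrightarrow> alg_dist B (f a) (f b) \<le> C * alg_dist (completion A) a b"
    using bdd_linear_lipschitz[OF C.seminormed_star_alg_axioms f] by blast
  obtain D where D: "D \<ge> 0" "\<And>a b. \<lbrakk>a \<in> elems (completion A); b \<in> elems (completion A)\<rbrakk>
      \<Longrightarrow> alg_dist B (g a) (g b) \<le> D * alg_dist (completion A) a b"
    using bdd_linear_lipschitz[OF C.seminormed_star_alg_axioms g] by blast
  have fg: "f P \<in> elems B" "g P \<in> elems B" if "P \<in> elems (completion A)" for P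
    using f g that unfolding bdd_linear_def by blast+
  have "alg_dist B (f P) (g P) \<le> 0"
  proof (rule field_le_epsilon)
    fix e :: real assume "e > 0"
    \<comment> \<open>The summand 1 keeps the denominator positive when both Lipschitz constants are
      0.\<close>
    then have "e / (C + D + 1) > 0" using C(1) D(1) by simp
    then obtain a where a: "a \<in> elems A" "alg_dist (completion A) P (completion_embed A a) < e / (C + D + 1)"
      by (rule A.embed_dense[OF P])
    let ?E = "completion_embed A a"
    have E: "?E \<in> elems (completion A)" by (rule A.embed_closed[OF a(1)])
    have "alg_dist B (f P) (g P) \<le> alg_dist B (f P) (f ?E) + alg_dist B (g ?E) (g P)"
      using B.alg_dist_triangle[of "f P" "f ?E" "g P"] fg P E eq[OF a(1)] by simp
    also have "\<dots> \<le> C * alg_dist (completion A) P ?E + D * alg_dist (completion A) ?E P"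
      using C(2)[OF P E] D(2)[OF E P] by simp
    also have "\<dots> = (C + D) * alg_dist (completion A) P ?E"
      using C.alg_dist_commute[OF P E] by (simp add: distrib_right)
    also have "\<dots> \<le> (C + D + 1) * alg_dist (completion A) P ?E"
      using C.alg_dist_nonneg[OF P E] by (intro mult_right_mono) auto
    also have "\<dots> \<le> (C + D + 1) * (e / (C + D + 1))"
      using a(2) C(1) D(1) by (intro mult_left_mono) auto
    also have "\<dots> = e" using C(1) D(1) by simp
    finally show "alg_dist B (f P) (g P) \<le> 0 + e" by simp
  qed
  then have "alg_dist B (f P) (g P) = 0"
    using B.alg_dist_nonneg[OF fg[OF P]] by simp
  then show ?thesis
    using sep fg[OF P] unfolding separated_def by blast
qed

section \<open>Weyl algebras\<close>

lemma circle_exp_add: "circle_exp (s + t) = circle_exp s * circle_exp t"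
  by transfer (simp add: cis_mult distrib_left)

lemma circle_exp_zero [simp]: "circle_exp 0 = 1"
  by transfer simp

lemma circle_exp_minus: "circle_exp (- s) = cnj (circle_exp s)"
  by transfer (simp add: cis_cnj)

lemma norm_circle_exp [simp]: "cmod (circle_exp s) = 1"
  by transfer simp

lemma weyl_poly_simps [simp]:
  "elems (weyl_poly G \<sigma>) = {a. finite {g. a g \<noteq> 0} \<and> {g. a g \<noteq> 0} \<subseteq> carrier G}"
  "add (weyl_poly G \<sigma>) a b = (\<lambda>x. a x + b x)"
  "scale (weyl_poly G \<sigma>) c a = (\<lambda>x. c * a x)"
  "unit (weyl_poly G \<sigma>) = (\<lambda>x. if x = \<one>\<^bsub>G\<^esub> then 1 else 0)"
  "star (weyl_poly G \<sigma>) a = (\<lambda>x. if x \<in> carrier G then cnj (a (inv\<^bsub>G\<^esub> x)) else 0)"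
  "nrm (weyl_poly G \<sigma>) a = (\<Sum>g | a g \<noteq> 0. cmod (a g))"
  by (simp_all add: weyl_poly_def)

text \<open>Sums over arbitrary finite sets containing the supports let products of different
  elements be compared over one index set.\<close>

lemma weyl_poly_times:
  assumes "finite U" "{g. a g \<noteq> 0} \<subseteq> U" "finite V" "{g. b g \<noteq> 0} \<subseteq> V"
  shows "times (weyl_poly G \<sigma>) a b x =
    (\<Sum>g\<in>U. \<Sum>h\<in>V. if g \<otimes>\<^bsub>G\<^esub> h = x then a g * b h * circle_exp (\<sigma> g h) else 0)"
proof -
  have "times (weyl_poly G \<sigma>) a b x =
      (\<Sum>g | a g \<noteq> 0. \<Sum>h\<in>V. if g \<otimes>\<^bsub>G\<^esub> h = x then a g * b h * circle_exp (\<sigma> g h) else 0)"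
    unfolding weyl_poly_def star_alg.simps using assms(3,4)
    by (intro sum.cong refl sum.mono_neutral_left) auto
  also have "\<dots> = (\<Sum>g\<in>U. \<Sum>h\<in>V. if g \<otimes>\<^bsub>G\<^esub> h = x then a g * b h * circle_exp (\<sigma> g h) else 0)"
  proof (rule sum.mono_neutral_left[OF assms(1,2)], rule ballI)
    fix g assume "g \<in> U - {g. a g \<noteq> 0}"
    then have "a g = 0" by simp
    then show "(\<Sum>h\<in>V. if g \<otimes>\<^bsub>G\<^esub> h = x then a g * b h * circle_exp (\<sigma> g h) else 0) = 0"
      by (simp cong: if_cong)
  qed
  finally show ?thesis .
qed

lemma nrm_weyl_poly:
  assumes "finite U" "{g. a g \<noteq> 0} \<subseteq> U"
  shows "nrm (weyl_poly G \<sigma>) a = (\<Sum>g\<in>U. cmod (a g))"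
  using assms by (auto intro: sum.mono_neutral_left)

text \<open>The form is alternating, which in \<open>circle\<close> is more than antisymmetric,
  since there 2 t = 0 does not imply t = 0. Antisymmetry follows by expanding \<sigma> at a product
  paired with itself.\<close>

locale weyl_data = comm_group G for G :: "'g monoid" (structure) +
  fixes \<sigma> :: "'g \<Rightarrow> 'g \<Rightarrow> circle"
  assumes sigma_left: "\<lbrakk>x \<in> carrier G; y \<in> carrier G; z \<in> carrier G\<rbrakk> \<Longrightarrow> \<sigma> (x \<otimes> y) z = \<sigma> x z + \<sigma> y z"
    and sigma_right: "\<lbrakk>x \<in> carrier G; y \<in> carrier G; z \<in> carrier G\<rbrakk> \<Longrightarrow> \<sigma> z (x \<otimes> y) = \<sigma> z x + \<sigma> z y"
    and sigma_self: "x \<in> carrier G \<Longrightarrow> \<sigma> x x = 0"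
begin

abbreviation P where "P \<equiv> weyl_poly G \<sigma>"

lemma sigma_commute:
  assumes "x \<in> carrier G" "y \<in> carrier G"
  shows "\<sigma> y x = - \<sigma> x y"
proof -
  have "\<sigma> x y + \<sigma> y x = 0"
    using sigma_left[of x y "x \<otimes> y"] sigma_right[of x y x] sigma_right[of x y y]
      sigma_self[of "x \<otimes> y"] sigma_self[of x] sigma_self[of y] assms by simp
  then show ?thesis by (simp add: eq_neg_iff_add_eq_0 add.commute)
qed

lemma sigma_one: "x \<in> carrier G \<Longrightarrow> \<sigma> \<one> x = 0" "x \<in> carrier G \<Longrightarrow> \<sigma> x \<one> = 0"
  using sigma_left[of \<one> \<one> x] sigma_right[of \<one> \<one> x] by simp_all

lemma sigma_inv:
  assumes "x \<in> carrier G" "y \<in> carrier G"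
  shows "\<sigma> (inv x) y = - \<sigma> x y" "\<sigma> x (inv y) = - \<sigma> x y"
  using sigma_left[of x "inv x" y] sigma_right[of y "inv y" x] assms
  by (simp_all add: sigma_one add_eq_0_iff)

lemma supp_times:
  assumes "a \<in> elems P" "b \<in> elems P"
  shows "{y. times P a b y \<noteq> 0} \<subseteq> (\<lambda>(g, h). g \<otimes> h) ` ({g. a g \<noteq> 0} \<times> {h. b h \<noteq> 0})"
    (is "_ \<subseteq> ?U")
proof -
  have fin: "finite {g. a g \<noteq> 0}" "finite {h. b h \<noteq> 0}" using assms by simp_all
  have "times P a b y = 0" if "y \<notin> ?U" for y
    unfolding weyl_poly_times[of "{g. a g \<noteq> 0}" a "{h. b h \<noteq> 0}" b G \<sigma>, OF fin(1) order_refl fin(2) order_refl]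
    using that by (intro sum.neutral ballI) (auto simp: image_iff)
  then show ?thesis by blast
qed

text \<open>The convolution product is the image measure of the twisted product measure.\<close>

lemma sum_weyl_poly_times:
  assumes a: "a \<in> elems P" and b: "b \<in> elems P"
  shows "(\<Sum>y | times P a b y \<noteq> 0. times P a b y * F y) =
    (\<Sum>g | a g \<noteq> 0. \<Sum>h | b h \<noteq> 0. a g * b h * circle_exp (\<sigma> g h) * F (g \<otimes> h))"
proof -
  let ?A = "{g. a g \<noteq> 0}" and ?B = "{h. b h \<noteq> 0}"
  let ?U = "(\<lambda>(g, h). g \<otimes> h) ` (?A \<times> ?B)"
  have fin: "finite ?A" "finite ?B" using a b by simp_all
  note t = weyl_poly_times[of ?A a ?B b G \<sigma>, OF fin(1) order_refl fin(2) order_refl]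
  have "(\<Sum>y | times P a b y \<noteq> 0. times P a b y * F y) = (\<Sum>y\<in>?U. times P a b y * F y)"
  proof (rule sum.mono_neutral_left)
    show "{y. times P a b y \<noteq> 0} \<subseteq> ?U" by (rule supp_times[OF a b])
  qed (use fin in auto)
  also have "\<dots> = (\<Sum>y\<in>?U. \<Sum>g\<in>?A. \<Sum>h\<in>?B. if y = g \<otimes> h then a g * b h * circle_exp (\<sigma> g h) * F (g \<otimes> h) else 0)"
    unfolding t sum_distrib_right by (intro sum.cong) auto
  also have "\<dots> = (\<Sum>g\<in>?A. \<Sum>y\<in>?U. \<Sum>h\<in>?B. if y = g \<otimes> h then a g * b h * circle_exp (\<sigma> g h) * F (g \<otimes> h) else 0)"
    by (rule sum.swap)
  also have "\<dots> = (\<Sum>g\<in>?A. \<Sum>h\<in>?B. \<Sum>y\<in>?U. if y = g \<otimes> h then a g * b h * circle_exp (\<sigma> g h) * F (g \<otimes> h) else 0)"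
    by (intro sum.cong refl sum.swap)
  also have "\<dots> = (\<Sum>g\<in>?A. \<Sum>h\<in>?B. a g * b h * circle_exp (\<sigma> g h) * F (g \<otimes> h))"
    using fin by (intro sum.cong refl) (subst sum.delta; force)
  finally show ?thesis .
qed

lemma times_closed:
  assumes a: "a \<in> elems P" and b: "b \<in> elems P"
  shows "times P a b \<in> elems P"
proof -
  let ?A = "{g. a g \<noteq> 0}" and ?B = "{h. b h \<noteq> 0}"
  let ?U = "(\<lambda>(g, h). g \<otimes> h) ` (?A \<times> ?B)"
  have fin: "finite ?A" "finite ?B" and sub: "?A \<subseteq> carrier G" "?B \<subseteq> carrier G"
    using a b by simp_all
  have "{y. times P a b y \<noteq> 0} \<subseteq> ?U" by (rule supp_times[OF a b])
  moreover have "finite ?U" using fin by simp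
  moreover have "?U \<subseteq> carrier G" using sub by auto
  ultimately show ?thesis using finite_subset by auto
qed

lemma supp_star: "a \<in> elems P \<Longrightarrow> {g. star P a g \<noteq> 0} = m_inv G ` {g. a g \<noteq> 0}"
  by (force simp: image_iff)

lemma sum_supp_star:
  assumes "a \<in> elems P"
  shows "(\<Sum>g | star P a g \<noteq> 0. F g) = (\<Sum>g | a g \<noteq> 0. F (inv g))"
proof -
  have "inj_on (m_inv G) {g. a g \<noteq> 0}"
    by (rule inj_on_subset[OF inv_inj]) (use assms in auto)
  then show ?thesis
    unfolding supp_star[OF assms] by (simp add: sum.reindex)
qed

text \<open>Both sides are triple sums, and biadditivity gives the cocycle identity \<sigma>(g, h) +
  \<sigma>(g h, k) = \<sigma>(h, k) + \<sigma>(g, h k) for their phases.\<close>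

lemma poly_times_assoc:
  assumes "a \<in> elems P" "b \<in> elems P" "c \<in> elems P"
  shows "times P (times P a b) c = times P a (times P b c)"
proof
  fix x
  have mem: "a g \<noteq> 0 \<Longrightarrow> g \<in> carrier G" "b g \<noteq> 0 \<Longrightarrow> g \<in> carrier G" "c g \<noteq> 0 \<Longrightarrow> g \<in> carrier G" for g
    using assms by auto
  have fin: "finite {g. times P a b g \<noteq> 0}" "finite {g. times P b c g \<noteq> 0}"
    using times_closed assms by auto
  have "times P (times P a b) c x = (\<Sum>y | times P a b y \<noteq> 0. times P a b y *
      (\<Sum>k | c k \<noteq> 0. if y \<otimes> k = x then c k * circle_exp (\<sigma> y k) else 0))"
    using assms fin by (subst weyl_poly_times[where U = "{g. times P a b g \<noteq> 0}" and V = "{g. c g \<noteq> 0}"])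
      (auto simp: sum_distrib_left intro!: sum.cong)
  also have "\<dots> = (\<Sum>g | a g \<noteq> 0. \<Sum>h | b h \<noteq> 0. \<Sum>k | c k \<noteq> 0. if g \<otimes> h \<otimes> k = x
      then a g * b h * c k * (circle_exp (\<sigma> g h) * circle_exp (\<sigma> (g \<otimes> h) k)) else 0)"
    unfolding sum_weyl_poly_times[OF assms(1,2)]
    by (auto simp: sum_distrib_left intro!: sum.cong)
  also have "\<dots> = (\<Sum>g | a g \<noteq> 0. \<Sum>h | b h \<noteq> 0. \<Sum>k | c k \<noteq> 0. if g \<otimes> (h \<otimes> k) = x
      then a g * b h * c k * (circle_exp (\<sigma> h k) * circle_exp (\<sigma> g (h \<otimes> k))) else 0)"
    by (intro sum.cong refl) (simp add: mem m_assoc circle_exp_add[symmetric] sigma_left sigma_right add_ac)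
  also have "\<dots> = (\<Sum>g | a g \<noteq> 0. a g * (\<Sum>h | b h \<noteq> 0. \<Sum>k | c k \<noteq> 0. b h * c k * circle_exp (\<sigma> h k) *
      (if g \<otimes> (h \<otimes> k) = x then circle_exp (\<sigma> g (h \<otimes> k)) else 0)))"
    by (auto simp: sum_distrib_left intro!: sum.cong)
  also have "\<dots> = (\<Sum>g | a g \<noteq> 0. a g * (\<Sum>y | times P b c y \<noteq> 0. times P b c y *
      (if g \<otimes> y = x then circle_exp (\<sigma> g y) else 0)))"
    unfolding sum_weyl_poly_times[OF assms(2,3)] ..
  also have "\<dots> = times P a (times P b c) x"
    using assms fin by (subst weyl_poly_times[where V = "{g. times P b c g \<noteq> 0}" and U = "{g. a g \<noteq> 0}"])
      (auto simp: sum_distrib_left intro!: sum.cong)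
  finally show "times P (times P a b) c x = times P a (times P b c) x" .
qed

text \<open>Testing against the conjugate signs of the product turns its l1-norm into a linear
  expression. \<open>sum_weyl_poly_times\<close> rewrites it over pairs, and phases and signs have
  modulus at most 1.\<close>

lemma poly_nrm_times:
  assumes a: "a \<in> elems P" and b: "b \<in> elems P"
  shows "nrm P (times P a b) \<le> nrm P a * nrm P b"
proof -
  define F where "F y = cnj (sgn (times P a b y))" for y
  have F: "cmod (F y) \<le> 1" for y by (simp add: F_def norm_sgn)
  have "of_real (cmod z) = z * cnj (sgn z)" for z :: complex
    using complex_norm_square[of z]
    by (cases "z = 0") (simp_all add: sgn_div_norm scaleR_conv_of_real field_simps power2_eq_square)
  then have "complex_of_real (nrm P (times P a b)) = (\<Sum>y | times P a b y \<noteq> 0. times P a b y * F y)"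
    by (simp add: F_def)
  then have "nrm P (times P a b) = cmod (\<Sum>y | times P a b y \<noteq> 0. times P a b y * F y)"
    by (metis abs_of_nonneg norm_ge_zero norm_of_real sum_nonneg weyl_poly_simps(6))
  also have "\<dots> \<le> (\<Sum>g | a g \<noteq> 0. \<Sum>h | b h \<noteq> 0. cmod (a g) * cmod (b h))"
    unfolding sum_weyl_poly_times[OF assms]
    by (intro sum_norm_le) (simp add: norm_mult mult_left_le F)
  also have "\<dots> = nrm P a * nrm P b"
    by (simp add: sum_product)
  finally show ?thesis .
qed

lemma poly_star_closed:
  assumes "a \<in> elems P"
  shows "star P a \<in> elems P"
proof -
  have "finite {g. star P a g \<noteq> 0}" "{g. star P a g \<noteq> 0} \<subseteq> carrier G"
    unfolding supp_star[OF assms] using assms by auto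
  then show ?thesis unfolding weyl_poly_simps(1) by blast
qed

text \<open>The phase of W(-h) W(-g) is \<sigma>(h, g), by antisymmetry the negative of that of W(g)
  W(h); \<open>circle_exp\<close> turns the sign into conjugation.\<close>

lemma poly_star_times:
  assumes a: "a \<in> elems P" and b: "b \<in> elems P"
  shows "star P (times P a b) = times P (star P b) (star P a)"
proof
  fix x
  have mem: "a g \<noteq> 0 \<Longrightarrow> g \<in> carrier G" "b g \<noteq> 0 \<Longrightarrow> g \<in> carrier G" for g
    using assms by auto
  have fin: "finite {g. star P a g \<noteq> 0}" "finite {g. star P b g \<noteq> 0}" "finite {g. a g \<noteq> 0}" "finite {g. b g \<noteq> 0}"
    using poly_star_closed[OF a] poly_star_closed[OF b] assms unfolding weyl_poly_simps(1) by blast+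
  have "times P (star P b) (star P a) x =
      (\<Sum>h | b h \<noteq> 0. \<Sum>g | a g \<noteq> 0. if inv h \<otimes> inv g = x
        then star P b (inv h) * star P a (inv g) * circle_exp (\<sigma> (inv h) (inv g)) else 0)"
    unfolding weyl_poly_times[OF fin(2) order_refl fin(1) order_refl] sum_supp_star[OF a] sum_supp_star[OF b] ..
  also have "\<dots> = (\<Sum>h | b h \<noteq> 0. \<Sum>g | a g \<noteq> 0. if inv (g \<otimes> h) = x
        then cnj (a g * b h * circle_exp (\<sigma> g h)) else 0)"
  proof (intro sum.cong refl)
    fix g h assume "g \<in> {g. a g \<noteq> 0}" "h \<in> {h. b h \<noteq> 0}"
    then have gh: "g \<in> carrier G" "h \<in> carrier G" using mem by simp_all
    have "circle_exp (\<sigma> (inv h) (inv g)) = cnj (circle_exp (\<sigma> g h))"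
      using sigma_commute[OF gh] gh by (simp add: sigma_inv circle_exp_minus[symmetric])
    then show "(if inv h \<otimes> inv g = x then star P b (inv h) * star P a (inv g) * circle_exp (\<sigma> (inv h) (inv g)) else 0)
        = (if inv (g \<otimes> h) = x then cnj (a g * b h * circle_exp (\<sigma> g h)) else 0)"
      using gh by (simp add: inv_mult_group)
  qed
  also have "\<dots> = (\<Sum>g | a g \<noteq> 0. \<Sum>h | b h \<noteq> 0. if inv (g \<otimes> h) = x
        then cnj (a g * b h * circle_exp (\<sigma> g h)) else 0)"
    by (rule sum.swap)
  also have "\<dots> = star P (times P a b) x"
  proof (cases "x \<in> carrier G")
    case True
    then have eq: "inv (g \<otimes> h) = x \<longleftrightarrow> g \<otimes> h = inv x" if "a g \<noteq> 0" "b h \<noteq> 0" for g h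
      using mem that by (metis inv_inv m_closed)
    have "(\<Sum>g | a g \<noteq> 0. \<Sum>h | b h \<noteq> 0. if inv (g \<otimes> h) = x then cnj (a g * b h * circle_exp (\<sigma> g h)) else 0)
        = (\<Sum>g | a g \<noteq> 0. \<Sum>h | b h \<noteq> 0. cnj (if g \<otimes> h = inv x then a g * b h * circle_exp (\<sigma> g h) else 0))"
      by (intro sum.cong refl) (simp add: eq)
    then show ?thesis
      using True by (simp add: weyl_poly_times[OF fin(3) order_refl fin(4) order_refl])
  next
    case False
    then have "inv (g \<otimes> h) \<noteq> x" if "a g \<noteq> 0" "b h \<noteq> 0" for g h
      using mem that by auto
    then have "(\<Sum>g | a g \<noteq> 0. \<Sum>h | b h \<noteq> 0. if inv (g \<otimes> h) = x then cnj (a g * b h * circle_exp (\<sigma> g h)) else 0) = 0"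
      by (intro sum.neutral ballI) simp
    then show ?thesis using False by simp
  qed
  finally show "star P (times P a b) x = times P (star P b) (star P a) x" by simp
qed

lemma poly_unit_times:
  assumes a: "a \<in> elems P"
  shows "times P (unit P) a = a" "times P a (unit P) = a"
proof -
  have fin: "finite {g. a g \<noteq> 0}" and mem: "a g \<noteq> 0 \<Longrightarrow> g \<in> carrier G" for g using a by auto
  have "times P (unit P) a x = a x" for x
  proof -
    have "times P (unit P) a x = (\<Sum>h | a h \<noteq> 0. if h = x then a x else 0)"
      by (subst weyl_poly_times[OF _ _ fin order_refl, where U = "{\<one>}"])
        (auto simp: mem sigma_one intro!: sum.cong)
    then show ?thesis using fin by simp
  qed
  moreover have "times P a (unit P) x = a x" for x
  proof -
    have "times P a (unit P) x = (\<Sum>h | a h \<noteq> 0. if h = x then a x else 0)"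
      by (subst weyl_poly_times[OF fin order_refl, where V = "{\<one>}"])
        (auto simp: mem sigma_one intro!: sum.cong)
    then show ?thesis using fin by simp
  qed
  ultimately show "times P (unit P) a = a" "times P a (unit P) = a" by blast+
qed

lemma poly_times_linear:
  assumes "a \<in> elems P" "b \<in> elems P" "c \<in> elems P"
  shows "times P (add P a b) c = add P (times P a c) (times P b c)"
    "times P c (add P a b) = add P (times P c a) (times P c b)"
    "times P (scale P k a) c = scale P k (times P a c)"
    "times P c (scale P k a) = scale P k (times P c a)"
proof -
  \<comment> \<open>One finite set contains the supports of all factors, including the sum and the
    multiple, so all products become sums over the same indices.\<close>
  let ?U = "{g. a g \<noteq> 0} \<union> {g. b g \<noteq> 0} \<union> {g. c g \<noteq> 0}"
  have fin: "finite ?U" using assms by simp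
  have sub: "{g. a g \<noteq> 0} \<subseteq> ?U" "{g. b g \<noteq> 0} \<subseteq> ?U" "{g. c g \<noteq> 0} \<subseteq> ?U"
    "{g. a g + b g \<noteq> 0} \<subseteq> ?U" "{g. k * a g \<noteq> 0} \<subseteq> ?U"
    by auto
  note t = weyl_poly_times[OF fin _ fin, where G = G and \<sigma> = \<sigma>]
  show "times P (add P a b) c = add P (times P a c) (times P b c)"
    "times P c (add P a b) = add P (times P c a) (times P c b)"
    "times P (scale P k a) c = scale P k (times P a c)"
    "times P c (scale P k a) = scale P k (times P c a)"
    unfolding weyl_poly_simps(2,3) fun_eq_iff
      t[OF sub(4,3)] t[OF sub(3,4)] t[OF sub(5,3)] t[OF sub(3,5)]
      t[OF sub(1,3)] t[OF sub(2,3)] t[OF sub(3,1)] t[OF sub(3,2)]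
      sum_distrib_left sum.distrib[symmetric]
    by (auto intro!: sum.cong simp: algebra_simps)
qed

lemma supp_add: "{x. a x + b x \<noteq> (0 :: complex)} \<subseteq> {x. a x \<noteq> 0} \<union> {x. b x \<noteq> 0}"
  by auto

lemma seminormed_star_alg_weyl_poly: "seminormed_star_alg P"
proof
  show "unit P \<in> elems P" by (simp add: if_distrib cong: if_cong)
next
  fix a b assume ab: "a \<in> elems P" "b \<in> elems P"
  then show "add P a b \<in> elems P"
    using finite_subset[OF supp_add[of a b]] order_trans[OF supp_add[of a b]] by simp
  show "times P a b \<in> elems P" using times_closed ab .
  show "add P a b = add P b a" "add P a (scale P 0 b) = a" by (simp_all add: add.commute)
  show "scale P c (add P a b) = add P (scale P c a) (scale P c b)" for c by (simp add: distrib_left)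
  show "times P (scale P c a) b = scale P c (times P a b)" "times P a (scale P c b) = scale P c (times P a b)" for c
    using poly_times_linear(3)[OF ab(1) ab(1) ab(2)] poly_times_linear(4)[OF ab(2) ab(2) ab(1)] by blast+
  show "star P (add P a b) = add P (star P a) (star P b)" by auto
  show "star P (times P a b) = times P (star P b) (star P a)" by (rule poly_star_times[OF ab])
  show "nrm P (add P a b) \<le> nrm P a + nrm P b"
  proof -
    let ?U = "{g. a g \<noteq> 0} \<union> {g. b g \<noteq> 0}"
    have fin: "finite ?U" using ab by simp
    have "nrm P (add P a b) = (\<Sum>g\<in>?U. cmod (a g + b g))"
      by (subst nrm_weyl_poly[OF fin]) auto
    also have "\<dots> \<le> (\<Sum>g\<in>?U. cmod (a g)) + (\<Sum>g\<in>?U. cmod (b g))"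
      by (simp add: sum.distrib[symmetric] sum_mono norm_triangle_ineq)
    also have "\<dots> = nrm P a + nrm P b"
      using nrm_weyl_poly[OF fin, of a] nrm_weyl_poly[OF fin, of b] by (simp del: weyl_poly_simps(6))
    finally show ?thesis .
  qed
  show "nrm P (times P a b) \<le> nrm P a * nrm P b" by (rule poly_nrm_times[OF ab])
next
  fix a b c assume abc: "a \<in> elems P" "b \<in> elems P" "c \<in> elems P"
  show "add P (add P a b) c = add P a (add P b c)" by (simp add: add.assoc)
  show "times P (times P a b) c = times P a (times P b c)" by (rule poly_times_assoc[OF abc])
  show "times P (add P a b) c = add P (times P a c) (times P b c)"
    "times P c (add P a b) = add P (times P c a) (times P c b)"
    by (rule poly_times_linear[OF abc])+
next
  fix a assume a: "a \<in> elems P"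
  show "scale P c a \<in> elems P" for c
    using a by (cases "c = 0") simp_all
  show "star P a \<in> elems P" by (rule poly_star_closed[OF a])
  show "scale P (c + e) a = add P (scale P c a) (scale P e a)"
    "scale P c (scale P e a) = scale P (c * e) a" for c e
    by (simp_all add: distrib_right mult.assoc)
  show "scale P 1 a = a" by simp
  show "times P (unit P) a = a" "times P a (unit P) = a" by (rule poly_unit_times[OF a])+
  show "star P (star P a) = a" using a by (auto simp: fun_eq_iff)
  show "star P (scale P c a) = scale P (cnj c) (star P a)" for c by auto
  show "0 \<le> nrm P a" by (simp add: sum_nonneg)
  show "nrm P (scale P c a) = cmod c * nrm P a" for c
    by (cases "c = 0") (simp_all add: norm_mult sum_distrib_left)
  have "nrm P (star P a) = (\<Sum>g | a g \<noteq> 0. cmod (star P a (inv g)))"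
    unfolding weyl_poly_simps(6) by (rule sum_supp_star[OF a])
  also have "\<dots> = nrm P a"
    unfolding weyl_poly_simps(6) using a by (intro sum.cong refl) auto
  finally show "nrm P (star P a) = nrm P a" .
qed

end

text \<open>A finitely supported function arises from 0 by adding one multiple of a generator at a
  time; this carries agreement on generators to all polynomials.\<close>

lemma weyl_poly_induct [consumes 1, case_names zero gen]:
  fixes a :: "'g \<Rightarrow> complex"
  assumes a: "a \<in> elems (weyl_poly G \<sigma>)"
    and zero: "Q (\<lambda>_. 0)"
    and gen: "\<And>a g c. \<lbrakk>a \<in> elems (weyl_poly G \<sigma>); g \<in> carrier G; Q a\<rbrakk>
      \<Longrightarrow> Q (add (weyl_poly G \<sigma>) a (scale (weyl_poly G \<sigma>) c (\<lambda>x. if x = g then 1 else 0)))"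
  shows "Q a"
proof -
  have "Q a" if "finite S" "S \<subseteq> carrier G" "{g. a g \<noteq> 0} \<subseteq> S" for S a
    using that
  proof (induction S arbitrary: a rule: finite_induct)
    case empty
    then have "a = (\<lambda>_. 0)" by auto
    then show ?case using zero by simp
  next
    case (insert g S)
    let ?a = "a(g := 0)"
    have supp: "{x. ?a x \<noteq> 0} \<subseteq> S" using insert.prems by auto
    then have "?a \<in> elems (weyl_poly G \<sigma>)"
      using insert.prems insert.hyps finite_subset[OF supp] by auto
    moreover have "Q ?a" using insert.prems by (intro insert.IH[OF _ supp]) simp
    ultimately have "Q (add (weyl_poly G \<sigma>) ?a (scale (weyl_poly G \<sigma>) (a g) (\<lambda>x. if x = g then 1 else 0)))"
      using insert.prems by (intro gen) auto
    moreover have "add (weyl_poly G \<sigma>) ?a (scale (weyl_poly G \<sigma>) (a g) (\<lambda>x. if x = g then 1 else 0)) = a"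
      by (auto simp: fun_eq_iff)
    ultimately show ?case by simp
  qed
  from this[of "{g. a g \<noteq> 0}" a] show ?thesis using a by simp
qed

section \<open>Generators and uniqueness of maps on the Weyl algebra\<close>

context weyl_data
begin

lemma gen_in_poly: "g \<in> carrier G \<Longrightarrow> (\<lambda>x. if x = g then 1 else 0) \<in> elems P"
  by (simp add: if_distrib cong: if_cong)

lemma seminormed_star_alg_weyl_banach: "seminormed_star_alg (weyl_banach G \<sigma>)"
  unfolding weyl_banach_def
  by (rule seminormed_star_alg.seminormed_star_alg_completion[OF seminormed_star_alg_weyl_poly])

lemma seminormed_star_alg_weyl_cstar: "seminormed_star_alg (with_cstar_norm (weyl_banach G \<sigma>))"
  by (rule seminormed_star_alg.seminormed_star_alg_with_cstar_norm[OF seminormed_star_alg_weyl_banach])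

lemma weyl_algebra_eq: "weyl_algebra G \<sigma> = completion (with_cstar_norm (weyl_banach G \<sigma>))"
  by (simp add: weyl_algebra_def enveloping_cstar_def)

lemma seminormed_star_alg_weyl_algebra: "seminormed_star_alg (weyl_algebra G \<sigma>)"
  unfolding weyl_algebra_eq
  by (rule seminormed_star_alg.seminormed_star_alg_completion[OF seminormed_star_alg_weyl_cstar])

lemma separated_weyl_algebra: "separated (weyl_algebra G \<sigma>)"
  unfolding weyl_algebra_eq by (rule separated_completion[OF seminormed_star_alg_weyl_cstar])

lemma weyl_gen_closed:
  assumes "g \<in> carrier G"
  shows "weyl_gen G \<sigma> g \<in> elems (weyl_algebra G \<sigma>)"
  unfolding weyl_gen_def weyl_algebra_eq
  using seminormed_star_alg.embed_closed[OF seminormed_star_alg_weyl_poly gen_in_poly[OF assms]]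
  by (intro seminormed_star_alg.embed_closed[OF seminormed_star_alg_weyl_cstar])
    (simp only: with_cstar_norm_simps weyl_banach_def)

text \<open>The common source of all uniqueness below. Continuity in the C*-norm restricts to
  continuity in the larger Banach norm and then in the l1-norm; agreement then climbs back from
  polynomials through both completions.\<close>

theorem bdd_linear_weyl_eq:
  fixes B :: "'b star_alg"
  assumes B: "seminormed_star_alg B" and sep: "separated B"
    and f: "bdd_linear (weyl_algebra G \<sigma>) B f" and f': "bdd_linear (weyl_algebra G \<sigma>) B f'"
    and eq: "\<And>g. g \<in> carrier G \<Longrightarrow> f (weyl_gen G \<sigma> g) = f' (weyl_gen G \<sigma> g)"
    and X: "X \<in> elems (weyl_algebra G \<sigma>)"
  shows "f X = f' X"
proof -
  let ?C = "with_cstar_norm (weyl_banach G \<sigma>)"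
  note C = seminormed_star_alg_weyl_cstar and Ba = seminormed_star_alg_weyl_banach
    and Po = seminormed_star_alg_weyl_poly
  define r where "r h = h \<circ> completion_embed ?C" for h :: "'g weyl_elem \<Rightarrow> 'b"
  define r' where "r' h = r h \<circ> completion_embed P" for h :: "'g weyl_elem \<Rightarrow> 'b"
  have r: "bdd_linear (completion P) B (r h)" if "bdd_linear (weyl_algebra G \<sigma>) B h" for h
    unfolding r_def
    using bdd_linear_with_cstar_norm[OF Ba bdd_linear_embed[OF C that[unfolded weyl_algebra_eq]]]
    by (simp only: weyl_banach_def)
  have r': "bdd_linear P B (r' h)" if "bdd_linear (weyl_algebra G \<sigma>) B h" for h
    unfolding r'_def by (rule bdd_linear_embed[OF Po r[OF that]])
  have gen_eq: "r' f (\<lambda>x. if x = g then 1 else 0) = r' f' (\<lambda>x. if x = g then 1 else 0)" if "g \<in> carrier G" for g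
    using eq[OF that] by (simp add: r'_def r_def weyl_gen_def)
  have lin: "r' h (add P a b) = add B (r' h a) (r' h b)" "r' h (scale P c a) = scale B c (r' h a)"
    if "bdd_linear (weyl_algebra G \<sigma>) B h" "a \<in> elems P" "b \<in> elems P" for h a b c
    using r'[OF that(1)] that(2,3) unfolding bdd_linear_def by blast+
  have poly: "r' f a = r' f' a" if "a \<in> elems P" for a
    using that
  proof (induction rule: weyl_poly_induct)
    case zero
    \<comment> \<open>The zero polynomial is written as 0 times a generator, since
      \<open>bdd_linear\<close> speaks of sums and multiples only.\<close>
    have "r' h (\<lambda>_. 0) = scale B 0 (r' h (\<lambda>x. if x = \<one> then 1 else 0))"
      if "bdd_linear (weyl_algebra G \<sigma>) B h" for h
      using lin(2)[OF that gen_in_poly gen_in_poly, of \<one> \<one> 0] by simp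
    then show ?case using f f' gen_eq[of \<one>] by simp
  next
    case (gen a g c)
    note g = gen_in_poly[OF gen(2)]
    note sc = seminormed_star_alg.scale_closed[OF Po g, of c]
    show ?case
      unfolding lin(1)[OF f gen(1) sc] lin(1)[OF f' gen(1) sc] lin(2)[OF f g g] lin(2)[OF f' g g]
        gen(3) gen_eq[OF gen(2)] ..
  qed
  have banach: "r f b = r f' b" if "b \<in> elems (completion P)" for b
    using bdd_linear_eq_completion[OF Po B sep r[OF f] r[OF f'] _ that] poly by (simp add: r'_def)
  show ?thesis
  proof (rule bdd_linear_eq_completion[OF C B sep f[unfolded weyl_algebra_eq] f'[unfolded weyl_algebra_eq]])
    fix b assume "b \<in> elems ?C"
    then show "f (completion_embed ?C b) = f' (completion_embed ?C b)"
      using banach[of b] by (simp only: r_def comp_def with_cstar_norm_simps weyl_banach_def)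
  qed (use X in \<open>simp only: weyl_algebra_eq\<close>)
qed

end

subsection \<open>The state that is supported on an isotropic subgroup\<close>

locale weyl_isotropic = weyl_data G \<sigma> for G :: "'g monoid" (structure) and \<sigma> +
  fixes K :: "'g set"
  assumes subgroup: "subgroup K G"
    and isotropic: "\<lbrakk>x \<in> K; y \<in> K\<rbrakk> \<Longrightarrow> \<sigma> x y = 0"
begin

text \<open>The indicator appears as a weight, so that \<open>sum_weyl_poly_times\<close> evaluates
  the functional on products.\<close>

definition poly_functional :: "('g \<Rightarrow> complex) \<Rightarrow> complex" where
  "poly_functional a = (\<Sum>x | a x \<noteq> 0. a x * of_bool (x \<in> K))"

lemma poly_functional_eq:
  assumes "finite U" "{g. a g \<noteq> 0} \<subseteq> U"
  shows "poly_functional a = (\<Sum>x\<in>U. a x * of_bool (x \<in> K))"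
  unfolding poly_functional_def using assms by (intro sum.mono_neutral_left) auto

text \<open>Relative to a fixed point \<open>z\<close> of the coset \<open>gK\<close>, the isotropy of \<open>K\<close> makes the cocycle
  a coboundary on this coset.\<close>

lemma sigma_on_coset:
  assumes "g \<in> carrier G" "h \<in> carrier G" "z \<in> carrier G" "inv g \<otimes> z \<in> K" "inv h \<otimes> z \<in> K"
  shows "\<sigma> (inv g) h = \<sigma> z g - \<sigma> z h"
proof -
  have "\<sigma> (inv g \<otimes> z) (inv h \<otimes> z) = 0" using assms(4,5) by (rule isotropic)
  moreover have "\<sigma> (inv g \<otimes> z) (inv h \<otimes> z) = \<sigma> g h - \<sigma> g z - \<sigma> z h"
    using assms by (simp add: sigma_left sigma_right sigma_inv sigma_self algebra_simps)
  ultimately show ?thesis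
    using sigma_commute[OF assms(3,1)] assms by (simp add: sigma_inv algebra_simps)
qed

lemma poly_functional_pos:
  assumes a: "a \<in> elems P"
  shows "poly_functional (times P (star P a) a) \<in> \<real>\<^sub>\<ge>\<^sub>0"
proof -
  \<comment> \<open>A point of the coset g K, chosen by a property that depends on the coset alone,
    so that r g = r h detects equal cosets.\<close>
  define r where "r g = (SOME z. z \<in> carrier G \<and> inv g \<otimes> z \<in> K)" for g
  have r: "r g \<in> carrier G \<and> inv g \<otimes> r g \<in> K" if "g \<in> carrier G" for g
    unfolding r_def
    by (rule someI[of _ g]) (use that subgroup.one_closed[OF subgroup] in simp)
  have r_eq: "inv g \<otimes> h \<in> K \<longleftrightarrow> r g = r h" if g: "g \<in> carrier G" and h: "h \<in> carrier G" for g h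
  proof
    assume gh: "inv g \<otimes> h \<in> K"
    then have hg: "inv (inv g \<otimes> h) \<in> K" by (rule subgroup.m_inv_closed[OF subgroup])
    \<comment> \<open>The defining properties of \<open>r g\<close> and \<open>r h\<close> hold for
      the same z, so the two choices coincide.\<close>
    have "inv g \<otimes> z \<in> K \<longleftrightarrow> inv h \<otimes> z \<in> K" if z: "z \<in> carrier G" for z
    proof
      assume "inv g \<otimes> z \<in> K"
      then have "inv (inv g \<otimes> h) \<otimes> (inv g \<otimes> z) \<in> K" by (rule subgroup.m_closed[OF subgroup hg])
      then show "inv h \<otimes> z \<in> K"
        using g h z by (simp add: inv_mult_group m_assoc) (metis inv_closed l_one m_assoc r_inv)
    next
      assume "inv h \<otimes> z \<in> K"
      then have "(inv g \<otimes> h) \<otimes> (inv h \<otimes> z) \<in> K" by (rule subgroup.m_closed[OF subgroup gh])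
      then show "inv g \<otimes> z \<in> K"
        using g h z by (metis inv_closed l_one m_assoc r_inv m_closed)
    qed
    then show "r g = r h" unfolding r_def by (metis (no_types, lifting))
  next
    assume eq: "r g = r h"
    have "inv g \<otimes> r g \<in> K" "inv h \<otimes> r g \<in> K"
      using r[OF g] r[OF h] eq by auto
    then have "(inv g \<otimes> r g) \<otimes> inv (inv h \<otimes> r g) \<in> K"
      by (intro subgroup.m_closed[OF subgroup _ subgroup.m_inv_closed[OF subgroup]])
    moreover have "(inv g \<otimes> r g) \<otimes> inv (inv h \<otimes> r g) = inv g \<otimes> h"
    proof -
      have z: "r g \<in> carrier G" using r[OF g] by simp
      have "(inv g \<otimes> r g) \<otimes> inv (inv h \<otimes> r g) = (inv g \<otimes> r g) \<otimes> (inv (r g) \<otimes> h)"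
        using z h by (simp add: inv_mult_group)
      also have "\<dots> = inv g \<otimes> h"
        using z g h by (metis inv_closed l_one m_assoc r_inv m_closed)
      finally show ?thesis .
    qed
    ultimately show "inv g \<otimes> h \<in> K" by simp
  qed
  let ?S = "{g. a g \<noteq> 0}"
  have fin: "finite ?S" and mem: "g \<in> ?S \<Longrightarrow> g \<in> carrier G" for g using a by auto
  \<comment> \<open>The coboundary is absorbed into the coefficients, relative to the base point
    \<open>r h\<close> of the coset.\<close>
  define f where "f h = a h * circle_exp (- \<sigma> (r h) h)" for h
  have "poly_functional (times P (star P a) a) =
      (\<Sum>g\<in>?S. \<Sum>h\<in>?S. star P a (inv g) * a h * circle_exp (\<sigma> (inv g) h) * of_bool (inv g \<otimes> h \<in> K))"
    unfolding poly_functional_def sum_weyl_poly_times[OF poly_star_closed[OF a] a]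
    by (rule sum_supp_star[OF a])
  also have "\<dots> = (\<Sum>g\<in>?S. \<Sum>h\<in>?S. of_bool (r g = r h) * (cnj (f g) * f h))"
  proof (intro sum.cong refl)
    fix g h assume "g \<in> ?S" "h \<in> ?S"
    then have gh: "g \<in> carrier G" "h \<in> carrier G" using mem by blast+
    show "star P a (inv g) * a h * circle_exp (\<sigma> (inv g) h) * of_bool (inv g \<otimes> h \<in> K) =
        of_bool (r g = r h) * (cnj (f g) * f h)"
    proof (cases "r g = r h")
      case True
      have "\<sigma> (inv g) h = \<sigma> (r h) g - \<sigma> (r h) h"
        using r[OF gh(1)] r[OF gh(2)] True gh by (intro sigma_on_coset) auto
      then have "circle_exp (\<sigma> (inv g) h) = cnj (circle_exp (- \<sigma> (r g) g)) * circle_exp (- \<sigma> (r h) h)"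
        by (simp add: circle_exp_minus[symmetric] circle_exp_add[symmetric] True)
      then show ?thesis using True gh by (simp add: r_eq f_def)
    qed (use gh in \<open>simp add: r_eq\<close>)
  qed
  \<comment> \<open>After sorting by cosets, the sum over the pairs within one coset factors into a
    number and its conjugate.\<close>
  also have "\<dots> = (\<Sum>z\<in>r ` ?S. \<Sum>g | g \<in> ?S \<and> r g = z. \<Sum>h\<in>?S. of_bool (r g = r h) * (cnj (f g) * f h))"
    by (rule sum.image_gen[OF fin])
  also have "\<dots> = (\<Sum>z\<in>r ` ?S. of_real ((cmod (\<Sum>h | h \<in> ?S \<and> r h = z. f h))\<^sup>2))"
  proof (intro sum.cong refl)
    fix z
    have "(\<Sum>g | g \<in> ?S \<and> r g = z. \<Sum>h\<in>?S. of_bool (r g = r h) * (cnj (f g) * f h))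
        = (\<Sum>g | g \<in> ?S \<and> r g = z. \<Sum>h | h \<in> ?S \<and> r h = z. cnj (f g) * f h)"
      using fin by (intro sum.cong refl sum.mono_neutral_cong_right) auto
    also have "\<dots> = cnj (\<Sum>h | h \<in> ?S \<and> r h = z. f h) * (\<Sum>h | h \<in> ?S \<and> r h = z. f h)"
      by (simp add: sum_product)
    also have "\<dots> = of_real ((cmod (\<Sum>h | h \<in> ?S \<and> r h = z. f h))\<^sup>2)"
      by (subst mult.commute) (simp only: complex_norm_square)
    finally show "(\<Sum>g | g \<in> ?S \<and> r g = z. \<Sum>h\<in>?S. of_bool (r g = r h) * (cnj (f g) * f h))
        = of_real ((cmod (\<Sum>h | h \<in> ?S \<and> r h = z. f h))\<^sup>2)" .
  qed
  also have "\<dots> = of_real (\<Sum>z\<in>r ` ?S. (cmod (\<Sum>h | h \<in> ?S \<and> r h = z. f h))\<^sup>2)"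
    by simp
  also have "\<dots> \<in> \<real>\<^sub>\<ge>\<^sub>0"
    unfolding nonneg_Reals_of_real_iff by (intro sum_nonneg) simp
  finally show ?thesis .
qed

lemma is_state_poly_functional: "is_state P poly_functional"
  unfolding is_state_def continuous_functional_def
proof (intro conjI ballI allI)
  fix a b assume ab: "a \<in> elems P" "b \<in> elems P"
  let ?U = "{g. a g \<noteq> 0} \<union> {g. b g \<noteq> 0}"
  have fin: "finite ?U" using ab by simp
  have eq: "poly_functional c = (\<Sum>x\<in>?U. c x * of_bool (x \<in> K))" if "c \<in> {a, b, add P a b}" for c
    using that by (intro poly_functional_eq[OF fin]) auto
  show "poly_functional (add P a b) = poly_functional a + poly_functional b"
    by (simp only: eq insert_iff simp_thms weyl_poly_simps distrib_right sum.distrib)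
next
  fix c a
  show "poly_functional (scale P c a) = c * poly_functional a"
    by (cases "c = 0") (simp_all add: poly_functional_def sum_distrib_left mult.assoc)
next
  have "cmod (poly_functional a) \<le> 1 * nrm P a" for a
    unfolding poly_functional_def weyl_poly_simps mult_1
    by (intro sum_norm_le) (simp add: norm_mult)
  then show "\<exists>C. \<forall>a\<in>elems P. cmod (poly_functional a) \<le> C * nrm P a" by blast
next
  show "poly_functional (unit P) = 1"
    using poly_functional_eq[of "{\<one>}" "unit P"] subgroup.one_closed[OF subgroup] by simp
qed (rule poly_functional_pos)

text \<open>Two applications of \<open>state_completion\<close>, with the change to the enveloping
  norm between them.\<close>

theorem weyl_state_exists:
  "\<exists>\<psi>. is_state (weyl_algebra G \<sigma>) \<psi> \<and> (\<forall>g \<in> carrier G. \<psi> (weyl_gen G \<sigma> g) = of_bool (g \<in> K))"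
proof -
  obtain \<psi> where \<psi>: "is_state (weyl_banach G \<sigma>) \<psi>"
    "\<And>a. a \<in> elems P \<Longrightarrow> \<psi> (completion_embed P a) = poly_functional a"
    using seminormed_star_alg.state_completion[OF seminormed_star_alg_weyl_poly is_state_poly_functional]
    unfolding weyl_banach_def by blast
  have "star_alg_state (weyl_banach G \<sigma>) \<psi>"
    by (intro star_alg_state.intro star_alg_state_axioms.intro seminormed_star_alg_weyl_banach \<psi>)
  from star_alg_state.is_state_with_cstar_norm[OF this]
  obtain \<psi>' where \<psi>': "is_state (weyl_algebra G \<sigma>) \<psi>'"
    "\<And>a. a \<in> elems (with_cstar_norm (weyl_banach G \<sigma>)) \<Longrightarrow>
      \<psi>' (completion_embed (with_cstar_norm (weyl_banach G \<sigma>)) a) = \<psi> a"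
    using seminormed_star_alg.state_completion[OF seminormed_star_alg_weyl_cstar]
    unfolding weyl_algebra_eq by blast
  have "\<psi>' (weyl_gen G \<sigma> g) = of_bool (g \<in> K)" if g: "g \<in> carrier G" for g
  proof -
    have "\<psi>' (weyl_gen G \<sigma> g) = \<psi> (completion_embed P (\<lambda>x. if x = g then 1 else 0))"
      unfolding weyl_gen_def
      using seminormed_star_alg.embed_closed[OF seminormed_star_alg_weyl_poly gen_in_poly[OF g]]
      by (intro \<psi>') (simp only: with_cstar_norm_simps weyl_banach_def)
    also have "\<dots> = poly_functional (\<lambda>x. if x = g then 1 else 0)"
      by (rule \<psi>(2)[OF gen_in_poly[OF g]])
    also have "\<dots> = of_bool (g \<in> K)"
      using poly_functional_eq[of "{g}" "\<lambda>x. if x = g then 1 else 0"] by simp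
    finally show ?thesis .
  qed
  then show ?thesis using \<psi>'(1) by blast
qed

end

subsection \<open>Functoriality\<close>

text \<open>Transport of coefficients along \<theta> preserves the l1-norm and, as \<tau>
  corresponds to \<sigma>, the twisted product. \<open>cstar_iso_completion\<close> lifts it twice,
  with the change to the enveloping norm in between.\<close>

theorem weyl_iso_exists:
  assumes G: "weyl_data G \<sigma>" and H: "weyl_data H \<tau>"
    and iso: "\<theta> \<in> iso G H"
    and pres: "\<And>x y. \<lbrakk>x \<in> carrier G; y \<in> carrier G\<rbrakk> \<Longrightarrow> \<tau> (\<theta> x) (\<theta> y) = \<sigma> x y"
  shows "\<exists>\<Phi>. cstar_iso (weyl_algebra G \<sigma>) (weyl_algebra H \<tau>) \<Phi> \<and>
    (\<forall>g \<in> carrier G. \<Phi> (weyl_gen G \<sigma> g) = weyl_gen H \<tau> (\<theta> g))"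
proof -
  interpret G: weyl_data G \<sigma> by (rule G)
  interpret H: weyl_data H \<tau> by (rule H)
  let ?P = "weyl_poly G \<sigma>" and ?Q = "weyl_poly H \<tau>"
  have bij: "bij_betw \<theta> (carrier G) (carrier H)" and hom: "\<theta> \<in> hom G H"
    using iso by (auto simp: iso_def)
  interpret \<theta>: group_hom G H \<theta> by unfold_locales (rule hom)
  have inj: "inj_on \<theta> (carrier G)" and img: "\<theta> ` carrier G = carrier H"
    using bij by (auto simp: bij_betw_def)
  let ?i = "inv_into (carrier G) \<theta>"
  have i: "?i (\<theta> x) = x" if "x \<in> carrier G" for x
    by (rule inv_into_f_f[OF inj that])
  have i': "?i y \<in> carrier G" "\<theta> (?i y) = y" if "y \<in> carrier H" for y
    using that img by (metis inv_into_into) (metis that img f_inv_into_f)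
  \<comment> \<open>Coefficient functions are total, so the transported one is set to 0 outside the
    carrier.\<close>
  define F where "F a y = (if y \<in> carrier H then a (?i y) else 0)" for a :: "'a \<Rightarrow> complex" and y
  have F: "F a (\<theta> x) = a x" if "x \<in> carrier G" for a x
    using that by (simp add: F_def i)
  have supp: "{y. F a y \<noteq> 0} = \<theta> ` {x. a x \<noteq> 0}" if "a \<in> elems ?P" for a
  proof (intro equalityI subsetI)
    fix y assume "y \<in> {y. F a y \<noteq> 0}"
    then have "y \<in> carrier H" "a (?i y) \<noteq> 0" by (auto simp: F_def split: if_splits)
    then show "y \<in> \<theta> ` {x. a x \<noteq> 0}" using i'(2)[of y]
      by (intro image_eqI[of _ _ "?i y"]) simp_all
  next
    fix y assume "y \<in> \<theta> ` {x. a x \<noteq> 0}"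
    then obtain x where "y = \<theta> x" "a x \<noteq> 0" by blast
    then show "y \<in> {y. F a y \<noteq> 0}" using that F[of x a] by auto
  qed
  have inj_supp: "inj_on \<theta> {x. a x \<noteq> 0}" if "a \<in> elems ?P" for a :: "'a \<Rightarrow> complex"
    by (rule inj_on_subset[OF inj]) (use that in auto)
  have sum: "(\<Sum>y | F a y \<noteq> 0. f y) = (\<Sum>x | a x \<noteq> 0. f (\<theta> x))" if "a \<in> elems ?P" for a and f :: "'b \<Rightarrow> complex"
    unfolding supp[OF that] using inj_supp[OF that] by (simp add: sum.reindex)
  \<comment> \<open>Every point is either some \<theta> x or outside the carrier, where
    \<open>F a\<close> vanishes.\<close>
  have eqI: "F a = b" if "\<And>x. x \<in> carrier G \<Longrightarrow> b (\<theta> x) = a x" "\<And>y. y \<notin> carrier H \<Longrightarrow> b y = 0" for a b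
  proof
    fix y show "F a y = b y"
      using that(1)[of "?i y"] that(2)[of y] i'[of y] by (auto simp: F_def)
  qed
  have Fc: "F a \<in> elems ?Q" if "a \<in> elems ?P" for a
  proof -
    have "finite {y. F a y \<noteq> 0}" using supp[OF that] that by simp
    then show ?thesis by (auto simp: F_def)
  qed
  have isoF: "cstar_iso ?P ?Q F"
    unfolding cstar_iso_def
  proof (intro conjI ballI allI)
    show "bij_betw F (elems ?P) (elems ?Q)"
    \<comment> \<open>The inverse pulls coefficients back along \<theta>, again with 0 off the
      carrier.\<close>
    proof (rule bij_betw_byWitness[where f' = "\<lambda>b x. if x \<in> carrier G then b (\<theta> x) else 0"])
      show "\<forall>a\<in>elems ?P. (\<lambda>x. if x \<in> carrier G then F a (\<theta> x) else 0) = a"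
      proof (intro ballI ext)
        fix a x assume "a \<in> elems ?P"
        then have "x \<notin> carrier G \<Longrightarrow> a x = 0" by auto
        then show "(if x \<in> carrier G then F a (\<theta> x) else 0) = a x" by (simp add: F)
      qed
      show "\<forall>b\<in>elems ?Q. F (\<lambda>x. if x \<in> carrier G then b (\<theta> x) else 0) = b"
      proof (intro ballI eqI)
        fix b y assume "b \<in> elems ?Q" "y \<notin> carrier H"
        then show "b y = 0" by auto
      qed simp
      show "F ` elems ?P \<subseteq> elems ?Q" using Fc by blast
      show "(\<lambda>b x. if x \<in> carrier G then b (\<theta> x) else 0) ` elems ?Q \<subseteq> elems ?P"
      proof (rule image_subsetI)
        fix b assume b: "b \<in> elems ?Q"
        have "{x. (if x \<in> carrier G then b (\<theta> x) else 0) \<noteq> 0} \<subseteq> ?i ` {y. b y \<noteq> 0}"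
        proof
          fix x assume "x \<in> {x. (if x \<in> carrier G then b (\<theta> x) else 0) \<noteq> 0}"
          then have "x \<in> carrier G" "b (\<theta> x) \<noteq> 0" by (simp_all split: if_splits)
          then show "x \<in> ?i ` {y. b y \<noteq> 0}" using i by (intro image_eqI[of _ _ "\<theta> x"]) simp_all
        qed
        then have "finite {x. (if x \<in> carrier G then b (\<theta> x) else 0) \<noteq> 0}"
          by (rule finite_subset) (use b in simp)
        then show "(\<lambda>x. if x \<in> carrier G then b (\<theta> x) else 0) \<in> elems ?P" by (simp add: Collect_mono_iff subset_iff)
      qed
    qed
  next
    fix a b assume a: "a \<in> elems ?P" and b: "b \<in> elems ?P"
    show "F (add ?P a b) = add ?Q (F a) (F b)"
      by (rule eqI) (simp_all add: F, simp add: F_def)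
    show "F (times ?P a b) = times ?Q (F a) (F b)"
    proof (rule eqI)
      have mem: "a x \<noteq> 0 \<Longrightarrow> x \<in> carrier G" "b x \<noteq> 0 \<Longrightarrow> x \<in> carrier G" for x using a b by auto
      \<comment> \<open>Reindexing both sums along \<theta> leaves only the condition on the product
        of the indices to be compared.\<close>
      have t: "times ?Q (F a) (F b) y = (\<Sum>g | a g \<noteq> 0. \<Sum>h | b h \<noteq> 0.
          if \<theta> (g \<otimes>\<^bsub>G\<^esub> h) = y then a g * b h * circle_exp (\<sigma> g h) else 0)" for y
        unfolding weyl_poly_def star_alg.simps sum[OF a] sum[OF b]
        by (intro sum.cong refl) (simp add: mem F pres)
      show "times ?Q (F a) (F b) (\<theta> x) = times ?P a b x" if x: "x \<in> carrier G" for x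
        unfolding t unfolding weyl_poly_def star_alg.simps
      proof (intro sum.cong refl)
        fix g h assume "g \<in> {g. a g \<noteq> 0}" "h \<in> {h. b h \<noteq> 0}"
        then have "g \<otimes>\<^bsub>G\<^esub> h \<in> carrier G" by (simp add: mem)
        then have "\<theta> (g \<otimes>\<^bsub>G\<^esub> h) = \<theta> x \<longleftrightarrow> g \<otimes>\<^bsub>G\<^esub> h = x"
          using x by (rule inj_on_eq_iff[OF inj])
        then show "(if \<theta> (g \<otimes>\<^bsub>G\<^esub> h) = \<theta> x then a g * b h * circle_exp (\<sigma> g h) else 0) =
            (if g \<otimes>\<^bsub>G\<^esub> h = x then a g * b h * circle_exp (\<sigma> g h) else 0)"
          by (simp only:)
      qed
      show "times ?Q (F a) (F b) y = 0" if y: "y \<notin> carrier H" for y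
        unfolding t
      proof (intro sum.neutral ballI)
        fix g h assume "g \<in> {g. a g \<noteq> 0}" "h \<in> {h. b h \<noteq> 0}"
        then have "\<theta> (g \<otimes>\<^bsub>G\<^esub> h) \<in> carrier H" by (simp add: mem)
        then show "(if \<theta> (g \<otimes>\<^bsub>G\<^esub> h) = y then a g * b h * circle_exp (\<sigma> g h) else 0) = 0"
          using y by auto
      qed
    qed
  next
    fix a c assume a: "a \<in> elems ?P"
    show "F (scale ?P c a) = scale ?Q c (F a)"
      by (rule eqI) (simp_all add: F, simp add: F_def)
    show "F (star ?P a) = star ?Q (F a)"
      by (rule eqI) (simp_all add: F \<theta>.hom_inv[symmetric] del: \<theta>.hom_inv)
    show "nrm ?Q (F a) = nrm ?P a"
    proof -
      have "nrm ?Q (F a) = (\<Sum>x | a x \<noteq> 0. cmod (F a (\<theta> x)))"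
        unfolding weyl_poly_simps(6) supp[OF a] using inj_supp[OF a] by (simp add: sum.reindex)
      also have "\<dots> = nrm ?P a"
        unfolding weyl_poly_simps(6) using a by (intro sum.cong refl) (auto simp: F)
      finally show ?thesis .
    qed
  next
    show "F (unit ?P) = unit ?Q"
    proof (rule eqI)
      show "unit ?Q (\<theta> x) = unit ?P x" if "x \<in> carrier G" for x
        using inj_on_eq_iff[OF inj that, of "\<one>\<^bsub>G\<^esub>"] by simp
      show "unit ?Q y = 0" if "y \<notin> carrier H" for y
      proof -
        have "y \<noteq> \<one>\<^bsub>H\<^esub>" using that by blast
        then show ?thesis by simp
      qed
    qed
  qed
  obtain F1 where F1: "cstar_iso (weyl_banach G \<sigma>) (weyl_banach H \<tau>) F1"
    "\<And>a. a \<in> elems ?P \<Longrightarrow> F1 (completion_embed ?P a) = completion_embed ?Q (F a)"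
    using cstar_iso_completion[OF G.seminormed_star_alg_weyl_poly H.seminormed_star_alg_weyl_poly isoF]
    unfolding weyl_banach_def by blast
  have isoF1: "cstar_iso (with_cstar_norm (weyl_banach G \<sigma>)) (with_cstar_norm (weyl_banach H \<tau>)) F1"
    by (rule cstar_iso_with_cstar_norm[OF G.seminormed_star_alg_weyl_banach H.seminormed_star_alg_weyl_banach F1(1)])
  obtain F2 where F2: "cstar_iso (weyl_algebra G \<sigma>) (weyl_algebra H \<tau>) F2"
    "\<And>a. a \<in> elems (with_cstar_norm (weyl_banach G \<sigma>)) \<Longrightarrow>
      F2 (completion_embed (with_cstar_norm (weyl_banach G \<sigma>)) a) = completion_embed (with_cstar_norm (weyl_banach H \<tau>)) (F1 a)"
    using cstar_iso_completion[OF G.seminormed_star_alg_weyl_cstar H.seminormed_star_alg_weyl_cstar isoF1]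
    unfolding G.weyl_algebra_eq H.weyl_algebra_eq by blast
  have "F2 (weyl_gen G \<sigma> g) = weyl_gen H \<tau> (\<theta> g)" if g: "g \<in> carrier G" for g
  proof -
    have "F (\<lambda>x. if x = g then 1 else 0) = (\<lambda>y. if y = \<theta> g then 1 else 0)"
      using g by (intro eqI) (auto simp: inj_on_eq_iff[OF inj])
    moreover have "completion_embed ?P (\<lambda>x. if x = g then 1 else 0) \<in> elems (with_cstar_norm (weyl_banach G \<sigma>))"
      using seminormed_star_alg.embed_closed[OF G.seminormed_star_alg_weyl_poly G.gen_in_poly[OF g]]
      by (simp only: with_cstar_norm_simps weyl_banach_def)
    ultimately show ?thesis
      unfolding weyl_gen_def by (simp only: F2(2) F1(2) G.gen_in_poly[OF g])
  qed
  then show ?thesis using F2(1) by blast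
qed

section \<open>Singular cochains\<close>

text \<open>The universal property of free abelian groups, for coefficients given by a type class
  instead of a group record. It carries identities between chains over to cochains.\<close>

lemma frag_hom_exists:
  fixes c :: "'x \<Rightarrow> 'g::ab_group_add"
  obtains h :: "('x \<Rightarrow>\<^sub>0 int) \<Rightarrow> 'g"
  where "\<And>a b. h (a + b) = h a + h b" "\<And>s. h (frag_of s) = c s"
proof -
  define G :: "'g monoid" where "G = \<lparr>carrier = UNIV, monoid.mult = (+), one = 0\<rparr>"
  interpret comm_group G
    by (rule comm_groupI) (auto simp: G_def add_ac, metis add.right_inverse)
  obtain h where "h \<in> hom (free_Abelian_group UNIV) G" "\<And>x. x \<in> UNIV \<Longrightarrow> h (frag_of x) = c x"
    using free_Abelian_group_universal[of c UNIV] by (auto simp: G_def)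
  then show thesis using that[of h] by (auto simp: hom_def free_Abelian_group_def G_def)
qed

text \<open>Signs are applied by negation, as the coefficients form an abelian group without
  multiplication.\<close>

definition altsum :: "nat \<Rightarrow> (nat \<Rightarrow> 'g) \<Rightarrow> 'g::ab_group_add" where
  "altsum n f = (\<Sum>i\<le>n. if even i then f i else - f i)"

lemma altsum_cong: "(\<And>i. i \<le> n \<Longrightarrow> f i = g i) \<Longrightarrow> altsum n f = altsum n g"
  unfolding altsum_def by (intro sum.cong) auto

lemma altsum_zero [simp]: "altsum n (\<lambda>_. 0) = 0"
  unfolding altsum_def by (intro sum.neutral) auto

lemma altsum_add: "altsum n (\<lambda>i. f i + g i) = altsum n f + altsum n g"
  unfolding altsum_def sum.distrib[symmetric] by (intro sum.cong) auto

lemma additive_altsum: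
  assumes "Modules.additive \<theta>"
  shows "\<theta> (altsum n f) = altsum n (\<lambda>i. \<theta> (f i))"
  unfolding altsum_def additive.sum[OF assms]
  by (intro sum.cong) (auto simp: additive.minus[OF assms])

lemma altsum_Suc_shift: "altsum (Suc n) f = f 0 - altsum n (\<lambda>i. f (Suc i))"
proof -
  have "altsum (Suc n) f = f 0 + (\<Sum>i\<le>n. if even (Suc i) then f (Suc i) else - f (Suc i))"
    unfolding altsum_def sum.atMost_Suc_shift by simp
  also have "(\<Sum>i\<le>n. if even (Suc i) then f (Suc i) else - f (Suc i)) = - altsum n (\<lambda>i. f (Suc i))"
    unfolding altsum_def sum_negf[symmetric] by (intro sum.cong) auto
  finally show ?thesis by simp
qed

text \<open>The faces of a simplex of dimension p + q + 1, cut after the first p + 1; the second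
  block begins with the sign of index p + 1.\<close>

lemma altsum_split:
  "altsum (p + Suc q) f =
    altsum p f + (if even p then - altsum q (\<lambda>j. f (Suc p + j)) else altsum q (\<lambda>j. f (Suc p + j)))"
proof -
  have "altsum (p + Suc q) f = altsum p f + (\<Sum>i\<in>{Suc p..p + Suc q}. if even i then f i else - f i)"
  proof -
    have "{..p + Suc q} = {..p} \<union> {Suc p..p + Suc q}" by auto
    then show ?thesis
      unfolding altsum_def by (simp only:) (rule sum.union_disjoint, auto)
  qed
  also have "(\<Sum>i\<in>{Suc p..p + Suc q}. if even i then f i else - f i) =
      (\<Sum>j\<le>q. if even (Suc p + j) then f (Suc p + j) else - f (Suc p + j))"
    by (rule sum.reindex_bij_witness[of _ "\<lambda>j. Suc p + j" "\<lambda>i. i - Suc p"]) auto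
  also have "\<dots> = (if even p then - altsum q (\<lambda>j. f (Suc p + j)) else altsum q (\<lambda>j. f (Suc p + j)))"
    by (auto simp: altsum_def sum_negf[symmetric] intro!: sum.cong)
  finally show ?thesis .
qed

lemma coboundary_altsum:
  "coboundary p X c s = (if 0 \<le> p \<and> singular_simplex (Suc (nat p)) X s
    then altsum (Suc (nat p)) (\<lambda>i. c (singular_face (Suc (nat p)) i s)) else 0)"
  unfolding coboundary_def altsum_def Suc_eq_plus1 by simp

lemma coboundary_neg: "p < 0 \<Longrightarrow> coboundary p X c = (\<lambda>_. 0)"
  by (simp add: coboundary_altsum fun_eq_iff)

lemma coboundary_add: "coboundary p X (\<lambda>s. a s + b s) = (\<lambda>s. coboundary p X a s + coboundary p X b s)"
  by (simp add: coboundary_altsum altsum_add fun_eq_iff)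

lemma coboundary_zero [simp]: "coboundary p X (\<lambda>_. 0) = (\<lambda>_. 0)"
  by (simp add: coboundary_altsum fun_eq_iff)

lemma coboundary_additive:
  assumes "Modules.additive \<theta>"
  shows "coboundary p X (\<theta> \<circ> c) = \<theta> \<circ> coboundary p X c"
  by (simp add: coboundary_altsum fun_eq_iff additive_altsum[OF assms] additive.zero[OF assms])

lemma coboundary_in_cochains: "coboundary p X c \<in> cochains (p + 1) X"
  by (auto simp: cochains_def coboundary_altsum nat_add_distrib)

lemma coboundary_eval:
  fixes c :: "('a, 'g::ab_group_add) cochain"
  assumes add: "\<And>a b. h (a + b) = h a + h b" and of: "\<And>s. h (frag_of s) = c s"
    and s: "singular_simplex (Suc p) X s"
  shows "coboundary (int p) X c s = h (chain_boundary (Suc p) (frag_of s))"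
proof -
  have h: "Modules.additive h" by unfold_locales (rule add)
  have "h (chain_boundary (Suc p) (frag_of s)) = altsum (Suc p) (\<lambda>i. c (singular_face (Suc p) i s))"
    unfolding chain_boundary_of altsum_def
    by (simp only: nat.distinct if_False additive.sum[OF h])
      (intro sum.cong refl, simp add: of additive.minus[OF h] minus_one_power_iff)
  then show ?thesis using s by (simp add: coboundary_altsum)
qed

text \<open>Extended additively to chains, the coboundary of a cochain is its composition with
  \<open>chain_boundary\<close>, whose square is 0.\<close>

lemma coboundary_coboundary:
  "coboundary (p + 1) X (coboundary p X c) = (\<lambda>_. 0)"
proof (cases "0 \<le> p")
  case True
  then obtain n where p: "p = int n" using nonneg_int_cases by blast
  obtain h where h: "\<And>a b. h (a + b) = h a + h b" "\<And>s. h (frag_of s) = c s"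
    using frag_hom_exists[of c] by metis
  obtain h' where h': "\<And>a b. h' (a + b) = h' a + h' b" "\<And>s. h' (frag_of s) = coboundary p X c s"
    using frag_hom_exists[of "coboundary p X c"] by metis
  \<comment> \<open>Both sides are additive and agree on simplices. Singular chains only, because
    \<open>coboundary\<close> takes the default value 0 elsewhere.\<close>
  have eq: "h' z = h (chain_boundary (Suc n) z)" if "singular_chain (Suc n) X z" for z
    using that unfolding singular_chain_def
  proof (induction rule: frag_induction)
    case zero
    show ?case using additive.zero[of h] additive.zero[of h'] h h' by (simp add: Modules.additive_def)
  next
    case (one s)
    then show ?case using coboundary_eval[of h c n X s] h h' p by simp
  next
    case (diff a b)
    then show ?case
      using additive.diff[of h] additive.diff[of h'] h h' by (simp add: Modules.additive_def chain_boundary_diff)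
  qed
  have "coboundary (p + 1) X (coboundary p X c) s = 0" if s: "singular_simplex (Suc (Suc n)) X s" for s
  proof -
    have "coboundary (p + 1) X (coboundary p X c) s = h' (chain_boundary (Suc (Suc n)) (frag_of s))"
      using coboundary_eval[of h' "coboundary p X c" "Suc n" X s] h' s p by (simp add: add.commute)
    also have "\<dots> = h (chain_boundary (Suc n) (chain_boundary (Suc (Suc n)) (frag_of s)))"
      using s by (intro eq singular_chain_boundary_alt) (simp add: singular_chain_of)
    also have "\<dots> = h 0"
      using chain_boundary_boundary_alt[of "Suc n" X "frag_of s"] s by (simp add: singular_chain_of)
    finally show ?thesis using additive.zero[of h] h by (simp add: Modules.additive_def)
  qed
  moreover have "coboundary (p + 1) X (coboundary p X c) s = 0" if "\<not> singular_simplex (Suc (Suc n)) X s" for s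
    using that unfolding coboundary_altsum[of "p + 1"] by (simp add: p nat_add_distrib)
  ultimately show ?thesis by blast
qed (simp add: coboundary_neg)

subsection \<open>Evaluation on chains\<close>

lemma int_scale_add: "int_scale (m + n) t = int_scale m t + int_scale n t"
  by transfer (simp add: int_diff_rel_def distrib_right)

lemma int_scale_add_right: "int_scale n (s + t) = int_scale n s + int_scale n t"
  by transfer (simp add: int_diff_rel_def distrib_left)

lemma int_scale_zero [simp]: "int_scale 0 t = 0"
  by transfer (simp add: int_diff_rel_def)

lemma int_scale_one [simp]: "int_scale 1 t = t"
  by transfer (simp add: int_diff_rel_def)

lemma int_scale_minus_one [simp]: "int_scale (- 1) t = - t"
  by transfer (simp add: int_diff_rel_def)

lemma int_scale_zero_right [simp]: "int_scale n 0 = 0"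
  using int_scale_add_right[of n 0 0] by simp

lemma int_scale_to_circle: "int_scale n (to_circle x) = to_circle (of_int n * x)"
  by transfer (simp add: int_diff_rel_def)

lemma additive_to_circle: "Modules.additive to_circle"
  by unfold_locales (transfer, simp add: int_diff_rel_def)

lemma to_circle_of_int: "to_circle (of_int n) = 0"
  by transfer (simp add: int_diff_rel_def)

lemma cochain_eval_superset:
  assumes "finite U" "Poly_Mapping.keys z \<subseteq> U"
  shows "cochain_eval c z = (\<Sum>s\<in>U. int_scale (Poly_Mapping.lookup z s) (c s))"
  unfolding cochain_eval_def using assms
  by (intro sum.mono_neutral_left) (auto simp: in_keys_iff)

lemma cochain_eval_add_chain: "cochain_eval c (z + w) = cochain_eval c z + cochain_eval c w"
proof -
  let ?U = "Poly_Mapping.keys z \<union> Poly_Mapping.keys w"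
  have "finite ?U" "Poly_Mapping.keys (z + w) \<subseteq> ?U" by (simp_all add: keys_add)
  then show ?thesis
    by (simp add: cochain_eval_superset[of ?U] lookup_add int_scale_add sum.distrib)
qed

lemma cochain_eval_add: "cochain_eval (\<lambda>s. c s + d s) z = cochain_eval c z + cochain_eval d z"
  by (simp add: cochain_eval_def int_scale_add_right sum.distrib)

lemma cochain_eval_zero [simp]: "cochain_eval (\<lambda>_. 0) z = 0"
  by (simp add: cochain_eval_def)

lemma additive_cochain_eval: "Modules.additive (cochain_eval c)"
  by unfold_locales (rule cochain_eval_add_chain)

text \<open>Both sides are additive in w, and on one simplex this is \<open>coboundary_eval\<close>.
  It makes the evaluation of cohomology on homology well defined.\<close>

lemma stokes:
  assumes "singular_chain (Suc n) X w"
  shows "cochain_eval (coboundary (int n) X c) w = cochain_eval c (chain_boundary (Suc n) w)"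
  using assms unfolding singular_chain_def
proof (induction rule: frag_induction)
  case zero
  show ?case by (simp add: additive.zero[OF additive_cochain_eval])
next
  case (one s)
  have of: "cochain_eval c (frag_of s) = c s" for c s
    by (simp add: cochain_eval_def)
  show ?case
    using coboundary_eval[of "cochain_eval c" c n X s] one by (simp add: of cochain_eval_add_chain)
next
  case (diff a b)
  then show ?case by (simp add: additive.diff[OF additive_cochain_eval] chain_boundary_diff)
qed

section \<open>The cup product\<close>

text \<open>The affine inclusion onto the face of the last vertices. The back face is precomposition
  with it, and thereby continuous.\<close>

definition shift_simplex :: "nat \<Rightarrow> (nat \<Rightarrow> real) \<Rightarrow> nat \<Rightarrow> real" where
  "shift_simplex p x = (\<lambda>i. if i < p then 0 else x (i - p))"

lemma back_face_shift: "back_face p q s = restrict (s \<circ> shift_simplex p) (standard_simplex q)"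
  by (auto simp: back_face_def shift_simplex_def)

lemma shift_simplex_in:
  assumes "x \<in> standard_simplex q"
  shows "shift_simplex p x \<in> standard_simplex (p + q)"
proof -
  have "(\<Sum>i\<le>p + q. shift_simplex p x i) = (\<Sum>i\<in>{p..p + q}. shift_simplex p x i)"
    by (rule sum.mono_neutral_right) (auto simp: shift_simplex_def)
  also have "\<dots> = (\<Sum>i\<le>q. x i)"
    by (rule sum.reindex_bij_witness[of _ "\<lambda>i. i + p" "\<lambda>i. i - p"]) (auto simp: shift_simplex_def)
  finally show ?thesis
    using assms by (auto simp: standard_simplex_def shift_simplex_def)
qed

lemma singular_simplex_front_face:
  assumes "singular_simplex n X s" "p \<le> n"
  shows "singular_simplex p X (front_face p s)"
proof -
  have "continuous_map (subtopology (powertop_real UNIV) (standard_simplex p)) X s"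
    using assms standard_simplex_mono[OF assms(2)]
    by (auto simp: singular_simplex_def intro: continuous_map_from_subtopology_mono)
  then show ?thesis
    by (auto simp: singular_simplex_def front_face_def intro: continuous_map_eq)
qed

lemma singular_simplex_back_face:
  assumes "singular_simplex (p + q) X s"
  shows "singular_simplex q X (back_face p q s)"
proof -
  have "continuous_map (powertop_real UNIV) (powertop_real UNIV) (shift_simplex p)"
    unfolding continuous_map_componentwise_UNIV shift_simplex_def
    by (auto intro: continuous_map_product_projection)
  then have "continuous_map (subtopology (powertop_real UNIV) (standard_simplex q))
      (subtopology (powertop_real UNIV) (standard_simplex (p + q))) (shift_simplex p)"
    using shift_simplex_in by (auto simp: continuous_map_in_subtopology continuous_map_from_subtopology)
  then have "continuous_map (subtopology (powertop_real UNIV) (standard_simplex q)) X (s \<circ> shift_simplex p)"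
    using assms unfolding singular_simplex_def by (blast intro: continuous_map_compose)
  then show ?thesis
    unfolding back_face_shift singular_simplex_def by (auto intro: continuous_map_eq)
qed

lemma front_face_low:
  assumes "i \<le> p"
  shows "front_face p (singular_face (Suc (p + q)) i s) = singular_face (Suc p) i (front_face (Suc p) s)"
proof
  fix x
  have "simplical_face i x \<in> standard_simplex (Suc p)" if "x \<in> standard_simplex p"
    using simplical_face_in_standard_simplex[of "Suc p" i x] assms that by simp
  then show "front_face p (singular_face (Suc (p + q)) i s) x = singular_face (Suc p) i (front_face (Suc p) s) x"
    using standard_simplex_mono[of p "p + q"]
    by (auto simp: front_face_def singular_face_def)
qed

text \<open>A point whose coordinates beyond p vanish is unchanged when a zero is inserted at a
  position i > p.\<close>

lemma front_face_high:
  assumes "p < i"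
  shows "front_face p (singular_face (Suc (p + q)) i s) = front_face p s"
    "singular_face (Suc p) i (front_face (Suc p) s) = front_face p s"
proof -
  have face: "simplical_face i x = x" if "x \<in> standard_simplex p" for x :: "nat \<Rightarrow> real"
    using that assms by (auto simp: simplical_face_def standard_simplex_def fun_eq_iff)
  show "front_face p (singular_face (Suc (p + q)) i s) = front_face p s"
    using standard_simplex_mono[of p "p + q"]
    by (intro ext) (auto simp: front_face_def singular_face_def face)
  show "singular_face (Suc p) i (front_face (Suc p) s) = front_face p s"
    using standard_simplex_mono[of p "Suc p"]
    by (intro ext) (auto simp: front_face_def singular_face_def face)
qed

lemma simplical_face_shift_low: "i \<le> p \<Longrightarrow> simplical_face i (shift_simplex p x) = shift_simplex (Suc p) x"
  by (auto simp: simplical_face_def shift_simplex_def fun_eq_iff intro!: arg_cong[of _ _ x])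

lemma simplical_face_shift_high:
  "simplical_face (p + j) (shift_simplex p x) = shift_simplex p (simplical_face j x)"
  by (auto simp: simplical_face_def shift_simplex_def fun_eq_iff intro!: arg_cong[of _ _ x])

text \<open>Whichever vertex i \<le> p is removed, the last q + 1 of the remaining ones are the
  vertices p + 1 to p + q + 1.\<close>

lemma back_face_low:
  assumes "i \<le> p"
  shows "back_face p q (singular_face (Suc (p + q)) i s) = back_face (Suc p) q s"
  unfolding back_face_shift singular_face_def
  by (auto simp: fun_eq_iff shift_simplex_in simplical_face_shift_low[OF assms])

lemma back_face_high:
  assumes "j \<le> Suc q"
  shows "back_face p q (singular_face (Suc (p + q)) (p + j) s) = singular_face (Suc q) j (back_face p (Suc q) s)"
  unfolding back_face_shift singular_face_def
  using simplical_face_in_standard_simplex[of "Suc q" j] assms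
  by (auto simp: fun_eq_iff shift_simplex_in simplical_face_shift_high)

text \<open>Two pairings occur: circle with integers in \<open>pairing\<close>, and reals with
  integers in the argument for torsion classes.\<close>

locale biadditive =
  fixes \<beta> :: "'g::ab_group_add \<Rightarrow> 'h::ab_group_add \<Rightarrow> 'k::ab_group_add"
  assumes left: "\<And>b. Modules.additive (\<lambda>a. \<beta> a b)" and right: "\<And>a. Modules.additive (\<beta> a)"
begin

lemmas simps = additive.add[OF left] additive.add[OF right] additive.zero[OF left] additive.zero[OF right]
  additive.minus[OF left] additive.minus[OF right]

lemma cup_neg: "p < 0 \<or> q < 0 \<Longrightarrow> cochain_cup \<beta> p q X a b = (\<lambda>_. 0)"
  by (auto simp: cochain_cup_def fun_eq_iff)

lemma cup_in_cochains: "cochain_cup \<beta> p q X a b \<in> cochains (p + q) X"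
  by (auto simp: cochains_def cochain_cup_def nat_add_distrib)

lemma cup_add_left:
  "cochain_cup \<beta> p q X (\<lambda>s. a s + a' s) b = (\<lambda>s. cochain_cup \<beta> p q X a b s + cochain_cup \<beta> p q X a' b s)"
  by (auto simp: cochain_cup_def fun_eq_iff simps)

lemma cup_add_right:
  "cochain_cup \<beta> p q X a (\<lambda>s. b s + b' s) = (\<lambda>s. cochain_cup \<beta> p q X a b s + cochain_cup \<beta> p q X a b' s)"
  by (auto simp: cochain_cup_def fun_eq_iff simps)

lemma cup_zero_left: "cochain_cup \<beta> p q X (\<lambda>_. 0) b = (\<lambda>_. 0)"
  by (auto simp: cochain_cup_def fun_eq_iff simps)

lemma cup_zero_right: "cochain_cup \<beta> p q X a (\<lambda>_. 0) = (\<lambda>_. 0)"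
  by (auto simp: cochain_cup_def fun_eq_iff simps)

text \<open>The two products on the right have p + q + 4 terms in all, the left side p + q + 2. The
  last term of the first product and the initial term of the second both pair the front p-face with
  the back q-face, and they have opposite signs.\<close>

lemma leibniz:
  fixes p q :: nat
  shows "coboundary (int p + int q) X (cochain_cup \<beta> (int p) (int q) X a b) =
    (\<lambda>s. cochain_cup \<beta> (int p + 1) (int q) X (coboundary (int p) X a) b s +
      (if even p then cochain_cup \<beta> (int p) (int q + 1) X a (coboundary (int q) X b) s
       else - cochain_cup \<beta> (int p) (int q + 1) X a (coboundary (int q) X b) s))"
proof
  fix s
  let ?n = "Suc (p + q)"
  have nats: "nat (int p + int q) = p + q" "nat (int p + 1) = Suc p" "nat (int q + 1) = Suc q" by simp_all
  show "coboundary (int p + int q) X (cochain_cup \<beta> (int p) (int q) X a b) s =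
    cochain_cup \<beta> (int p + 1) (int q) X (coboundary (int p) X a) b s +
      (if even p then cochain_cup \<beta> (int p) (int q + 1) X a (coboundary (int q) X b) s
       else - cochain_cup \<beta> (int p) (int q + 1) X a (coboundary (int q) X b) s)"
  proof (cases "singular_simplex ?n X s")
    case True
    define f where "f i = \<beta> (a (front_face p (singular_face ?n i s))) (b (back_face p q (singular_face ?n i s)))" for i
    have lhs: "coboundary (int p + int q) X (cochain_cup \<beta> (int p) (int q) X a b) s = altsum ?n f"
      using True singular_simplex_singular_face[OF True]
      by (auto simp: coboundary_altsum nats cochain_cup_def f_def intro!: altsum_cong)
    let ?A = "front_face p s" and ?B = "back_face (Suc p) q s"
    have low: "f i = \<beta> (a (singular_face (Suc p) i (front_face (Suc p) s))) (b ?B)" if "i \<le> p" for i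
      using that by (simp add: f_def front_face_low back_face_low)
    have high: "f (Suc p + j) = \<beta> (a ?A) (b (singular_face (Suc q) (Suc j) (back_face p (Suc q) s)))" if "j \<le> q" for j
      using that back_face_high[of "Suc j" q p s] by (simp add: f_def front_face_high)
    have "singular_simplex (Suc p) X (front_face (Suc p) s)" "singular_simplex (Suc q) X (back_face p (Suc q) s)"
      using True by (auto intro: singular_simplex_front_face singular_simplex_back_face)
    then have da: "coboundary (int p) X a (front_face (Suc p) s)
        = altsum (Suc p) (\<lambda>i. a (singular_face (Suc p) i (front_face (Suc p) s)))"
      and db: "coboundary (int q) X b (back_face p (Suc q) s)
        = altsum (Suc q) (\<lambda>j. b (singular_face (Suc q) j (back_face p (Suc q) s)))"
      by (simp_all add: coboundary_altsum)
    \<comment> \<open>Face p + 1 of the front part is the front p-face of s; it supplies the extra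
      term, with the sign of index p + 1.\<close>
    have cupA: "cochain_cup \<beta> (int p + 1) (int q) X (coboundary (int p) X a) b s =
        altsum p f + (if even p then - \<beta> (a ?A) (b ?B) else \<beta> (a ?A) (b ?B))"
    proof -
      have "cochain_cup \<beta> (int p + 1) (int q) X (coboundary (int p) X a) b s
          = altsum (p + Suc 0) (\<lambda>i. \<beta> (a (singular_face (Suc p) i (front_face (Suc p) s))) (b ?B))"
        using True by (simp add: cochain_cup_def nats da additive_altsum[OF left])
      also have "\<dots> = altsum p f + (if even p then - \<beta> (a ?A) (b ?B) else \<beta> (a ?A) (b ?B))"
      proof -
        have "altsum p (\<lambda>i. \<beta> (a (singular_face (Suc p) i (front_face (Suc p) s))) (b ?B)) = altsum p f"
          by (rule altsum_cong) (simp add: low)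
        then show ?thesis
          unfolding altsum_split by (simp add: altsum_def[of 0] front_face_high(2))
      qed
      finally show ?thesis .
    qed
    have cupB: "cochain_cup \<beta> (int p) (int q + 1) X a (coboundary (int q) X b) s =
        \<beta> (a ?A) (b ?B) - altsum q (\<lambda>j. f (Suc p + j))"
    proof -
      \<comment> \<open>Removing vertex p from the back part leaves the vertices p + 1 to p + q +
        1.\<close>
      have B: "singular_face (Suc q) 0 (back_face p (Suc q) s) = ?B"
        using back_face_high[of 0 q p s] back_face_low[of p p q s] by simp
      have "cochain_cup \<beta> (int p) (int q + 1) X a (coboundary (int q) X b) s
          = altsum (Suc q) (\<lambda>j. \<beta> (a ?A) (b (singular_face (Suc q) j (back_face p (Suc q) s))))"
        using True by (simp add: cochain_cup_def nats db additive_altsum[OF right])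
      also have "\<dots> = \<beta> (a ?A) (b ?B) - altsum q (\<lambda>j. f (Suc p + j))"
        unfolding altsum_Suc_shift B using altsum_cong[of q "\<lambda>j. f (Suc p + j)", OF high] by simp
      finally show ?thesis .
    qed
    show ?thesis
      unfolding lhs cupA cupB using altsum_split[of p q f] by simp
  next
    case False
    then show ?thesis by (simp add: coboundary_altsum nats cochain_cup_def)
  qed
qed

end

section \<open>Cohomology groups\<close>

lemma cochains_add: "\<lbrakk>a \<in> cochains p X; b \<in> cochains p X\<rbrakk> \<Longrightarrow> (\<lambda>s. a s + b s) \<in> cochains p X"
  unfolding cochains_def mem_Collect_eq by (metis add.right_neutral)

lemma cochains_zero: "(\<lambda>_. 0) \<in> cochains p X"
  by (simp add: cochains_def)

lemma cochains_minus: "a \<in> cochains p X \<Longrightarrow> (\<lambda>s. - a s) \<in> cochains p X"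
  by (simp add: cochains_def)

lemma coboundary_minus: "coboundary p X (\<lambda>s. - a s) = (\<lambda>s. - coboundary p X a s)"
  using coboundary_additive[of uminus p X a] by (simp add: comp_def Modules.additive_def)

abbreviation cocycles :: "int \<Rightarrow> 'a topology \<Rightarrow> ('a, 'g::ab_group_add) cochain set" where
  "cocycles p X \<equiv> carrier (cocycle_group p X)"

lemma cocycles_iff: "c \<in> cocycles p X \<longleftrightarrow> c \<in> cochains p X \<and> coboundary p X c = (\<lambda>_. 0)"
  by (simp add: cocycle_group_def)

lemma cocycle_group_simps [simp]:
  "a \<otimes>\<^bsub>cocycle_group p X\<^esub> b = (\<lambda>s. a s + b s)" "\<one>\<^bsub>cocycle_group p X\<^esub> = (\<lambda>_. 0)"
  by (simp_all add: cocycle_group_def)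

lemma cocycles_add: "\<lbrakk>a \<in> cocycles p X; b \<in> cocycles p X\<rbrakk> \<Longrightarrow> (\<lambda>s. a s + b s) \<in> cocycles p X"
  by (simp add: cocycles_iff cochains_add coboundary_add)

lemma cocycles_zero: "(\<lambda>_. 0) \<in> cocycles p X"
  by (simp add: cocycles_iff cochains_zero)

lemma cocycles_minus: "a \<in> cocycles p X \<Longrightarrow> (\<lambda>s. - a s) \<in> cocycles p X"
  by (simp add: cocycles_iff cochains_minus coboundary_minus)

lemma comm_group_cocycle_group: "comm_group (cocycle_group p X :: ('a, 'g::ab_group_add) cochain monoid)"
proof (rule comm_groupI)
  fix a assume "a \<in> carrier (cocycle_group p X :: ('a, 'g) cochain monoid)"
  then have "(\<lambda>s. - a s) \<in> carrier (cocycle_group p X)" by (rule cocycles_minus)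
  then show "\<exists>y\<in>carrier (cocycle_group p X). y \<otimes>\<^bsub>cocycle_group p X\<^esub> a = \<one>\<^bsub>cocycle_group p X\<^esub>"
    by (intro bexI[of _ "\<lambda>s. - a s"]) simp_all
qed (auto simp: cocycles_add cocycles_zero add_ac)

lemma coboundaries_add: "\<lbrakk>a \<in> coboundaries p X; b \<in> coboundaries p X\<rbrakk> \<Longrightarrow> (\<lambda>s. a s + b s) \<in> coboundaries p X"
  unfolding coboundaries_def by (auto simp: coboundary_add[symmetric] intro!: imageI cochains_add)

lemma coboundaries_zero: "(\<lambda>_. 0) \<in> coboundaries p X"
  unfolding coboundaries_def by (rule image_eqI[of _ _ "\<lambda>_. 0"]) (simp_all add: cochains_zero)

lemma coboundaries_minus: "a \<in> coboundaries p X \<Longrightarrow> (\<lambda>s. - a s) \<in> coboundaries p X"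
  unfolding coboundaries_def by (auto simp: coboundary_minus[symmetric] intro!: imageI cochains_minus)

lemma coboundaries_subset: "coboundaries p X \<subseteq> cocycles p X"
  using coboundary_in_cochains[of "p - 1" X] coboundary_coboundary[of "p - 1" X]
  by (auto simp: coboundaries_def cocycles_iff)

lemma cocycle_inv: "a \<in> cocycles p X \<Longrightarrow> inv\<^bsub>cocycle_group p X\<^esub> a = (\<lambda>s. - a s)"
  by (rule group.inv_equality[OF comm_group.axioms(2)[OF comm_group_cocycle_group]])
    (simp_all add: cocycles_minus)

lemma normal_coboundaries: "coboundaries p X \<lhd> cocycle_group p X"
proof (rule comm_group.subgroup_imp_normal[OF comm_group_cocycle_group])
  show "subgroup (coboundaries p X) (cocycle_group p X)"
    by (rule subgroup.intro)
      (auto simp: coboundaries_add coboundaries_zero coboundaries_minus cocycle_inv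
        coboundaries_subset[THEN subsetD] intro: coboundaries_subset[THEN subsetD])
qed

lemma comm_group_cohomology_group: "comm_group (cohomology_group p X)"
  unfolding cohomology_group_def
  by (rule comm_group.abelian_FactGroup[OF comm_group_cocycle_group normal_imp_subgroup[OF normal_coboundaries]])

lemma group_cohomology_group: "group (cohomology_group p X)"
  by (rule comm_group.axioms(2)[OF comm_group_cohomology_group])

lemma mem_cohom_class: "c \<in> cohom_class p X a \<longleftrightarrow> (\<exists>e \<in> coboundaries p X. c = (\<lambda>s. e s + a s))"
  by (auto simp: cohom_class_def r_coset_def)

lemma cohom_class_self: "a \<in> cohom_class p X a"
  unfolding mem_cohom_class by (rule bexI[OF _ coboundaries_zero]) simp

lemma cohom_class_absorb:
  assumes "e \<in> coboundaries p X"
  shows "cohom_class p X (\<lambda>s. e s + a s) = cohom_class p X a"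
proof (intro equalityI subsetI)
  fix c assume "c \<in> cohom_class p X (\<lambda>s. e s + a s)"
  then obtain e' where "e' \<in> coboundaries p X" "c = (\<lambda>s. e' s + (e s + a s))"
    unfolding mem_cohom_class by blast
  then show "c \<in> cohom_class p X a"
    unfolding mem_cohom_class
    by (intro bexI[OF _ coboundaries_add[of e' p X e]]) (simp_all add: assms add.assoc)
next
  fix c assume "c \<in> cohom_class p X a"
  then obtain e' where "e' \<in> coboundaries p X" "c = (\<lambda>s. e' s + a s)"
    unfolding mem_cohom_class by blast
  then show "c \<in> cohom_class p X (\<lambda>s. e s + a s)"
    unfolding mem_cohom_class
    by (intro bexI[OF _ coboundaries_add[of e' p X "\<lambda>s. - e s", OF _ coboundaries_minus[OF assms]]])
      (simp_all add: add.assoc)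
qed

lemma carrier_cohomology_group: "carrier (cohomology_group p X) = cohom_class p X ` cocycles p X"
  by (simp add: cohomology_group_def carrier_FactGroup cohom_class_def)

lemma cohom_class_in: "a \<in> cocycles p X \<Longrightarrow> cohom_class p X a \<in> carrier (cohomology_group p X)"
  by (simp add: carrier_cohomology_group)

lemma cohom_class_mult:
  assumes "a \<in> cocycles p X" "b \<in> cocycles p X"
  shows "cohom_class p X a \<otimes>\<^bsub>cohomology_group p X\<^esub> cohom_class p X b = cohom_class p X (\<lambda>s. a s + b s)"
  using normal.rcos_sum[OF normal_coboundaries assms]
  by (simp add: cohomology_group_def cohom_class_def)

lemma cohom_class_one: "\<one>\<^bsub>cohomology_group p X\<^esub> = cohom_class p X (\<lambda>_. 0)"
  by (auto simp: cohomology_group_def mem_cohom_class)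

text \<open>Well-definedness of unary operations on classes; additivity is asked only where a
  coboundary is split off.\<close>

lemma UN_cohom_class:
  assumes "\<And>e. e \<in> coboundaries p X \<Longrightarrow> \<phi> (\<lambda>s. e s + a s) = (\<lambda>s. \<phi> e s + \<phi> a s)"
    and "\<And>e. e \<in> coboundaries p X \<Longrightarrow> \<phi> e \<in> coboundaries q Y"
  shows "(\<Union>c \<in> cohom_class p X a. cohom_class q Y (\<phi> c)) = cohom_class q Y (\<phi> a)"
proof (rule UN_const[OF cohom_class_self])
  fix c assume "c \<in> cohom_class p X a"
  then obtain e where "e \<in> coboundaries p X" "c = (\<lambda>s. e s + a s)" unfolding mem_cohom_class by blast
  then show "cohom_class q Y (\<phi> c) = cohom_class q Y (\<phi> a)"
    using assms by (simp add: cohom_class_absorb)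
qed

lemma additive_cochains: "Modules.additive \<theta> \<Longrightarrow> c \<in> cochains p X \<Longrightarrow> \<theta> \<circ> c \<in> cochains p X"
  by (auto simp: cochains_def additive.zero) (metis additive.zero)+

lemma additive_cocycles: "Modules.additive \<theta> \<Longrightarrow> c \<in> cocycles p X \<Longrightarrow> \<theta> \<circ> c \<in> cocycles p X"
  by (auto simp: cocycles_iff additive_cochains coboundary_additive additive.zero)

lemma additive_coboundaries: "Modules.additive \<theta> \<Longrightarrow> c \<in> coboundaries p X \<Longrightarrow> \<theta> \<circ> c \<in> coboundaries p X"
  unfolding coboundaries_def by (auto simp: additive_cochains coboundary_additive[symmetric])

lemma cohom_coeff_class:
  assumes "Modules.additive \<theta>"
  shows "cohom_coeff \<theta> p X (cohom_class p X a) = cohom_class p X (\<theta> \<circ> a)"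
  unfolding cohom_coeff_def
  by (rule UN_cohom_class) (simp_all add: additive_coboundaries[OF assms, unfolded comp_def] additive.add[OF assms] comp_def)

lemma singular_face_simplex_map_commute:
  assumes "1 \<le> p" "k \<le> p"
  shows "simplex_map (p - Suc 0) f (singular_face p k s) = singular_face p k (simplex_map p f s)"
  using assms simplical_face_in_standard_simplex[of p k]
  by (auto simp: simplex_map_def singular_face_def fun_eq_iff)

lemma cochain_pullback_coboundary:
  assumes f: "continuous_map Y X f"
  shows "cochain_pullback (p + 1) Y f (coboundary p X c) = coboundary p Y (cochain_pullback p Y f c)"
proof
  fix s
  show "cochain_pullback (p + 1) Y f (coboundary p X c) s = coboundary p Y (cochain_pullback p Y f c) s"
  proof (cases "0 \<le> p \<and> singular_simplex (Suc (nat p)) Y s")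
    case True
    then have "singular_simplex (Suc (nat p)) X (simplex_map (Suc (nat p)) f s)"
      using singular_simplex_simplex_map f by blast
    then show ?thesis
      using True singular_simplex_singular_face[of "Suc (nat p)" Y s] singular_face_simplex_map_commute[of "Suc (nat p)" _ f s]
      by (auto simp: cochain_pullback_def coboundary_altsum nat_add_distrib intro!: altsum_cong)
  next
    case False
    then show ?thesis
      by (auto simp: cochain_pullback_def coboundary_altsum nat_add_distrib)
  qed
qed

lemma cochain_pullback_add:
  "cochain_pullback p Y f (\<lambda>s. a s + b s) = (\<lambda>s. cochain_pullback p Y f a s + cochain_pullback p Y f b s)"
  by (auto simp: cochain_pullback_def)

lemma cochain_pullback_zero [simp]: "cochain_pullback p Y f (\<lambda>_. 0) = (\<lambda>_. 0)"
  by (auto simp: cochain_pullback_def)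

lemma cochain_pullback_additive:
  "Modules.additive \<theta> \<Longrightarrow> cochain_pullback p Y f (\<theta> \<circ> a) = \<theta> \<circ> cochain_pullback p Y f a"
  by (auto simp: cochain_pullback_def fun_eq_iff additive.zero)

lemma cochain_pullback_in: "cochain_pullback p Y f c \<in> cochains p Y"
  by (auto simp: cochains_def cochain_pullback_def)

lemma cochain_pullback_cocycles:
  "continuous_map Y X f \<Longrightarrow> c \<in> cocycles p X \<Longrightarrow> cochain_pullback p Y f c \<in> cocycles p Y"
  by (simp add: cocycles_iff cochain_pullback_in cochain_pullback_coboundary[symmetric])

lemma cochain_pullback_coboundaries:
  assumes "continuous_map Y X f" "e \<in> coboundaries p X"
  shows "cochain_pullback p Y f e \<in> coboundaries p Y"
  using assms(2) cochain_pullback_coboundary[OF assms(1), of "p - 1"] cochain_pullback_in[of "p - 1" Y f]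
  by (auto simp: coboundaries_def)

lemma cohom_pullback_class:
  assumes "continuous_map Y X f"
  shows "cohom_pullback p Y f (cohom_class p X a) = cohom_class p Y (cochain_pullback p Y f a)"
  unfolding cohom_pullback_def
  by (rule UN_cohom_class) (simp_all add: cochain_pullback_add cochain_pullback_coboundaries[OF assms])

section \<open>The cup product on cohomology classes\<close>

context biadditive
begin

text \<open>If e = \<delta> e' and \<delta> b = 0, the Leibniz rule reads \<delta>(e' \<smile> b) =
  e \<smile> b.\<close>

lemma cup_coboundaries_left:
  assumes e: "e \<in> coboundaries p X" and b: "b \<in> cocycles q X"
  shows "cochain_cup \<beta> p q X e b \<in> coboundaries (p + q) X"
proof (cases "0 < p \<and> 0 \<le> q")
  case True
  then obtain P Q where pq: "p = int P + 1" "q = int Q"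
    using that[of "nat (p - 1)" "nat q"] by simp
  obtain e' where e': "e = coboundary (int P) X e'"
    using e by (auto simp: coboundaries_def pq)
  have "coboundary (int Q) X b = (\<lambda>_. 0)" using b by (simp add: cocycles_iff pq)
  then have z: "cochain_cup \<beta> p' q' X e' (coboundary (int Q) X b) = (\<lambda>_. 0)" for p' q'
    by (simp only: cup_zero_right)
  have "coboundary (int P + int Q) X (cochain_cup \<beta> (int P) (int Q) X e' b) = cochain_cup \<beta> p q X e b"
    by (simp add: leibniz e' pq z cong: if_cong)
  moreover have "p + q - 1 = int P + int Q" using pq by simp
  ultimately show ?thesis
    unfolding coboundaries_def by (metis cup_in_cochains imageI)
next
  \<comment> \<open>In negative degrees the product is 0 by definition, and in degree 0 the only
    coboundary is 0.\<close>
  case False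
  then have "cochain_cup \<beta> p q X e b = (\<lambda>_. 0)"
  proof (cases "p = 0")
    case True
    then have "e = (\<lambda>_. 0)" using e by (auto simp: coboundaries_def coboundary_neg)
    then show ?thesis by (simp only: cup_zero_left)
  qed (use False in \<open>intro cup_neg, auto\<close>)
  then show ?thesis by (simp add: coboundaries_zero)
qed

text \<open>As on the left, but the Leibniz rule contributes the sign (-1)^p, which coboundaries
  absorb.\<close>

lemma cup_coboundaries_right:
  assumes a: "a \<in> cocycles p X" and e: "e \<in> coboundaries q X"
  shows "cochain_cup \<beta> p q X a e \<in> coboundaries (p + q) X"
proof (cases "0 \<le> p \<and> 0 < q")
  case True
  then obtain P Q where pq: "p = int P" "q = int Q + 1"
    using that[of "nat p" "nat (q - 1)"] by simp
  obtain e' where e': "e = coboundary (int Q) X e'"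
    using e by (auto simp: coboundaries_def pq)
  have "coboundary (int P) X a = (\<lambda>_. 0)" using a by (simp add: cocycles_iff pq)
  then have z: "cochain_cup \<beta> p' q' X (coboundary (int P) X a) e' = (\<lambda>_. 0)" for p' q'
    by (simp only: cup_zero_left)
  have "coboundary (int P + int Q) X (cochain_cup \<beta> (int P) (int Q) X a e') =
      (\<lambda>s. if even P then cochain_cup \<beta> p q X a e s else - cochain_cup \<beta> p q X a e s)"
    unfolding e' pq by (simp add: leibniz z cong: if_cong)
  moreover have "coboundary (int P + int Q) X (cochain_cup \<beta> (int P) (int Q) X a e') \<in> coboundaries (p + q) X"
    using cup_in_cochains[of "int P" "int Q" X a e'] by (auto simp: coboundaries_def pq algebra_simps)
  ultimately show ?thesis
    using coboundaries_minus[of "\<lambda>s. - cochain_cup \<beta> p q X a e s" "p + q" X] by (cases "even P") simp_all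
next
  case False
  then have "cochain_cup \<beta> p q X a e = (\<lambda>_. 0)"
  proof (cases "q = 0")
    case True
    then have "e = (\<lambda>_. 0)" using e by (auto simp: coboundaries_def coboundary_neg)
    then show ?thesis by (simp only: cup_zero_right)
  qed (use False in \<open>intro cup_neg, auto\<close>)
  then show ?thesis by (simp add: coboundaries_zero)
qed

lemma cup_cocycles:
  assumes a: "a \<in> cocycles p X" and b: "b \<in> cocycles q X"
  shows "cochain_cup \<beta> p q X a b \<in> cocycles (p + q) X"
proof (cases "0 \<le> p \<and> 0 \<le> q")
  case True
  then obtain P Q where pq: "p = int P" "q = int Q" by (metis nonneg_int_cases)
  have "coboundary (int P) X a = (\<lambda>_. 0)" "coboundary (int Q) X b = (\<lambda>_. 0)"
    using a b by (simp_all add: cocycles_iff pq)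
  then have "cochain_cup \<beta> p' q' X (coboundary (int P) X a) b = (\<lambda>_. 0)"
    "cochain_cup \<beta> p' q' X a (coboundary (int Q) X b) = (\<lambda>_. 0)" for p' q'
    by (simp_all only: cup_zero_left cup_zero_right)
  then show ?thesis
    using cup_in_cochains[of p q X a b] by (simp add: cocycles_iff leibniz pq cong: if_cong)
next
  case False
  then have "cochain_cup \<beta> p q X a b = (\<lambda>_. 0)" by (intro cup_neg) auto
  then show ?thesis by (simp add: cocycles_zero)
qed

text \<open>The representatives are changed one after the other: the left change uses that b' is a
  cocycle, the right change that a is one.\<close>

lemma cup_class:
  assumes a: "a \<in> cocycles p X" and b: "b \<in> cocycles q X"
  shows "cup \<beta> p q X (cohom_class p X a) (cohom_class q X b) = cohom_class (p + q) X (cochain_cup \<beta> p q X a b)"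
  unfolding cup_def
proof (rule UN_const2[OF cohom_class_self cohom_class_self])
  fix a' b' assume "a' \<in> cohom_class p X a" "b' \<in> cohom_class q X b"
  then obtain e f where e: "e \<in> coboundaries p X" "a' = (\<lambda>s. e s + a s)"
    and f: "f \<in> coboundaries q X" "b' = (\<lambda>s. f s + b s)"
    unfolding mem_cohom_class by blast
  have "b' \<in> cocycles q X"
    unfolding f(2) by (intro cocycles_add b subsetD[OF coboundaries_subset f(1)])
  then have "cohom_class (p + q) X (cochain_cup \<beta> p q X a' b') = cohom_class (p + q) X (cochain_cup \<beta> p q X a b')"
    unfolding e(2) cup_add_left by (intro cohom_class_absorb cup_coboundaries_left e(1))
  also have "\<dots> = cohom_class (p + q) X (cochain_cup \<beta> p q X a b)"
    unfolding f(2) cup_add_right by (intro cohom_class_absorb cup_coboundaries_right a f(1))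
  finally show "cohom_class (p + q) X (cochain_cup \<beta> p q X a' b') = cohom_class (p + q) X (cochain_cup \<beta> p q X a b)" .
qed

end

section \<open>Evaluation of cohomology classes on homology classes\<close>

lemma cochain_eval_coboundaries:
  assumes e: "e \<in> coboundaries (int n) X" and z: "singular_relcycle n X {} z"
  shows "cochain_eval e z = 0"
proof (cases n)
  case 0
  then show ?thesis using e by (auto simp: coboundaries_def coboundary_neg)
next
  case (Suc k)
  obtain c where "e = coboundary (int k) X c"
    using e by (auto simp: coboundaries_def Suc)
  then show ?thesis
    using z stokes[of k X z c] by (simp add: Suc singular_cycle additive.zero[OF additive_cochain_eval])
qed

text \<open>Coboundaries vanish on cycles, and by \<open>stokes\<close> cocycles take equal values
  on homologous cycles; so the \<open>THE\<close> has a single candidate.\<close>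

lemma cohom_eval_class:
  assumes c: "c \<in> cocycles (int n) X" and z: "singular_relcycle n X {} z"
  shows "cohom_eval (cohom_class (int n) X c) (homologous_rel_set n X {} z) = cochain_eval c z"
  unfolding cohom_eval_def
proof (rule the_equality)
  show "\<exists>c'\<in>cohom_class (int n) X c. \<exists>z'\<in>homologous_rel_set n X {} z. cochain_eval c z = cochain_eval c' z'"
    using cohom_class_self by force
next
  fix t assume "\<exists>c'\<in>cohom_class (int n) X c. \<exists>z'\<in>homologous_rel_set n X {} z. t = cochain_eval c' z'"
  then obtain e z' where e: "e \<in> coboundaries (int n) X"
    and zz: "homologous_rel n X {} z z'" and t: "t = cochain_eval (\<lambda>s. e s + c s) z'"
    by (auto simp: mem_cohom_class)
  have z': "singular_relcycle n X {} z'"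
    using homologous_rel_singular_relcycle[OF zz] z by simp
  obtain w where w: "singular_chain (Suc n) X w" "chain_boundary (Suc n) w = z - z'"
    using zz unfolding homologous_rel_def singular_boundary by blast
  have "cochain_eval c z - cochain_eval c z' = cochain_eval (coboundary (int n) X c) w"
    using stokes[OF w(1), of c] by (simp add: w(2) additive.diff[OF additive_cochain_eval])
  also have "\<dots> = 0" using c by (simp add: cocycles_iff)
  finally show "t = cochain_eval c z"
    using cochain_eval_coboundaries[OF e z'] by (simp add: t cochain_eval_add)
qed

section \<open>Free cohomology groups and the pairing\<close>

lemma (in comm_group) subgroup_torsion: "subgroup (torsion G) G"
proof (rule subgroup.intro)
  show "torsion G \<subseteq> carrier G" by (auto simp: torsion_def)
  show "\<one> \<in> torsion G" by (auto simp: torsion_def intro: exI[of _ 1])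
next
  fix x y assume "x \<in> torsion G" "y \<in> torsion G"
  then obtain m n :: nat where x: "x \<in> carrier G" "m > 0" "x [^] m = \<one>"
    and y: "y \<in> carrier G" "n > 0" "y [^] n = \<one>" by (auto simp: torsion_def)
  have "(x \<otimes> y) [^] (m * n) = x [^] (m * n) \<otimes> y [^] (n * m)"
    using x y by (simp add: nat_pow_distrib mult.commute)
  also have "\<dots> = \<one>" using x y by (simp add: nat_pow_pow[symmetric])
  finally show "x \<otimes> y \<in> torsion G" using x y by (auto simp: torsion_def intro: exI[of _ "m * n"])
next
  fix x assume "x \<in> torsion G"
  then show "inv x \<in> torsion G" by (auto simp: torsion_def nat_pow_inv)
qed

lemma additive_real_of_int: "Modules.additive real_of_int"
  by unfold_locales simp

lemma int_lattice_eq: "int_lattice p X = (\<lambda>n. cohom_class p X (real_of_int \<circ> n)) ` cocycles p X"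
  by (simp add: int_lattice_def carrier_cohomology_group image_image cohom_coeff_class[OF additive_real_of_int])

lemma subgroup_int_lattice: "subgroup (int_lattice p X) (cohomology_group p X)"
proof -
  let ?H = "cohomology_group p X :: ('a, real) cohom_class monoid"
  let ?I = "cohomology_group p X :: ('a, int) cohom_class monoid"
  have "cohom_coeff real_of_int p X \<in> hom ?I ?H"
  proof (rule homI)
    fix \<alpha> \<alpha>' assume "\<alpha> \<in> carrier ?I" "\<alpha>' \<in> carrier ?I"
    then obtain a a' where a: "a \<in> cocycles p X" "a' \<in> cocycles p X"
      and \<alpha>: "\<alpha> = cohom_class p X a" "\<alpha>' = cohom_class p X a'"
      by (auto simp: carrier_cohomology_group)
    note R = additive_cocycles[OF additive_real_of_int]
    show "cohom_coeff real_of_int p X \<alpha> \<in> carrier ?H"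
      using R[OF a(1)] by (simp add: \<alpha> cohom_coeff_class[OF additive_real_of_int] cohom_class_in)
    have "cohom_coeff real_of_int p X (\<alpha> \<otimes>\<^bsub>?I\<^esub> \<alpha>') = cohom_class p X (\<lambda>s. (real_of_int \<circ> a) s + (real_of_int \<circ> a') s)"
      by (simp add: \<alpha> cohom_class_mult[OF a] cohom_coeff_class[OF additive_real_of_int] comp_def)
    also have "\<dots> = cohom_coeff real_of_int p X \<alpha> \<otimes>\<^bsub>?H\<^esub> cohom_coeff real_of_int p X \<alpha>'"
      unfolding \<alpha> cohom_coeff_class[OF additive_real_of_int]
      by (rule cohom_class_mult[symmetric, OF R[OF a(1)] R[OF a(2)]])
    finally show "cohom_coeff real_of_int p X (\<alpha> \<otimes>\<^bsub>?I\<^esub> \<alpha>') =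
        cohom_coeff real_of_int p X \<alpha> \<otimes>\<^bsub>?H\<^esub> cohom_coeff real_of_int p X \<alpha>'" .
  qed
  then interpret group_hom ?I ?H "cohom_coeff real_of_int p X"
    by (simp add: group_hom_def group_hom_axioms_def group_cohomology_group)
  show ?thesis unfolding int_lattice_def by (rule img_is_subgroup)
qed

text \<open>Together with \<open>free_class\<close>, a cochain-level name for the elements of the
  quotient groups, so that the pairing can be computed on cocycles.\<close>

definition flat_class :: "int \<Rightarrow> 'a topology \<Rightarrow> ('a, real) cochain \<Rightarrow> 'a real_class set" where
  "flat_class p X a = int_lattice p X #>\<^bsub>cohomology_group p X\<^esub> cohom_class p X a"

definition free_class :: "int \<Rightarrow> 'a topology \<Rightarrow> ('a, int) cochain \<Rightarrow> 'a int_class set" where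
  "free_class p X b = torsion (cohomology_group p X) #>\<^bsub>cohomology_group p X\<^esub> cohom_class p X b"

lemma normal_int_lattice: "int_lattice p X \<lhd> cohomology_group p X"
  by (rule comm_group.subgroup_imp_normal[OF comm_group_cohomology_group subgroup_int_lattice])

lemma normal_torsion: "torsion (cohomology_group p X) \<lhd> cohomology_group p X"
  by (rule comm_group.subgroup_imp_normal[OF comm_group_cohomology_group
        comm_group.subgroup_torsion[OF comm_group_cohomology_group]])

lemma comm_group_H_flat: "comm_group (H_flat p X)"
  unfolding H_flat_def
  by (rule comm_group.abelian_FactGroup[OF comm_group_cohomology_group subgroup_int_lattice])

lemma comm_group_H_free: "comm_group (H_free p X)"
  unfolding H_free_def
  by (rule comm_group.abelian_FactGroup[OF comm_group_cohomology_group
        comm_group.subgroup_torsion[OF comm_group_cohomology_group]])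

lemma carrier_H_flat: "carrier (H_flat p X) = flat_class p X ` cocycles p X"
  by (simp add: H_flat_def carrier_FactGroup carrier_cohomology_group image_image flat_class_def)

lemma carrier_H_free: "carrier (H_free p X) = free_class p X ` cocycles p X"
  by (simp add: H_free_def carrier_FactGroup carrier_cohomology_group image_image free_class_def)

lemma flat_class_mult:
  assumes "a \<in> cocycles p X" "b \<in> cocycles p X"
  shows "flat_class p X a \<otimes>\<^bsub>H_flat p X\<^esub> flat_class p X b = flat_class p X (\<lambda>s. a s + b s)"
  using normal.rcos_sum[OF normal_int_lattice cohom_class_in[OF assms(1)] cohom_class_in[OF assms(2)]]
  by (simp add: H_flat_def flat_class_def cohom_class_mult assms)

lemma free_class_mult:
  assumes "a \<in> cocycles p X" "b \<in> cocycles p X"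
  shows "free_class p X a \<otimes>\<^bsub>H_free p X\<^esub> free_class p X b = free_class p X (\<lambda>s. a s + b s)"
  using normal.rcos_sum[OF normal_torsion cohom_class_in[OF assms(1)] cohom_class_in[OF assms(2)]]
  by (simp add: H_free_def free_class_def cohom_class_mult assms)

lemma mem_flat_class:
  assumes "a \<in> cocycles p X"
  shows "\<alpha> \<in> flat_class p X a \<longleftrightarrow> (\<exists>n \<in> cocycles p X. \<alpha> = cohom_class p X (\<lambda>s. real_of_int (n s) + a s))"
  using cohom_class_mult[OF additive_cocycles[OF additive_real_of_int] assms]
  by (auto simp: flat_class_def r_coset_def int_lattice_eq)

lemma flat_class_absorb:
  assumes a: "a \<in> cocycles p X" and n: "n \<in> cocycles p X"
  shows "flat_class p X (\<lambda>s. real_of_int (n s) + a s) = flat_class p X a"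
proof -
  have na: "(\<lambda>s. real_of_int (n s) + a s) \<in> cocycles p X"
    using cocycles_add[OF additive_cocycles[OF additive_real_of_int n] a] by simp
  show ?thesis
  proof (intro equalityI subsetI)
    fix \<alpha> assume "\<alpha> \<in> flat_class p X (\<lambda>s. real_of_int (n s) + a s)"
    then obtain k where k: "k \<in> cocycles p X" "\<alpha> = cohom_class p X (\<lambda>s. real_of_int (k s) + (real_of_int (n s) + a s))"
      by (auto simp: mem_flat_class[OF na])
    then show "\<alpha> \<in> flat_class p X a"
      unfolding mem_flat_class[OF a]
      by (intro bexI[OF _ cocycles_add[OF k(1) n]]) (simp add: add.assoc)
  next
    fix \<alpha> assume "\<alpha> \<in> flat_class p X a"
    then obtain k where k: "k \<in> cocycles p X" "\<alpha> = cohom_class p X (\<lambda>s. real_of_int (k s) + a s)"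
      by (auto simp: mem_flat_class[OF a])
    then show "\<alpha> \<in> flat_class p X (\<lambda>s. real_of_int (n s) + a s)"
      unfolding mem_flat_class[OF na]
      by (intro bexI[OF _ cocycles_add[OF k(1) cocycles_minus[OF n]]]) simp
  qed
qed

lemma flat_class_self: "a \<in> cocycles p X \<Longrightarrow> cohom_class p X a \<in> flat_class p X a"
  unfolding mem_flat_class by (rule bexI[OF _ cocycles_zero]) simp

text \<open>Pulling back an integer-valued cocycle gives an integer-valued one, so the lattice is
  respected.\<close>

lemma H_flat_pullback_class:
  assumes f: "continuous_map Y X f" and a: "a \<in> cocycles p X"
  shows "H_flat_pullback p Y f (flat_class p X a) = flat_class p Y (cochain_pullback p Y f a)"
  unfolding H_flat_pullback_def flat_class_def[of p Y, symmetric]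
proof -
  have "int_lattice p Y #>\<^bsub>cohomology_group p Y\<^esub> cohom_pullback p Y f \<alpha> = flat_class p Y (cochain_pullback p Y f a)"
    if \<alpha>: "\<alpha> \<in> flat_class p X a" for \<alpha>
  proof -
    obtain n where n: "n \<in> cocycles p X" "\<alpha> = cohom_class p X (\<lambda>s. real_of_int (n s) + a s)"
      using \<alpha> by (auto simp: mem_flat_class[OF a])
    have "cochain_pullback p Y f (\<lambda>s. real_of_int (n s) + a s)
        = (\<lambda>s. real_of_int (cochain_pullback p Y f n s) + cochain_pullback p Y f a s)"
      using cochain_pullback_additive[OF additive_real_of_int, of p Y f n]
      by (simp add: cochain_pullback_add comp_def)
    then show ?thesis
      using flat_class_absorb[OF cochain_pullback_cocycles[OF f a] cochain_pullback_cocycles[OF f n(1)]]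
      by (simp add: n(2) cohom_pullback_class[OF f] flat_class_def)
  qed
  then show "(\<Union>\<alpha>\<in>flat_class p X a. int_lattice p Y #>\<^bsub>cohomology_group p Y\<^esub> cohom_pullback p Y f \<alpha>)
      = flat_class p Y (cochain_pullback p Y f a)"
    by (rule UN_const[OF flat_class_self[OF a]])
qed

text \<open>The lattice is represented by integer-valued cocycles, and these vanish in the
  circle.\<close>

lemma flat_to_circle_class:
  assumes a: "a \<in> cocycles p X"
  shows "flat_to_circle p X (flat_class p X a) = cohom_class p X (to_circle \<circ> a)"
  unfolding flat_to_circle_def
proof (rule UN_const[OF flat_class_self[OF a]])
  fix \<alpha> assume "\<alpha> \<in> flat_class p X a"
  then obtain n where n: "n \<in> cocycles p X" "\<alpha> = cohom_class p X (\<lambda>s. real_of_int (n s) + a s)"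
    by (auto simp: mem_flat_class[OF a])
  have "to_circle \<circ> (\<lambda>s. real_of_int (n s) + a s) = to_circle \<circ> a"
    by (simp add: comp_def additive.add[OF additive_to_circle] to_circle_of_int)
  then show "cohom_coeff to_circle p X \<alpha> = cohom_class p X (to_circle \<circ> a)"
    by (simp add: n(2) cohom_coeff_class[OF additive_to_circle])
qed

lemma cohom_class_pow:
  assumes a: "a \<in> cocycles p X"
  shows "cohom_class p X a [^]\<^bsub>cohomology_group p X\<^esub> (k::nat) = cohom_class p X (\<lambda>s. int k * a s)"
    and "(\<lambda>s. int k * a s) \<in> cocycles p X"
proof -
  show 2: "(\<lambda>s. int k * a s) \<in> cocycles p X" for k :: nat
    using additive_cocycles[of "\<lambda>x. int k * x", OF _ a] by (simp add: comp_def Modules.additive_def distrib_left)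
  show "cohom_class p X a [^]\<^bsub>cohomology_group p X\<^esub> k = cohom_class p X (\<lambda>s. int k * a s)"
  proof (induction k)
    case 0
    then show ?case by (simp add: nat_pow_def cohom_class_one)
  next
    case (Suc k)
    then show ?case by (simp add: nat_pow_def cohom_class_mult[OF 2 a] distrib_right add.commute)
  qed
qed

text \<open>Two lifts of a free class differ by a torsion class, which on cochains is a cocycle with
  a positive multiple that is a coboundary.\<close>

lemma mem_free_class:
  assumes b: "b \<in> cocycles p X" and y: "y \<in> free_class p X b"
  obtains c k where "c \<in> cocycles p X" "(k::nat) > 0" "(\<lambda>s. int k * c s) \<in> coboundaries p X"
    "y = cohom_class p X (\<lambda>s. c s + b s)"
proof -
  obtain \<tau> where \<tau>: "\<tau> \<in> torsion (cohomology_group p X)" "y = \<tau> \<otimes>\<^bsub>cohomology_group p X\<^esub> cohom_class p X b"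
    using y by (auto simp: free_class_def r_coset_def)
  then obtain c and k :: nat where c: "c \<in> cocycles p X" "\<tau> = cohom_class p X c" and k: "k > 0"
    "cohom_class p X c [^]\<^bsub>cohomology_group p X\<^esub> k = \<one>\<^bsub>cohomology_group p X\<^esub>"
    by (auto simp: torsion_def carrier_cohomology_group)
  have "(\<lambda>s. int k * c s) \<in> cohom_class p X (\<lambda>_. 0)"
    using k(2) cohom_class_self[of "\<lambda>s. int k * c s" p X] by (simp add: cohom_class_pow[OF c(1)] cohom_class_one)
  then have "(\<lambda>s. int k * c s) \<in> coboundaries p X" by (auto simp: mem_cohom_class)
  then show thesis
    using that[OF c(1) k(1)] by (simp add: \<tau>(2) c cohom_class_mult b)
qed

interpretation circle_cup: biadditive "\<lambda>t n. int_scale n t"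
  by unfold_locales (simp_all add: int_scale_add int_scale_add_right)

interpretation real_cup: biadditive "\<lambda>(x::real) n. of_int n * x"
  by unfold_locales (simp_all add: algebra_simps)

text \<open>If \<open>k c\<close> is a coboundary then so is \<open>a \<smile> c = a/k \<smile> k c\<close>, over the reals.\<close>

lemma circle_cup_torsion:
  assumes a: "a \<in> cocycles p X" and k: "(k::nat) > 0" and c: "(\<lambda>s. int k * c s) \<in> coboundaries q X"
  shows "cochain_cup (\<lambda>t n. int_scale n t) p q X (to_circle \<circ> a) c \<in> coboundaries (p + q) X"
proof -
  have "(\<lambda>s. a s / k) \<in> cocycles p X"
    using additive_cocycles[of "\<lambda>x. x / k", OF _ a] by (simp add: comp_def Modules.additive_def add_divide_distrib)
  then have "cochain_cup (\<lambda>x n. of_int n * x) p q X (\<lambda>s. a s / k) (\<lambda>s. int k * c s) \<in> coboundaries (p + q) X"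
    using c by (rule real_cup.cup_coboundaries_right)
  from additive_coboundaries[OF additive_to_circle this] show ?thesis
    by (rule back_subst[of "\<lambda>x. x \<in> _"])
      (use k in \<open>auto simp: fun_eq_iff cochain_cup_def int_scale_to_circle additive.zero[OF additive_to_circle]\<close>)
qed

text \<open>A fixed cycle in the fundamental class, which turns the pairing into a biadditive
  function of cochains.\<close>

definition fundamental_cycle :: "('a, 'n::{finite,linorder}) spacetime_data \<Rightarrow> 'a set \<Rightarrow> 'a chain" where
  "fundamental_cycle M S = (let n = CARD('n) - 1; Y = subtopology (pts M) S in
    SOME z. singular_relcycle n Y {} z \<and> fundamental_class M S = homologous_rel_set n Y {} z)"

text \<open>In either branch of its definition \<open>fundamental_class\<close> is an element of the
  homology group, hence the class of a cycle.\<close>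

lemma fundamental_cycle:
  fixes M :: "('a, 'n::{finite,linorder}) spacetime_data" and S :: "'a set"
  defines "n \<equiv> CARD('n) - 1" and "Y \<equiv> subtopology (pts M) S"
  shows "singular_relcycle n Y {} (fundamental_cycle M S)"
    "fundamental_class M S = homologous_rel_set n Y {} (fundamental_cycle M S)"
proof -
  have "fundamental_class M S \<in> carrier (homology_group (int n) Y)"
  proof (cases "\<exists>h. is_fundamental_class M S h")
    case True
    then have "is_fundamental_class M S (fundamental_class M S)"
      unfolding fundamental_class_def by (simp add: someI_ex)
    then show ?thesis by (simp add: is_fundamental_class_def Let_def n_def Y_def)
  next
    case False
    then show ?thesis
      unfolding fundamental_class_def n_def Y_def
      by (simp only: if_False) (rule monoid.one_closed[OF group.is_monoid], simp)
  qed
  then have "\<exists>z. singular_relcycle n Y {} z \<and> fundamental_class M S = homologous_rel_set n Y {} z"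
    unfolding carrier_relative_homology_group by blast
  from someI_ex[OF this] show "singular_relcycle n Y {} (fundamental_cycle M S)"
    "fundamental_class M S = homologous_rel_set n Y {} (fundamental_cycle M S)"
    unfolding fundamental_cycle_def n_def Y_def Let_def by blast+
qed

definition cochain_pairing ::
  "('a, 'n::{finite,linorder}) spacetime_data \<Rightarrow> 'a set \<Rightarrow> int \<Rightarrow> int \<Rightarrow> ('a, real) cochain \<Rightarrow> ('a, int) cochain \<Rightarrow> circle"
  where "cochain_pairing M S p q a b = (let Y = subtopology (pts M) S in
    cochain_eval (cochain_cup (\<lambda>t n. int_scale n t) p q Y
      (to_circle \<circ> cochain_pullback p Y id a) (cochain_pullback q Y id b)) (fundamental_cycle M S))"

text \<open>The lift y picked by \<open>SOME\<close> differs from b by a torsion cocycle. Its cup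
  product with a circle class that comes from a real one is a coboundary, so it contributes
  0.\<close>

lemma pairing_class:
  fixes M :: "('a, 'n::{finite,linorder}) spacetime_data"
  assumes pq: "p + q = int CARD('n) - 1"
    and a: "a \<in> cocycles p (pts M)" and b: "b \<in> cocycles q (pts M)"
  shows "pairing M S p q (flat_class p (pts M) a) (free_class q (pts M) b) = cochain_pairing M S p q a b"
proof -
  let ?Y = "subtopology (pts M) S" and ?n = "CARD('n) - 1" and ?X = "pts M"
  let ?r = "cochain_pullback p ?Y id" and ?r' = "cochain_pullback q ?Y id"
  have pq': "p + q = int ?n" using pq by (simp add: of_nat_diff Suc_leI)
  have id: "continuous_map ?Y ?X id"
    by (simp add: continuous_map_from_subtopology)
  define y where "y = (SOME y. y \<in> free_class q ?X b)"
  have "cohom_class q ?X b \<in> free_class q ?X b"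
    unfolding free_class_def
    by (rule group.rcos_self[OF group_cohomology_group cohom_class_in[OF b]
          comm_group.subgroup_torsion[OF comm_group_cohomology_group]])
  then have "y \<in> free_class q ?X b" unfolding y_def by (rule someI)
  then obtain c k where c: "c \<in> cocycles q ?X" "(k::nat) > 0" "(\<lambda>s. int k * c s) \<in> coboundaries q ?X"
    "y = cohom_class q ?X (\<lambda>s. c s + b s)"
    by (rule mem_free_class[OF b])
  have ra: "?r a \<in> cocycles p ?Y" and rb: "?r' b \<in> cocycles q ?Y" and rc: "?r' c \<in> cocycles q ?Y"
    using cochain_pullback_cocycles[OF id] a b c(1) by blast+
  have ta: "to_circle \<circ> ?r a \<in> cocycles p ?Y" by (rule additive_cocycles[OF additive_to_circle ra])
  have rcb: "?r' (\<lambda>s. c s + b s) = (\<lambda>s. ?r' c s + ?r' b s)" by (rule cochain_pullback_add)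
  have cyc: "?r' (\<lambda>s. c s + b s) \<in> cocycles q ?Y" unfolding rcb by (rule cocycles_add[OF rc rb])
  \<comment> \<open>Restriction to S commutes with multiples and coboundaries, so the restricted
    cocycle again represents a torsion class.\<close>
  have "(\<lambda>s. int k * ?r' c s) \<in> coboundaries q ?Y"
    using cochain_pullback_coboundaries[OF id c(3)]
      cochain_pullback_additive[of "\<lambda>x. int k * x" q ?Y id c]
    by (simp add: comp_def Modules.additive_def distrib_left)
  then have tors: "cochain_cup (\<lambda>t n. int_scale n t) p q ?Y (to_circle \<circ> ?r a) (?r' c) \<in> coboundaries (int ?n) ?Y"
    using circle_cup_torsion[OF ra c(2)] pq' by metis
  have "pairing M S p q (flat_class p ?X a) (free_class q ?X b) =
      cohom_eval (cup (\<lambda>t n. int_scale n t) p q ?Y (cohom_class p ?Y (to_circle \<circ> ?r a))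
        (cohom_class q ?Y (?r' (\<lambda>s. c s + b s)))) (fundamental_class M S)"
    unfolding pairing_def Let_def y_def[symmetric] c(4) H_flat_pullback_class[OF id a]
      flat_to_circle_class[OF ra] cohom_pullback_class[OF id] ..
  also have "\<dots> = cohom_eval (cohom_class (int ?n) ?Y
      (cochain_cup (\<lambda>t n. int_scale n t) p q ?Y (to_circle \<circ> ?r a) (?r' (\<lambda>s. c s + b s)))) (fundamental_class M S)"
    unfolding circle_cup.cup_class[OF ta cyc] pq' ..
  also have "\<dots> = cochain_eval (cochain_cup (\<lambda>t n. int_scale n t) p q ?Y (to_circle \<circ> ?r a) (?r' (\<lambda>s. c s + b s)))
      (fundamental_cycle M S)"
    using circle_cup.cup_cocycles[OF ta cyc]
    by (subst fundamental_cycle(2)) (intro cohom_eval_class fundamental_cycle(1); simp add: pq')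
  also have "\<dots> = cochain_pairing M S p q a b"
    using cochain_eval_coboundaries[OF tors fundamental_cycle(1)]
    by (simp add: cochain_pairing_def Let_def rcb circle_cup.cup_add_right cochain_eval_add)
  finally show ?thesis .
qed

lemma cochain_pairing_add:
  "cochain_pairing M S p q (\<lambda>s. a s + a' s) b = cochain_pairing M S p q a b + cochain_pairing M S p q a' b"
  "cochain_pairing M S p q a (\<lambda>s. b s + b' s) = cochain_pairing M S p q a b + cochain_pairing M S p q a b'"
proof -
  have "to_circle \<circ> (\<lambda>s. c s + d s) = (\<lambda>s. (to_circle \<circ> c) s + (to_circle \<circ> d) s)" for c d :: "('a, real) cochain"
    by (simp add: fun_eq_iff additive.add[OF additive_to_circle])
  then show "cochain_pairing M S p q (\<lambda>s. a s + a' s) b = cochain_pairing M S p q a b + cochain_pairing M S p q a' b"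
    unfolding cochain_pairing_def Let_def cochain_pullback_add
    by (simp only: circle_cup.cup_add_left cochain_eval_add)
  show "cochain_pairing M S p q a (\<lambda>s. b s + b' s) = cochain_pairing M S p q a b + cochain_pairing M S p q a b'"
    unfolding cochain_pairing_def Let_def cochain_pullback_add
    by (simp only: circle_cup.cup_add_right cochain_eval_add)
qed

lemma pairing_mult:
  fixes M :: "('a, 'n::{finite,linorder}) spacetime_data"
  assumes pq: "p + q = int CARD('n) - 1"
  shows "\<lbrakk>v \<in> carrier (H_flat p (pts M)); v' \<in> carrier (H_flat p (pts M)); w \<in> carrier (H_free q (pts M))\<rbrakk> \<Longrightarrow>
      pairing M S p q (v \<otimes>\<^bsub>H_flat p (pts M)\<^esub> v') w = pairing M S p q v w + pairing M S p q v' w"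
    and "\<lbrakk>v \<in> carrier (H_flat p (pts M)); w \<in> carrier (H_free q (pts M)); w' \<in> carrier (H_free q (pts M))\<rbrakk> \<Longrightarrow>
      pairing M S p q v (w \<otimes>\<^bsub>H_free q (pts M)\<^esub> w') = pairing M S p q v w + pairing M S p q v w'"
  by (auto simp: carrier_H_flat carrier_H_free flat_class_mult free_class_mult pairing_class[OF pq]
      cocycles_add cochain_pairing_add)

section \<open>The state and the duality\<close>

lemma comm_group_DirProd:
  assumes "comm_group G" "comm_group H"
  shows "comm_group (G \<times>\<times> H)"
proof -
  interpret G: comm_group G by (rule assms)
  interpret H: comm_group H by (rule assms)
  interpret GH: group "G \<times>\<times> H" by (rule DirProd_group[OF G.group_axioms H.group_axioms])
  show ?thesis by (rule GH.group_comm_groupI) (auto simp: G.m_comm H.m_comm)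
qed

lemma minus_one_power_cases: "(- 1 :: int) ^ n = 1 \<or> (- 1 :: int) ^ n = - 1"
  by (cases "even n") auto

text \<open>Signs appear as integer powers of group elements. The exponents are 1 or -1, so the
  values at the identity and at inverses, which follow from additivity, are enough.\<close>

lemma pairing_sign:
  fixes M :: "('a, 'n::{finite,linorder}) spacetime_data"
  assumes pq: "p + q = int CARD('n) - 1"
    and v: "v \<in> carrier (H_flat p (pts M))" and w: "w \<in> carrier (H_free q (pts M))"
  shows "pairing M S p q v \<one>\<^bsub>H_free q (pts M)\<^esub> = 0"
    and "e = 1 \<or> e = - 1 \<Longrightarrow> pairing M S p q (v [^]\<^bsub>H_flat p (pts M)\<^esub> (e::int)) w = int_scale e (pairing M S p q v w)"
    and "e = 1 \<or> e = - 1 \<Longrightarrow> pairing M S p q v (w [^]\<^bsub>H_free q (pts M)\<^esub> (e::int)) = int_scale e (pairing M S p q v w)"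
proof -
  let ?F = "H_flat p (pts M)" and ?Z = "H_free q (pts M)"
  interpret F: comm_group ?F by (rule comm_group_H_flat)
  interpret Z: comm_group ?Z by (rule comm_group_H_free)
  note mult = pairing_mult[OF pq, where S = S]
  show one: "pairing M S p q v \<one>\<^bsub>?Z\<^esub> = 0"
    using mult(2)[OF v Z.one_closed Z.one_closed] by simp
  have one': "pairing M S p q \<one>\<^bsub>?F\<^esub> w = 0"
    using mult(1)[OF F.one_closed F.one_closed w] by simp
  have "pairing M S p q (inv\<^bsub>?F\<^esub> v) w = - pairing M S p q v w"
    using mult(1)[OF F.inv_closed[OF v] v w] v one' by (simp add: eq_neg_iff_add_eq_0)
  then show "e = 1 \<or> e = - 1 \<Longrightarrow> pairing M S p q (v [^]\<^bsub>?F\<^esub> e) w = int_scale e (pairing M S p q v w)"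
    using v by (auto simp: F.int_pow_neg)
  have "pairing M S p q v (inv\<^bsub>?Z\<^esub> w) = - pairing M S p q v w"
    using mult(2)[OF v Z.inv_closed[OF w] w] w one by (simp add: eq_neg_iff_add_eq_0)
  then show "e = 1 \<or> e = - 1 \<Longrightarrow> pairing M S p q v (w [^]\<^bsub>?Z\<^esub> e) = int_scale e (pairing M S p q v w)"
    using w by (auto simp: Z.int_pow_neg)
qed

lemma comm_group_Top_free: "comm_group (Top_free M k)"
  unfolding Top_free_def Let_def
  by (intro comm_group_DirProd comm_group_H_flat comm_group_H_free)

lemma Top_free_simps:
  fixes M :: "('a, 'n::{finite,linorder}) spacetime_data"
  shows "(u, ut, z, zt) \<in> carrier (Top_free M k) \<longleftrightarrow>
      u \<in> carrier (H_flat (int k - 1) (pts M)) \<and> ut \<in> carrier (H_flat (int CARD('n) - int k - 1) (pts M)) \<and>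
      z \<in> carrier (H_free (int k) (pts M)) \<and> zt \<in> carrier (H_free (int CARD('n) - int k) (pts M))"
    and "(u, ut, z, zt) \<otimes>\<^bsub>Top_free M k\<^esub> (u', ut', z', zt') =
      (u \<otimes>\<^bsub>H_flat (int k - 1) (pts M)\<^esub> u', ut \<otimes>\<^bsub>H_flat (int CARD('n) - int k - 1) (pts M)\<^esub> ut',
       z \<otimes>\<^bsub>H_free (int k) (pts M)\<^esub> z', zt \<otimes>\<^bsub>H_free (int CARD('n) - int k) (pts M)\<^esub> zt')"
    and "\<one>\<^bsub>Top_free M k\<^esub> = (\<one>\<^bsub>H_flat (int k - 1) (pts M)\<^esub>, \<one>\<^bsub>H_flat (int CARD('n) - int k - 1) (pts M)\<^esub>,
       \<one>\<^bsub>H_free (int k) (pts M)\<^esub>, \<one>\<^bsub>H_free (int CARD('n) - int k) (pts M)\<^esub>)"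
  by (simp_all add: Top_free_def Let_def)

lemma weyl_data_Top_free:
  fixes M :: "('a, 'n::{finite,linorder}) spacetime_data"
  shows "weyl_data (Top_free M k) (sigma_free M S k)"
proof -
  \<comment> \<open>In each pairing the degrees add up to m - 1, the dimension of the Cauchy
    surface.\<close>
  have deg: "(int CARD('n) - int k - 1) + int k = int CARD('n) - 1"
    "(int k - 1) + (int CARD('n) - int k) = int CARD('n) - 1" by simp_all
  note mult = pairing_mult[OF deg(1), of _ M _ _ S] pairing_mult[OF deg(2), of _ M _ _ S]
  show ?thesis
  proof (intro weyl_data.intro comm_group_Top_free weyl_data_axioms.intro)
    fix x y z assume xyz: "x \<in> carrier (Top_free M k)" "y \<in> carrier (Top_free M k)" "z \<in> carrier (Top_free M k)"
    obtain a b c d a' b' c' d' a'' b'' c'' d'' where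
      eq: "x = (a, b, c, d)" "y = (a', b', c', d')" "z = (a'', b'', c'', d'')"
      by (metis prod.exhaust)
    note mem = xyz[unfolded eq Top_free_simps(1)]
    show "sigma_free M S k (x \<otimes>\<^bsub>Top_free M k\<^esub> y) z = sigma_free M S k x z + sigma_free M S k y z"
      using mem unfolding eq Top_free_simps
      by (simp add: sigma_free_def Let_def mult int_scale_add_right)
    show "sigma_free M S k z (x \<otimes>\<^bsub>Top_free M k\<^esub> y) = sigma_free M S k z x + sigma_free M S k z y"
      using mem unfolding eq Top_free_simps
      by (simp add: sigma_free_def Let_def mult int_scale_add_right)
  next
    \<comment> \<open>With equal arguments the first term cancels the third and the second cancels
      the fourth.\<close>
    fix x show "sigma_free M S k x x = 0"
      by (cases x) (simp add: sigma_free_def Let_def)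
  qed
qed

definition flat_subgroup :: "('a, 'n::{finite,linorder}) spacetime_data \<Rightarrow> nat \<Rightarrow> 'a top_elem set" where
  "flat_subgroup M k = {x \<in> carrier (Top_free M k).
    fst (snd (snd x)) = \<one>\<^bsub>H_free (int k) (pts M)\<^esub> \<and>
    snd (snd (snd x)) = \<one>\<^bsub>H_free (int CARD('n) - int k) (pts M)\<^esub>}"

text \<open>The subgroup is the kernel of the projection to the free classes, and on it each of the
  four terms of the form contains a trivial free class.\<close>

lemma weyl_isotropic_flat_subgroup:
  fixes M :: "('a, 'n::{finite,linorder}) spacetime_data"
  shows "weyl_isotropic (Top_free M k) (sigma_free M S k) (flat_subgroup M k)"
proof (intro weyl_isotropic.intro weyl_data_Top_free weyl_isotropic_axioms.intro)
  have deg: "(int CARD('n) - int k - 1) + int k = int CARD('n) - 1"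
    "(int k - 1) + (int CARD('n) - int k) = int CARD('n) - 1" by simp_all
  interpret T: comm_group "Top_free M k" by (rule comm_group_Top_free)
  interpret Z: comm_group "H_free (int k) (pts M)" by (rule comm_group_H_free)
  interpret Zt: comm_group "H_free (int CARD('n) - int k) (pts M)" by (rule comm_group_H_free)
  let ?f = "\<lambda>x :: 'a top_elem. snd (snd x)"
  let ?H = "H_free (int k) (pts M) \<times>\<times> H_free (int CARD('n) - int k) (pts M)"
  have "group_hom (Top_free M k) ?H ?f"
    by (auto simp: group_hom_def group_hom_axioms_def hom_def Top_free_def Let_def mult_DirProd'
        T.group_axioms[unfolded Top_free_def Let_def] intro: DirProd_group Z.group_axioms Zt.group_axioms)
  then have "subgroup (kernel (Top_free M k) ?H ?f) (Top_free M k)"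
    by (rule group_hom.subgroup_kernel)
  moreover have "kernel (Top_free M k) ?H ?f = flat_subgroup M k"
    by (auto simp: kernel_def flat_subgroup_def prod_eq_iff)
  ultimately show "subgroup (flat_subgroup M k) (Top_free M k)" by simp
  fix x y assume "x \<in> flat_subgroup M k" "y \<in> flat_subgroup M k"
  then show "sigma_free M S k x y = 0"
    by (cases x; cases y)
      (auto simp: flat_subgroup_def Top_free_simps(1) sigma_free_def Let_def
        pairing_sign(1)[OF deg(1) _ Z.one_closed] pairing_sign(1)[OF deg(2) _ Zt.one_closed])
qed

lemma zeta_free_iso:
  fixes M :: "('a, 'n::{finite,linorder}) spacetime_data"
  assumes k: "k \<le> CARD('n)"
  shows "zeta_free M k \<in> iso (Top_free M k) (Top_free M (CARD('n) - k))"
proof -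
  let ?m = "CARD('n)"
  let ?e = "(- 1) ^ (k * (?m - k) + 1) :: int"
  let ?U = "H_flat (int k - 1) (pts M)" and ?Z = "H_free (int k) (pts M)"
  \<comment> \<open>Degrees are integers while m - k is a truncated difference; k \<le> m reconciles
    them. The last two equations treat the expressions left after rewriting by the third.\<close>
  have deg: "int (?m - k) - 1 = int ?m - int k - 1" "int ?m - int (?m - k) - 1 = int k - 1"
    "int (?m - k) = int ?m - int k" "int ?m - int (?m - k) = int k"
    "int ?m - (int ?m - int k) - 1 = int k - 1" "int ?m - (int ?m - int k) = int k"
    using k by (simp_all add: of_nat_diff)
  interpret U: comm_group ?U by (rule comm_group_H_flat)
  interpret Z: comm_group ?Z by (rule comm_group_H_free)
  have e: "?e * ?e = 1" using minus_one_power_cases[of "k * (?m - k) + 1"] by auto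
  have z: "zeta_free M k (u, ut, z, zt) = (ut, u [^]\<^bsub>?U\<^esub> ?e, zt, z [^]\<^bsub>?Z\<^esub> ?e)" for u ut z zt
    by (simp add: zeta_free_def Let_def)
  have mem: "(ut, u, zt, z) \<in> carrier (Top_free M (?m - k)) \<longleftrightarrow> (u, ut, z, zt) \<in> carrier (Top_free M k)" for u ut z zt
    unfolding Top_free_simps(1) deg by auto
  have closed: "zeta_free M k x \<in> carrier (Top_free M (?m - k))" if x: "x \<in> carrier (Top_free M k)" for x
    using x by (cases x) (simp add: z Top_free_simps(1) deg del: power_Suc)
  show ?thesis
  proof (rule isoI)
    show "zeta_free M k \<in> hom (Top_free M k) (Top_free M (?m - k))"
    proof (rule homI)
      fix x y assume "x \<in> carrier (Top_free M k)" "y \<in> carrier (Top_free M k)"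
      then show "zeta_free M k (x \<otimes>\<^bsub>Top_free M k\<^esub> y) = zeta_free M k x \<otimes>\<^bsub>Top_free M (?m - k)\<^esub> zeta_free M k y"
        by (cases x; cases y) (simp add: z Top_free_simps deg U.int_pow_distrib Z.int_pow_distrib del: power_Suc)
    qed (rule closed)
    show "bij_betw (zeta_free M k) (carrier (Top_free M k)) (carrier (Top_free M (?m - k)))"
    \<comment> \<open>As \<open>?e * ?e = 1\<close>, the same power undoes the sign after the
      components are exchanged back.\<close>
    proof (rule bij_betw_byWitness[where f' = "\<lambda>(ut, u, zt, z). (u [^]\<^bsub>?U\<^esub> ?e, ut, z [^]\<^bsub>?Z\<^esub> ?e, zt)"])
      have UU: "(u [^]\<^bsub>?U\<^esub> ?e) [^]\<^bsub>?U\<^esub> ?e = u" if "u \<in> carrier ?U" for u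
        using U.int_pow_pow[OF that, of ?e ?e] that e by simp
      have ZZ: "(z [^]\<^bsub>?Z\<^esub> ?e) [^]\<^bsub>?Z\<^esub> ?e = z" if "z \<in> carrier ?Z" for z
        using Z.int_pow_pow[OF that, of ?e ?e] that e by simp
      show "\<forall>x\<in>carrier (Top_free M k). (\<lambda>(ut, u, zt, z). (u [^]\<^bsub>?U\<^esub> ?e, ut, z [^]\<^bsub>?Z\<^esub> ?e, zt)) (zeta_free M k x) = x"
        by (clarify, simp only: z Top_free_simps(1) UU ZZ prod.case)
      show "\<forall>y\<in>carrier (Top_free M (?m - k)). zeta_free M k ((\<lambda>(ut, u, zt, z). (u [^]\<^bsub>?U\<^esub> ?e, ut, z [^]\<^bsub>?Z\<^esub> ?e, zt)) y) = y"
        by (clarify, simp only: z Top_free_simps(1) deg UU ZZ prod.case)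
      show "zeta_free M k ` carrier (Top_free M k) \<subseteq> carrier (Top_free M (?m - k))"
        using closed by blast
      show "(\<lambda>(ut, u, zt, z). (u [^]\<^bsub>?U\<^esub> ?e, ut, z [^]\<^bsub>?Z\<^esub> ?e, zt)) ` carrier (Top_free M (?m - k)) \<subseteq> carrier (Top_free M k)"
        by (auto simp: Top_free_simps(1) deg simp del: power_Suc)
    qed
  qed
qed

text \<open>The exponent k (m - k) is symmetric in k and m - k, so both forms carry the same sign s,
  and \<epsilon> = - s. As s s = 1, the duality exchanges the first term with the second and the
  third with the fourth.\<close>

lemma sigma_free_zeta_free:
  fixes M :: "('a, 'n::{finite,linorder}) spacetime_data"
  assumes k: "k \<le> CARD('n)"
    and x: "x \<in> carrier (Top_free M k)" and y: "y \<in> carrier (Top_free M k)"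
  shows "sigma_free M S (CARD('n) - k) (zeta_free M k x) (zeta_free M k y) = sigma_free M S k x y"
proof -
  let ?m = "CARD('n)"
  have deg: "int (?m - k) - 1 = int ?m - int k - 1" "int ?m - int (?m - k) - 1 = int k - 1"
    "int (?m - k) = int ?m - int k" "int ?m - int (?m - k) = int k"
    "int ?m - (int ?m - int k) - 1 = int k - 1" "int ?m - (int ?m - int k) = int k"
    using k by (simp_all add: of_nat_diff)
  have pq: "(int ?m - int k - 1) + int k = int ?m - 1" "(int k - 1) + (int ?m - int k) = int ?m - 1" by simp_all
  obtain u ut z zt u' ut' z' zt' where xy: "x = (u, ut, z, zt)" "y = (u', ut', z', zt')"
    by (metis prod.exhaust)
  note mem = x[unfolded xy Top_free_simps(1)] y[unfolded xy Top_free_simps(1)]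
  have nat: "?m - (?m - k) = k" using k by simp
  define s where "s = (- 1 :: int) ^ (k * (?m - k))"
  have s: "s = 1 \<or> s = - 1" unfolding s_def by (rule minus_one_power_cases)
  then have e: "- s = 1 \<or> - s = - 1" by auto
  have zeta: "zeta_free M k (u, ut, z, zt) =
      (ut, u [^]\<^bsub>H_flat (int k - 1) (pts M)\<^esub> (- s), zt, z [^]\<^bsub>H_free (int k) (pts M)\<^esub> (- s))" for u ut z zt
    by (simp add: zeta_free_def Let_def s_def)
  have s': "(- 1 :: int) ^ ((?m - k) * (?m - (?m - k))) = s" by (simp add: s_def nat mult.commute)
  show ?thesis
    using mem s unfolding xy zeta sigma_free_def Let_def prod.case s' deg s_def[symmetric]
    by (auto simp: pairing_sign(2)[OF pq(2) _ _ e] pairing_sign(3)[OF pq(1) _ _ e])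
qed

section \<open>Existence and uniqueness of the functional and of the isomorphism\<close>

lemma is_state_restrict:
  assumes A: "seminormed_star_alg A" and \<psi>: "is_state A \<psi>"
  shows "is_state A (restrict \<psi> (elems A))"
proof -
  interpret seminormed_star_alg A by (rule A)
  show ?thesis using \<psi> by (auto simp: is_state_def continuous_functional_def closed)
qed

lemma cstar_iso_restrict:
  assumes A: "seminormed_star_alg A" and \<Phi>: "cstar_iso A B \<Phi>"
  shows "cstar_iso A B (restrict \<Phi> (elems A))"
proof -
  interpret seminormed_star_alg A by (rule A)
  have "bij_betw (restrict \<Phi> (elems A)) (elems A) (elems B)"
    using cstar_isoD(1)[OF \<Phi>] by (subst bij_betw_cong[of _ _ \<Phi>]) auto
  then show ?thesis using \<Phi> by (auto simp: cstar_iso_def closed)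
qed

lemma bdd_linear_comp_cstar_iso:
  assumes A: "seminormed_star_alg A" and \<Phi>: "cstar_iso A B \<Phi>" and f: "bdd_linear B C f"
  shows "bdd_linear A C (f \<circ> \<Phi>)"
proof -
  obtain K where "\<And>b. b \<in> elems B \<Longrightarrow> nrm C (f b) \<le> K * nrm B b"
    using f unfolding bdd_linear_def by blast
  then have "\<forall>a\<in>elems A. nrm C (f (\<Phi> a)) \<le> K * nrm A a"
    using cstar_isoD(7,8)[OF \<Phi>] by metis
  then have "\<exists>K. \<forall>a\<in>elems A. nrm C (f (\<Phi> a)) \<le> K * nrm A a" by blast
  then show ?thesis
    using f unfolding bdd_linear_def by (auto simp: cstar_isoD[OF \<Phi>])
qed

lemma seminormed_star_alg_W_free: "seminormed_star_alg (W_free M S k)"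
  unfolding W_free_def by (rule weyl_data.seminormed_star_alg_weyl_algebra[OF weyl_data_Top_free])

lemma W_gen_closed: "x \<in> carrier (Top_free M k) \<Longrightarrow> W_gen M S k x \<in> elems (W_free M S k)"
  unfolding W_free_def W_gen_def by (rule weyl_data.weyl_gen_closed[OF weyl_data_Top_free])

text \<open>Values on generators determine a continuous functional on the algebra, and
  extensionality fixes it elsewhere; so the \<open>THE\<close> in \<open>omega_free\<close> can be
  evaluated.\<close>

lemma omega_free_spec_unique:
  assumes "omega_free_spec M S k \<omega>" "omega_free_spec M S k \<omega>'"
  shows "\<omega> = \<omega>'"
proof (rule extensionalityI)
  show "\<omega> \<in> extensional (elems (W_free M S k))" "\<omega>' \<in> extensional (elems (W_free M S k))"
    using assms by (simp_all add: omega_free_spec_def)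
  fix X assume X: "X \<in> elems (W_free M S k)"
  show "\<omega> X = \<omega>' X"
  proof (rule weyl_data.bdd_linear_weyl_eq[OF weyl_data_Top_free seminormed_star_alg_complex_alg
        separated_complex_alg _ _ _ X[unfolded W_free_def]])
    show "bdd_linear (weyl_algebra (Top_free M k) (sigma_free M S k)) complex_alg \<omega>"
      "bdd_linear (weyl_algebra (Top_free M k) (sigma_free M S k)) complex_alg \<omega>'"
      using assms by (simp_all add: omega_free_spec_def bdd_linear_complex_alg W_free_def)
    fix g assume "g \<in> carrier (Top_free M k)"
    then show "\<omega> (weyl_gen (Top_free M k) (sigma_free M S k) g) = \<omega>' (weyl_gen (Top_free M k) (sigma_free M S k) g)"
      using assms by (cases g) (simp add: omega_free_spec_def W_gen_def)
  qed
qed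

lemma omega_free_spec_exists: "\<exists>\<omega>. omega_free_spec M S k \<omega> \<and> is_state (W_free M S k) \<omega>"
proof -
  obtain \<psi> where \<psi>: "is_state (W_free M S k) \<psi>"
    "\<And>g. g \<in> carrier (Top_free M k) \<Longrightarrow> \<psi> (W_gen M S k g) = of_bool (g \<in> flat_subgroup M k)"
    using weyl_isotropic.weyl_state_exists[OF weyl_isotropic_flat_subgroup, of M k S]
    unfolding W_free_def W_gen_def by blast
  \<comment> \<open>The specification prescribes the value off the algebra, so the functional is
    restricted; being a state concerns elements of the algebra only.\<close>
  have "is_state (W_free M S k) (restrict \<psi> (elems (W_free M S k)))"
    by (rule is_state_restrict[OF seminormed_star_alg_W_free \<psi>(1)])
  moreover have "omega_free_spec M S k (restrict \<psi> (elems (W_free M S k)))"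
    unfolding omega_free_spec_def
  proof (intro conjI allI impI)
    show "continuous_functional (W_free M S k) (restrict \<psi> (elems (W_free M S k)))"
      using \<open>is_state (W_free M S k) (restrict \<psi> (elems (W_free M S k)))\<close> by (simp only: is_state_def)
    fix u ut z zt assume g: "(u, ut, z, zt) \<in> carrier (Top_free M k)"
    then show "restrict \<psi> (elems (W_free M S k)) (W_gen M S k (u, ut, z, zt)) =
        (if z = \<one>\<^bsub>H_free (int k) (pts M)\<^esub> \<and> zt = \<one>\<^bsub>H_free (int CARD('b) - int k) (pts M)\<^esub> then 1 else 0)"
      using W_gen_closed[OF g, of S] \<psi>(2)[OF g] by (simp add: flat_subgroup_def)
  qed simp
  ultimately show ?thesis by blast
qed

text \<open>Here the isomorphism serves as a bounded linear map into a separated algebra.\<close>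

lemma W_zeta_spec_unique:
  assumes "W_zeta_spec M S k \<Phi>" "W_zeta_spec M S k \<Phi>'"
  shows "\<Phi> = \<Phi>'"
proof (rule extensionalityI)
  show "\<Phi> \<in> extensional (elems (W_free M S k))" "\<Phi>' \<in> extensional (elems (W_free M S k))"
    using assms by (simp_all add: W_zeta_spec_def)
  fix X assume X: "X \<in> elems (W_free M S k)"
  show "\<Phi> X = \<Phi>' X"
  proof (rule weyl_data.bdd_linear_weyl_eq[OF weyl_data_Top_free seminormed_star_alg_W_free
        weyl_data.separated_weyl_algebra[OF weyl_data_Top_free, folded W_free_def] _ _ _ X[unfolded W_free_def]])
    show "bdd_linear (weyl_algebra (Top_free M k) (sigma_free M S k)) (W_free M S (CARD('b) - k)) \<Phi>"
      "bdd_linear (weyl_algebra (Top_free M k) (sigma_free M S k)) (W_free M S (CARD('b) - k)) \<Phi>'"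
      using assms by (auto simp: W_zeta_spec_def W_free_def[of M S k] intro!: bdd_linear_cstar_iso)
    fix g assume "g \<in> carrier (Top_free M k)"
    then show "\<Phi> (weyl_gen (Top_free M k) (sigma_free M S k) g) = \<Phi>' (weyl_gen (Top_free M k) (sigma_free M S k) g)"
      using assms by (simp add: W_zeta_spec_def W_gen_def[of M S k])
  qed
qed

lemma W_zeta_spec_exists:
  fixes M :: "('a, 'n::{finite,linorder}) spacetime_data"
  assumes k: "k \<le> CARD('n)"
  shows "\<exists>\<Phi>. W_zeta_spec M S k \<Phi>"
proof -
  have "\<exists>\<Phi>. cstar_iso (W_free M S k) (W_free M S (CARD('n) - k)) \<Phi> \<and>
    (\<forall>g\<in>carrier (Top_free M k). \<Phi> (W_gen M S k g) = W_gen M S (CARD('n) - k) (zeta_free M k g))"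
    unfolding W_free_def W_gen_def
    by (rule weyl_iso_exists[OF weyl_data_Top_free weyl_data_Top_free zeta_free_iso[OF k]])
      (rule sigma_free_zeta_free[OF k])
  then obtain \<Phi> where \<Phi>: "cstar_iso (W_free M S k) (W_free M S (CARD('n) - k)) \<Phi>"
    "\<And>g. g \<in> carrier (Top_free M k) \<Longrightarrow> \<Phi> (W_gen M S k g) = W_gen M S (CARD('n) - k) (zeta_free M k g)"
    by blast
  have "W_zeta_spec M S k (restrict \<Phi> (elems (W_free M S k)))"
    unfolding W_zeta_spec_def
    by (auto simp: cstar_iso_restrict[OF seminormed_star_alg_W_free \<Phi>(1)] W_gen_closed \<Phi>(2))
  then show ?thesis by blast
qed

lemma omega_free_W_zeta:
  fixes M :: "('a, 'n::{finite,linorder}) spacetime_data"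
  assumes k: "k \<le> CARD('n)"
    and \<omega>: "omega_free_spec M S k \<omega>" and \<omega>': "omega_free_spec M S (CARD('n) - k) \<omega>'"
    and \<Phi>: "W_zeta_spec M S k \<Phi>" and a: "a \<in> elems (W_free M S k)"
  shows "\<omega>' (\<Phi> a) = \<omega> a"
proof -
  let ?m = "CARD('n)"
  have deg: "int (?m - k) = int ?m - int k" "int ?m - (int ?m - int k) = int k"
    using k by (simp_all add: of_nat_diff)
  interpret Z: comm_group "H_free (int k) (pts M)" by (rule comm_group_H_free)
  have "(\<omega>' \<circ> \<Phi>) a = \<omega> a"
  proof (rule weyl_data.bdd_linear_weyl_eq[OF weyl_data_Top_free seminormed_star_alg_complex_alg
        separated_complex_alg _ _ _ a[unfolded W_free_def]])
    have "bdd_linear (W_free M S (?m - k)) complex_alg \<omega>'"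
      using \<omega>' by (simp add: omega_free_spec_def bdd_linear_complex_alg)
    then show "bdd_linear (weyl_algebra (Top_free M k) (sigma_free M S k)) complex_alg (\<omega>' \<circ> \<Phi>)"
      using \<Phi> unfolding W_zeta_spec_def W_free_def[of M S k, symmetric]
      by (blast intro: bdd_linear_comp_cstar_iso[OF seminormed_star_alg_W_free])
    show "bdd_linear (weyl_algebra (Top_free M k) (sigma_free M S k)) complex_alg \<omega>"
      using \<omega> by (simp add: omega_free_spec_def bdd_linear_complex_alg W_free_def)
    fix g assume g: "g \<in> carrier (Top_free M k)"
    obtain u ut z zt where eq: "g = (u, ut, z, zt)" by (metis prod.exhaust)
    let ?e = "(- 1) ^ (k * (?m - k) + 1) :: int"
    have z: "z \<in> carrier (H_free (int k) (pts M))" using g by (simp add: eq Top_free_simps(1))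
    \<comment> \<open>A sign does not change whether a class is trivial, so the exchange of the two
      components preserves the condition that both vanish.\<close>
    have ze: "z [^]\<^bsub>H_free (int k) (pts M)\<^esub> ?e = \<one>\<^bsub>H_free (int k) (pts M)\<^esub> \<longleftrightarrow> z = \<one>\<^bsub>H_free (int k) (pts M)\<^esub>"
      using minus_one_power_cases[of "k * (?m - k) + 1"]
    proof
      assume "?e = 1"
      then show ?thesis unfolding \<open>?e = 1\<close> using z by simp
    next
      assume "?e = - 1"
      then show ?thesis unfolding \<open>?e = - 1\<close> using z by (simp add: Z.int_pow_neg Z.inv_eq_1_iff)
    qed
    have zeta: "zeta_free M k g = (ut, u [^]\<^bsub>H_flat (int k - 1) (pts M)\<^esub> ?e, zt, z [^]\<^bsub>H_free (int k) (pts M)\<^esub> ?e)"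
      by (simp add: eq zeta_free_def Let_def)
    have "zeta_free M k g \<in> carrier (Top_free M (?m - k))"
      using bij_betw_apply[OF _ g] zeta_free_iso[OF k, of M] unfolding iso_def by blast
    then have "\<omega>' (W_gen M S (?m - k) (zeta_free M k g)) =
        (if zt = \<one>\<^bsub>H_free (int (?m - k)) (pts M)\<^esub> \<and>
          z [^]\<^bsub>H_free (int k) (pts M)\<^esub> ?e = \<one>\<^bsub>H_free (int ?m - int (?m - k)) (pts M)\<^esub> then 1 else 0)"
      using \<omega>' unfolding zeta omega_free_spec_def by blast
    also have "\<dots> = (if z = \<one>\<^bsub>H_free (int k) (pts M)\<^esub> \<and> zt = \<one>\<^bsub>H_free (int ?m - int k) (pts M)\<^esub> then 1 else 0)"
      unfolding deg ze by (simp only: conj_commute)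
    also have "\<dots> = \<omega> (W_gen M S k g)"
      using \<omega> g unfolding eq omega_free_spec_def by simp
    finally have "\<omega>' (W_gen M S (?m - k) (zeta_free M k g)) = \<omega> (W_gen M S k g)" .
    then show "(\<omega>' \<circ> \<Phi>) (weyl_gen (Top_free M k) (sigma_free M S k) g) = \<omega> (weyl_gen (Top_free M k) (sigma_free M S k) g)"
      using \<Phi> g by (simp add: W_zeta_spec_def W_gen_def[of M S k])
  qed
  then show ?thesis by simp
qed

theorem proposition4p8:
  fixes M :: "('a, 'n::{finite,linorder}) spacetime_data" and S :: "'a set" and k m :: nat
  assumes "spacetime M" and "m = CARD('n)" and "globally_hyperbolic M"
    and "compact_spacelike_cauchy_surface M S" and "k \<le> m"
  shows "(\<exists>!\<omega>. omega_free_spec M S k \<omega>)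
    \<and> is_state (W_free M S k) (omega_free M S k)
    \<and> (\<exists>!\<Phi>. W_zeta_spec M S k \<Phi>)
    \<and> (\<forall>a \<in> elems (W_free M S k).
          omega_free M S (m - k) (W_zeta M S k a) = omega_free M S k a)"
proof -
  have k: "k \<le> CARD('n)" using assms(2,5) by simp
  \<comment> \<open>Stated for every degree j, since the invariance involves both k and m -
    k.\<close>
  have omega: "omega_free_spec M S j (omega_free M S j) \<and> is_state (W_free M S j) (omega_free M S j)" for j
  proof -
    obtain \<omega> where \<omega>: "omega_free_spec M S j \<omega>" "is_state (W_free M S j) \<omega>"
      using omega_free_spec_exists by blast
    have "omega_free M S j = \<omega>"
      unfolding omega_free_def using \<omega>(1) omega_free_spec_unique by (blast intro: the_equality)
    then show ?thesis using \<omega> by simp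
  qed
  have ex1: "\<exists>!\<Phi>. W_zeta_spec M S k \<Phi>"
    using W_zeta_spec_exists[OF k] W_zeta_spec_unique by blast
  then have zeta: "W_zeta_spec M S k (W_zeta M S k)"
    unfolding W_zeta_def by (rule theI')
  show ?thesis
  proof (intro conjI ballI)
    show "\<exists>!\<omega>. omega_free_spec M S k \<omega>"
      using omega[of k] omega_free_spec_unique by blast
    show "is_state (W_free M S k) (omega_free M S k)" using omega by blast
    show "\<exists>!\<Phi>. W_zeta_spec M S k \<Phi>" by (rule ex1)
    fix a assume "a \<in> elems (W_free M S k)"
    then show "omega_free M S (m - k) (W_zeta M S k a) = omega_free M S k a"
      unfolding assms(2) by (intro omega_free_W_zeta[OF k _ _ zeta]) (simp_all add: omega)
  qed
qed

end
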